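(* Fix $\alpha>0$, $0<\delta<\alpha$, a function $a_2^0$ as in the context, numbers $0<c_1<c_2$, and $\sigma\ge 2$. Then there exist a number $\beta_0>0$ and, for each $\mathcal{B}>0$, a number $\varepsilon_0(\mathcal{B})>0$ such that the following holds. Let $\beta>\beta_0$, let $\mathcal{B}$ satisfy $c_1\beta^\sigma\le \mathcal{B}\le c_2\beta^\sigma$, and let $\Omega$ be a curvilinear upper half-plane with boundary curve $\Gamma$ as described in the context (with the given $\alpha,\delta$) whose signed curvature $\gamma$ satisfies $$\max\left\{\|\gamma\|_{L^\infty(\mathbb{R})},\ \|\dot\gamma\|_{L^\infty(\mathbb{R})}\right\}<\varepsilon_0(\mathcal{B}).$$ Then the discrete spectrum of the magnetic Robin Laplacian $H^{\mathcal{A}}_{\beta,\Omega}$ below $-\beta^2$ is empty, i.e. $\sigma_{\mathrm{disc}}(H^{\mathcal{A}}_{\beta,\Omega})\cap(-\infty,-\beta^2)=\emptyset$.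
   Context: Domain. $\Gamma=\{(a(s),b(s)):s\in\mathbb{R}\}\subset\mathbb{R}^2$ is a smooth ($C^\infty$) simple curve parametrized by arc length, $\dot a(s)^2+\dot b(s)^2=1$ (the dot denotes $d/ds$), with $a(s)\to\pm\infty$ as $s\to\pm\infty$. For given $\alpha>0$ and $0<\delta<\alpha$, the part of $\Gamma$ lying over $x\in(-\infty,-\alpha+\delta)\cup(\alpha-\delta,\infty)$ coincides with the corresponding part of the coordinate axis $\{(x,0):x\in\mathbb{R}\}$. The curvilinear upper half-plane $\Omega$ is the connected component of $\mathbb{R}^2\setminus\Gamma$ lying above $\Gamma$ (the one containing $(0,y)$ for all sufficiently large $y>0$). The signed curvature of $\Gamma$ is $\gamma(s)=\dot b(s)\ddot a(s)-\dot a(s)\ddot b(s)$. Magnetic potential. $\mathcal{A}(x,y)=\mathcal{B}\,\mathcal{A}_0(x,y)$ with $\mathcal{B}>0$ and $\mathcal{A}_0(x,y)=(0,a_2^0(x))$, where $a_2^0:\mathbb{R}\to\mathbb{R}$ is a bounded measurable function with $a_2^0(x)=x$ for $x\in(-\alpha,\alpha)$ and $a_2^0(x)\to0$ as $|x|\to\infty$. Operator. For $\beta>0$, $H^{\mathcal{A}}_{\beta,\Omega}$ is the unique self-adjoint operator in $L^2(\Omega)$ associated with the closed, lower-bounded quadratic form $$q^{\mathcal{A}}_{\beta,\Omega}[\varphi]=\|(i\nabla+\mathcal{A})\varphi\|^2_{L^2(\Omega)}-\beta\int_\Gamma|\varphi|^2\,ds,\qquad \mathrm{Dom}(q^{\mathcal{A}}_{\beta,\Omega})=\mathcal{H}^1(\Omega),$$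 where $\mathcal{H}^1(\Omega)$ is the usual Sobolev space, $ds$ is arc length, and $\varphi$ on $\Gamma$ is understood in the sense of traces. The discrete spectrum consists of isolated eigenvalues of finite multiplicity. *)

theory Defs
  imports "HOL-Analysis.Analysis" "HOL-Probability.Essential_Supremum"
begin

section \<open>Smooth functions\<close>

text \<open>Continuity of all directional derivatives of order at most \<open>k\<close> is the usual
  \<open>C\<^sup>k\<close> condition on a Euclidean space.\<close>

primrec C_k :: "nat \<Rightarrow> ('a::euclidean_space \<Rightarrow> 'b::real_normed_vector) \<Rightarrow> bool" where
  "C_k 0 f \<longleftrightarrow> continuous_on UNIV f"
| "C_k (Suc k) f \<longleftrightarrow> (\<forall>x. f differentiable (at x)) \<and>
     (\<forall>v. C_k k (\<lambda>x. frechet_derivative f (at x) v))"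

definition smooth :: "('a::euclidean_space \<Rightarrow> 'b::real_normed_vector) \<Rightarrow> bool" where
  "smooth f \<longleftrightarrow> (\<forall>k. C_k k f)"

definition test_functions :: "'a::euclidean_space set \<Rightarrow> ('a \<Rightarrow> complex) set" where
  "test_functions \<Omega> = {\<eta>. smooth \<eta> \<and> compact (closure {x. \<eta> x \<noteq> 0}) \<and> closure {x. \<eta> x \<noteq> 0} \<subseteq> \<Omega>}"


section \<open>Square-integrable functions\<close>

text \<open>Elements of \<open>L\<^sup>2\<close> are represented by functions; all notions below are invariant under
  changing a representative on a null set.\<close>

definition L2_space :: "'a measure \<Rightarrow> ('a \<Rightarrow> complex) set" where
  "L2_space M = {f \<in> borel_measurable M. integrable M (\<lambda>x. (cmod (f x))\<^sup>2)}"

definition L2_inner :: "'a measure \<Rightarrow> ('a \<Rightarrow> complex) \<Rightarrow> ('a \<Rightarrow> complex) \<Rightarrow> complex" where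
  "L2_inner M f g = (\<integral>x. f x * cnj (g x) \<partial>M)"

definition L2_norm :: "'a measure \<Rightarrow> ('a \<Rightarrow> complex) \<Rightarrow> real" where
  "L2_norm M f = sqrt (\<integral>x. (cmod (f x))\<^sup>2 \<partial>M)"


section \<open>Sobolev space and traces\<close>

definition has_weak_derivative ::
    "'a::euclidean_space set \<Rightarrow> 'a \<Rightarrow> ('a \<Rightarrow> complex) \<Rightarrow> ('a \<Rightarrow> complex) \<Rightarrow> bool" where
  "has_weak_derivative \<Omega> e u g \<longleftrightarrow>
     (\<forall>\<eta>\<in>test_functions \<Omega>.
        (\<integral>x. u x * frechet_derivative \<eta> (at x) e \<partial>lebesgue_on \<Omega>)
          = - (\<integral>x. g x * \<eta> x \<partial>lebesgue_on \<Omega>))"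

definition sobolev_H1 :: "'a::euclidean_space set \<Rightarrow> ('a \<Rightarrow> complex) set" where
  "sobolev_H1 \<Omega> = {u \<in> L2_space (lebesgue_on \<Omega>).
     \<forall>e\<in>Basis. \<exists>g\<in>L2_space (lebesgue_on \<Omega>). has_weak_derivative \<Omega> e u g}"

text \<open>For open \<open>\<Omega>\<close> the weak derivative is unique up to a null set, so the choice is immaterial.\<close>

definition weak_derivative ::
    "'a::euclidean_space set \<Rightarrow> 'a \<Rightarrow> ('a \<Rightarrow> complex) \<Rightarrow> 'a \<Rightarrow> complex" where
  "weak_derivative \<Omega> e u = (SOME g. g \<in> L2_space (lebesgue_on \<Omega>) \<and> has_weak_derivative \<Omega> e u g)"

definition H1_norm :: "'a::euclidean_space set \<Rightarrow> ('a \<Rightarrow> complex) \<Rightarrow> real" where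
  "H1_norm \<Omega> u = sqrt ((L2_norm (lebesgue_on \<Omega>) u)\<^sup>2 +
     (\<Sum>e\<in>Basis. (L2_norm (lebesgue_on \<Omega>) (weak_derivative \<Omega> e u))\<^sup>2))"

text \<open>The trace on a curve \<open>c\<close> parametrized by arc length is the extension by continuity, from
  the \<open>H\<^sup>1\<close> norm to \<open>L\<^sup>2\<close> of arc length, of the map restricting a smooth compactly supported
  function on the whole space (equivalently, on the closure of \<open>\<Omega>\<close>) to the curve.
  It is a function of the arc length parameter.\<close>

definition has_trace ::
    "'a::euclidean_space set \<Rightarrow> (real \<Rightarrow> 'a) \<Rightarrow> ('a \<Rightarrow> complex) \<Rightarrow> (real \<Rightarrow> complex) \<Rightarrow> bool" where
  "has_trace \<Omega> c u g \<longleftrightarrow> g \<in> L2_space lebesgue \<and>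
     (\<exists>\<phi>. (\<forall>n. \<phi> n \<in> test_functions UNIV \<and> \<phi> n \<circ> c \<in> L2_space lebesgue) \<and>
        (\<lambda>n. H1_norm \<Omega> (\<lambda>x. \<phi> n x - u x)) \<longlonglongrightarrow> 0 \<and>
        (\<lambda>n. L2_norm lebesgue (\<lambda>s. \<phi> n (c s) - g s)) \<longlonglongrightarrow> 0)"

definition boundary_trace ::
    "'a::euclidean_space set \<Rightarrow> (real \<Rightarrow> 'a) \<Rightarrow> ('a \<Rightarrow> complex) \<Rightarrow> real \<Rightarrow> complex" where
  "boundary_trace \<Omega> c u = (SOME g. has_trace \<Omega> c u g)"


section \<open>Operators and discrete spectrum\<close>

text \<open>An operator in \<open>L\<^sup>2\<close> is given by its graph, closed under almost everywhere equality.\<close>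

type_synonym 'a operator_graph = "(('a \<Rightarrow> complex) \<times> ('a \<Rightarrow> complex)) set"

definition polarization :: "(('a \<Rightarrow> complex) \<Rightarrow> real) \<Rightarrow> ('a \<Rightarrow> complex) \<Rightarrow> ('a \<Rightarrow> complex) \<Rightarrow> complex" where
  "polarization q u v = (\<Sum>k<4. \<i> ^ k * complex_of_real (q (\<lambda>x. u x + \<i> ^ k * v x))) / 4"

text \<open>The self-adjoint operator associated with a densely defined closed lower-bounded form by the
  first representation theorem: \<open>u\<close> is in its domain with image \<open>f\<close> iff \<open>q[u,v] = \<langle>f,v\<rangle>\<close> for all
  \<open>v\<close> in the form domain \<open>D\<close>.\<close>

definition form_operator ::
    "'a measure \<Rightarrow> ('a \<Rightarrow> complex) set \<Rightarrow> (('a \<Rightarrow> complex) \<Rightarrow> real) \<Rightarrow> 'a operator_graph" where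
  "form_operator M D q =
     {(u, f). u \<in> D \<and> f \<in> L2_space M \<and> (\<forall>v\<in>D. polarization q u v = L2_inner M f v)}"

text \<open>\<open>z\<close> is in the resolvent set iff \<open>T - z\<close> is onto and has a bounded inverse; the estimate
  includes injectivity.\<close>

definition resolvent_set :: "'a measure \<Rightarrow> 'a operator_graph \<Rightarrow> complex set" where
  "resolvent_set M T = {z.
     (\<forall>f\<in>L2_space M. \<exists>(u, h)\<in>T. AE x in M. h x - z * u x = f x) \<and>
     (\<exists>C. \<forall>(u, h)\<in>T. L2_norm M u \<le> C * L2_norm M (\<lambda>x. h x - z * u x))}"

definition spectrum :: "'a measure \<Rightarrow> 'a operator_graph \<Rightarrow> complex set" where
  "spectrum M T = - resolvent_set M T"

definition eigenspace :: "'a operator_graph \<Rightarrow> complex \<Rightarrow> ('a \<Rightarrow> complex) set" where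
  "eigenspace T z = {u. (u, \<lambda>x. z * u x) \<in> T}"

definition eigenvalue :: "'a measure \<Rightarrow> 'a operator_graph \<Rightarrow> complex \<Rightarrow> bool" where
  "eigenvalue M T z \<longleftrightarrow> (\<exists>u\<in>eigenspace T z. \<not> (AE x in M. u x = 0))"

definition finite_multiplicity :: "'a measure \<Rightarrow> 'a operator_graph \<Rightarrow> complex \<Rightarrow> bool" where
  "finite_multiplicity M T z \<longleftrightarrow>
     (\<exists>F. finite F \<and> F \<subseteq> eigenspace T z \<and>
        (\<forall>u\<in>eigenspace T z. \<exists>c. AE x in M. u x = (\<Sum>w\<in>F. c w * w x)))"

definition discrete_spectrum :: "'a measure \<Rightarrow> 'a operator_graph \<Rightarrow> complex set" where
  "discrete_spectrum M T =
     {z. z isolated_in spectrum M T \<and> eigenvalue M T z \<and> finite_multiplicity M T z}"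


section \<open>The magnetic Robin Laplacian\<close>

definition magnetic_robin_form ::
    "('a::euclidean_space \<Rightarrow> 'a) \<Rightarrow> real \<Rightarrow> 'a set \<Rightarrow> (real \<Rightarrow> 'a) \<Rightarrow> ('a \<Rightarrow> complex) \<Rightarrow> real" where
  "magnetic_robin_form A \<beta> \<Omega> c u =
     (\<Sum>e\<in>Basis. (L2_norm (lebesgue_on \<Omega>)
        (\<lambda>x. \<i> * weak_derivative \<Omega> e u x + complex_of_real (A x \<bullet> e) * u x))\<^sup>2)
     - \<beta> * (\<integral>s. (cmod (boundary_trace \<Omega> c u s))\<^sup>2 \<partial>lebesgue)"

definition magnetic_robin_laplacian ::
    "('a::euclidean_space \<Rightarrow> 'a) \<Rightarrow> real \<Rightarrow> 'a set \<Rightarrow> (real \<Rightarrow> 'a) \<Rightarrow> 'a operator_graph" where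
  "magnetic_robin_laplacian A \<beta> \<Omega> c =
     form_operator (lebesgue_on \<Omega>) (sobolev_H1 \<Omega>) (magnetic_robin_form A \<beta> \<Omega> c)"

definition magnetic_potential :: "real \<Rightarrow> (real \<Rightarrow> real) \<Rightarrow> real \<times> real \<Rightarrow> real \<times> real" where
  "magnetic_potential B a20 = (\<lambda>(x, y). B *\<^sub>R (0, a20 x))"


section \<open>Curvilinear half-planes\<close>

definition signed_curvature :: "(real \<Rightarrow> real) \<Rightarrow> (real \<Rightarrow> real) \<Rightarrow> real \<Rightarrow> real" where
  "signed_curvature a b s = deriv b s * deriv (deriv a) s - deriv a s * deriv (deriv b) s"

definition Linf_norm :: "(real \<Rightarrow> real) \<Rightarrow> ereal" where
  "Linf_norm f = esssup lborel (\<lambda>s. ereal \<bar>f s\<bar>)"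

definition admissible_curve :: "real \<Rightarrow> real \<Rightarrow> (real \<Rightarrow> real) \<Rightarrow> (real \<Rightarrow> real) \<Rightarrow> bool" where
  "admissible_curve \<alpha> \<delta> a b \<longleftrightarrow>
     smooth a \<and> smooth b \<and> inj (\<lambda>s. (a s, b s)) \<and>
     (\<forall>s. (deriv a s)\<^sup>2 + (deriv b s)\<^sup>2 = 1) \<and>
     filterlim a at_top at_top \<and> filterlim a at_bot at_bot \<and>
     range (\<lambda>s. (a s, b s)) \<inter> ({..<-\<alpha>+\<delta>} \<union> {\<alpha>-\<delta><..}) \<times> UNIV
       = ({..<-\<alpha>+\<delta>} \<union> {\<alpha>-\<delta><..}) \<times> {0}"

definition curvilinear_upper_half_plane ::
    "(real \<Rightarrow> real) \<Rightarrow> (real \<Rightarrow> real) \<Rightarrow> (real \<times> real) set \<Rightarrow> bool" where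
  "curvilinear_upper_half_plane a b \<Omega> \<longleftrightarrow>
     \<Omega> \<in> components (- range (\<lambda>s. (a s, b s))) \<and> (\<forall>\<^sub>F y in at_top. (0, y) \<in> \<Omega>)"

end

theory Submission
  imports Defs
begin

text \<open>Everything rests on the inequality \<open>q[\<phi>] \<ge> - \<beta>\<^sup>2 \<parallel>\<phi>\<parallel>\<^sup>2\<close> for test functions \<open>\<phi>\<close>. For small
  curvature \<open>\<Gamma>\<close> is the graph of a function \<open>h\<close> and \<open>\<Omega>\<close> is the region above it. The potential
  is vertical and depends on \<open>x\<close> only, so on each vertical line, with the number \<open>A = B * a20 x\<close>,
  one can complete the square:
    \<open>\<integral> \<bar>(\<i> \<partial>\<^sub>y + A) \<phi>\<bar>\<^sup>2 + \<beta>\<^sup>2 \<bar>\<phi>\<bar>\<^sup>2 dy = \<beta> \<bar>\<phi> (x, h x)\<bar>\<^sup>2 + \<integral> \<bar>g\<bar>\<^sup>2 dy\<close>,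
    \<open>g = (\<partial>\<^sub>y - \<i> A + \<beta>) \<phi>\<close>
  (\<open>robin_half_line\<close>). Integrating over \<open>x\<close>, the form plus \<open>\<beta>\<^sup>2 \<parallel>\<phi>\<parallel>\<^sup>2\<close> becomes
    \<open>\<integral> \<bar>\<partial>\<^sub>x \<phi>\<bar>\<^sup>2 + \<integral> \<bar>g\<bar>\<^sup>2 - \<beta> \<integral>\<^sub>\<Gamma> \<bar>\<phi>\<bar>\<^sup>2 (ds - dx)\<close>.
  The only negative term comes from the excess of arc length over \<open>dx\<close>. It lives over
  \<open>\<bar>x\<bar> \<le> \<alpha> - \<delta>\<close>, and its density is small when the curvature is small
  (\<open>admissible_curve_almost_straight\<close>, \<open>arc_length_integral_le\<close>).

  The magnetic field absorbs it. Over \<open>\<bar>x\<bar> < \<alpha>\<close> the operators \<open>\<partial>\<^sub>x\<close> and \<open>\<partial>\<^sub>y - \<i> B x + \<beta>\<close> do not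
  commute: transport around a rectangle of width \<open>t\<close> and height \<open>s\<close> with \<open>B * t * s = pi\<close>
  multiplies by \<open>-1\<close>. A function that is almost parallel along the sides of the rectangle is
  therefore almost zero at its corners, and transport down to the boundary gives a Hardy type inequality
    \<open>\<integral>\<^bsub>\<bar>x\<bar> \<le> \<alpha> - \<delta>\<^esub> \<bar>\<phi> (x, h x)\<bar>\<^sup>2 dx \<le> K (\<integral> \<bar>\<partial>\<^sub>x \<phi>\<bar>\<^sup>2 + \<integral> \<bar>g\<bar>\<^sup>2)\<close>
  (\<open>holonomy_estimate\<close>, \<open>holonomy_hardy\<close>). The constant \<open>K\<close> depends on the curve only through a
  bound for \<open>\<bar>h\<bar>\<close>, and on \<open>\<beta>\<close> only through an upper bound; the latter is supplied by
  \<open>c1 * \<beta> powr \<sigma> \<le> B\<close>. Hence the admissible size of the curvature depends on \<open>B\<close> alone.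

  Let now \<open>u\<close> be an eigenfunction for \<open>E < - \<beta>\<^sup>2\<close>. The eigenvalue equation tested with a real
  multiple \<open>t u\<close> reads \<open>4 t E \<parallel>u\<parallel>\<^sup>2 = q[(1 + t) u] - q[(1 - t) u]\<close>. If \<open>2 u\<close> has a trace, the inequality for
  test functions passes to the limit (\<open>magnetic_robin_inequality_closure\<close>), and \<open>t = 1\<close> gives
  \<open>E \<ge> - \<beta>\<^sup>2\<close> because \<open>q[0] \<le> 0\<close>. If it has none, no nonzero multiple of \<open>u\<close> has one, the
  boundary terms of \<open>3 u\<close> and \<open>- u\<close> agree, and \<open>t = 2\<close> leaves only the magnetic energy, so
  \<open>E \<ge> 0\<close> (\<open>magnetic_robin_no_eigenvalue_below\<close>). Scaling of the energy and of the \<open>H\<^sup>1\<close> norm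
  requires that weak derivatives are unique almost everywhere, which is the fundamental lemma of the calculus of
  variations (\<open>fundamental_lemma_calculus_of_variations\<close>).\<close>

section \<open>Smooth functions and test functions\<close>

lemma smooth_differentiable: "smooth f \<Longrightarrow> f differentiable (at x)"
  unfolding smooth_def by (metis C_k.simps(2))

lemma smooth_frechet_derivative: "smooth f \<Longrightarrow> smooth (\<lambda>x. frechet_derivative f (at x) v)"
  unfolding smooth_def by (metis C_k.simps(2))

lemma smooth_continuous_on: "smooth f \<Longrightarrow> continuous_on S f"
  unfolding smooth_def by (metis C_k.simps(1) continuous_on_subset subset_UNIV)

lemma C_k_SucD: "C_k (Suc k) f \<Longrightarrow> C_k k f"
proof (induction k arbitrary: f)
  case 0
  then show ?case
    by (auto intro!: differentiable_imp_continuous_on simp: differentiable_on_def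
        intro: differentiable_at_withinI)
next
  case (Suc k)
  then show ?case by (metis C_k.simps(2))
qed

lemma C_k_const: "C_k k (\<lambda>x. c)"
  by (induction k arbitrary: c) auto

lemma C_k_add: "C_k k f \<Longrightarrow> C_k k g \<Longrightarrow> C_k k (\<lambda>x. f x + g x)"
proof (induction k arbitrary: f g)
  case 0
  then show ?case by (auto intro: continuous_intros)
next
  case (Suc k)
  then have df: "f differentiable (at x)" and dg: "g differentiable (at x)" for x by auto
  have "frechet_derivative (\<lambda>x. f x + g x) (at x)
      = (\<lambda>v. frechet_derivative f (at x) v + frechet_derivative g (at x) v)" for x
    by (intro frechet_derivative_at[symmetric] has_derivative_add
        frechet_derivative_works[THEN iffD1] df dg)
  then show ?case using Suc df dg by auto
qed

lemma C_k_bounded_linear: "bounded_linear T \<Longrightarrow> C_k k f \<Longrightarrow> C_k k (\<lambda>x. T (f x))"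
proof (induction k arbitrary: f)
  case 0
  then show ?case by (auto intro: bounded_linear.continuous_on)
next
  case (Suc k)
  then have df: "f differentiable (at x)" for x by auto
  have D: "((\<lambda>x. T (f x)) has_derivative (\<lambda>v. T (frechet_derivative f (at x) v))) (at x)" for x
    by (rule bounded_linear.has_derivative[OF Suc.prems(1) frechet_derivative_works[THEN iffD1, OF df]])
  have eq: "frechet_derivative (\<lambda>x. T (f x)) (at x) = (\<lambda>v. T (frechet_derivative f (at x) v))" for x
    by (rule frechet_derivative_at[OF D, symmetric])
  have "(\<lambda>x. T (f x)) differentiable (at x)" for x using D differentiable_def by blast
  moreover have "C_k k (\<lambda>x. T (frechet_derivative f (at x) v))" for v using Suc by simp
  ultimately show ?case by (simp add: eq)
qed

lemma C_k_mult:
  fixes f g :: "'a::euclidean_space \<Rightarrow> 'b::real_normed_algebra"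
  shows "C_k k f \<Longrightarrow> C_k k g \<Longrightarrow> C_k k (\<lambda>x. f x * g x)"
proof (induction k arbitrary: f g)
  case 0
  then show ?case by (auto intro: continuous_intros)
next
  case (Suc k)
  then have df: "f differentiable (at x)" and dg: "g differentiable (at x)" for x by auto
  have D: "((\<lambda>x. f x * g x) has_derivative
      (\<lambda>v. f x * frechet_derivative g (at x) v + frechet_derivative f (at x) v * g x)) (at x)" for x
    by (intro has_derivative_mult frechet_derivative_works[THEN iffD1] df dg)
  have eq: "frechet_derivative (\<lambda>x. f x * g x) (at x)
      = (\<lambda>v. f x * frechet_derivative g (at x) v + frechet_derivative f (at x) v * g x)" for x
    by (rule frechet_derivative_at[OF D, symmetric])
  have "C_k k f" "C_k k g" using Suc.prems by (auto intro: C_k_SucD)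
  then have "C_k k (\<lambda>x. f x * frechet_derivative g (at x) v + frechet_derivative f (at x) v * g x)" for v
    using Suc by (intro C_k_add Suc.IH) auto
  moreover have "(\<lambda>x. f x * g x) differentiable (at x)" for x using D differentiable_def by blast
  ultimately show ?case by (simp add: eq)
qed

lemma smooth_const: "smooth (\<lambda>x. c)"
  by (simp add: smooth_def C_k_const)

lemma smooth_bounded_linear: "bounded_linear T \<Longrightarrow> smooth f \<Longrightarrow> smooth (\<lambda>x. T (f x))"
  by (simp add: smooth_def C_k_bounded_linear)

lemma smooth_mult:
  fixes f g :: "'a::euclidean_space \<Rightarrow> 'b::real_normed_algebra"
  shows "smooth f \<Longrightarrow> smooth g \<Longrightarrow> smooth (\<lambda>x. f x * g x)"
  by (simp add: smooth_def C_k_mult)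

lemma smooth_prod:
  fixes f :: "'i \<Rightarrow> 'a::euclidean_space \<Rightarrow> 'b::{real_normed_algebra,comm_ring_1}"
  assumes "\<And>i. i \<in> I \<Longrightarrow> smooth (f i)"
  shows "smooth (\<lambda>x. \<Prod>i\<in>I. f i x)"
  using assms by (induction I rule: infinite_finite_induct) (auto intro: smooth_const smooth_mult)

lemma C_k_compose_affine:
  fixes f :: "real \<Rightarrow> 'b::real_normed_vector" and l :: "'a::euclidean_space \<Rightarrow> real"
  assumes l: "bounded_linear l"
  shows "C_k k f \<Longrightarrow> C_k k (\<lambda>x. f (l x + d))"
proof (induction k arbitrary: f)
  case 0
  then have "continuous_on UNIV f" by simp
  then show ?case
    using continuous_on_compose2[OF _ continuous_on_add[OF linear_continuous_on[OF l] continuous_on_const] subset_UNIV]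
    by auto
next
  case (Suc k)
  then have df: "f differentiable (at x)" for x by auto
  have lin: "frechet_derivative f (at y) (l v) = l v *\<^sub>R frechet_derivative f (at y) 1" for y v
    using linear_frechet_derivative[OF df, of y] by (metis linear_scale mult.right_neutral real_scaleR_def)
  have D: "((\<lambda>x. f (l x + d)) has_derivative
      (\<lambda>v. frechet_derivative f (at (l x + d)) (l v))) (at x)" for x
    by (rule has_derivative_compose[of "\<lambda>x. l x + d" l x UNIV f, simplified])
      (auto intro!: derivative_eq_intros bounded_linear_imp_has_derivative l
        frechet_derivative_works[THEN iffD1] df)
  have eq: "frechet_derivative (\<lambda>x. f (l x + d)) (at x) v
      = l v *\<^sub>R frechet_derivative f (at (l x + d)) 1" for x v
    using frechet_derivative_at[OF D] lin by metis
  have "C_k k (\<lambda>x. l v *\<^sub>R frechet_derivative f (at (l x + d)) 1)" for v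
    using Suc by (intro C_k_bounded_linear[OF bounded_linear_scaleR_right]) auto
  moreover have "(\<lambda>x. f (l x + d)) differentiable (at x)" for x using D differentiable_def by blast
  ultimately show ?case by (simp add: eq)
qed

lemma smooth_compose_affine:
  fixes f :: "real \<Rightarrow> 'b::real_normed_vector" and l :: "'a::euclidean_space \<Rightarrow> real"
  assumes "bounded_linear l" "smooth f"
  shows "smooth (\<lambda>x. f (l x + d))"
  using assms by (simp add: smooth_def C_k_compose_affine)

text \<open>For \<open>p = 1\<close> this is the classical flat function \<open>exp (- 1 / x)\<close>; the polynomial factor makes the
  family closed under differentiation.\<close>

definition flat_fun :: "real poly \<Rightarrow> real \<Rightarrow> real" where
  "flat_fun p x = (if x > 0 then poly p (inverse x) * exp (- inverse x) else 0)"

lemma poly_exp_decay: "((\<lambda>t. t ^ k * poly p t * exp (- t)) \<longlongrightarrow> 0) (at_top :: real filter)"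
proof (induction p arbitrary: k)
  case 0
  then show ?case by simp
next
  case (pCons a p)
  have "((\<lambda>t::real. a * (t ^ k / exp t) + t ^ Suc k * poly p t * exp (- t)) \<longlongrightarrow> a * 0 + 0) at_top"
    by (intro tendsto_add tendsto_mult tendsto_const tendsto_power_div_exp_0 pCons.IH)
  then show ?case by (simp add: algebra_simps exp_minus field_simps)
qed

text \<open>In terms of \<open>\<tau> = 1 / x\<close>, differentiating \<open>p(\<tau>) exp (- \<tau>)\<close> in \<open>x\<close> gives
  \<open>\<tau>\<^sup>2 (p - p')(\<tau>) exp (- \<tau>)\<close>. At \<open>0\<close> the difference quotient is \<open>\<tau> p(\<tau>) exp (- \<tau>)\<close>, which tends to \<open>0\<close>.\<close>

lemma has_real_derivative_flat_fun:
  "(flat_fun p has_real_derivative flat_fun ([:0, 0, 1:] * (p - pderiv p)) x) (at x)"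
proof -
  consider "x > 0" | "x < 0" | "x = 0" by linarith
  then show ?thesis
  proof cases
    case 1
    have "((\<lambda>x. poly p (inverse x) * exp (- inverse x)) has_real_derivative
        flat_fun ([:0, 0, 1:] * (p - pderiv p)) x) (at x)"
      using 1 by (auto intro!: derivative_eq_intros DERIV_chain2[OF poly_DERIV]
          simp: flat_fun_def field_simps power2_eq_square)
    then show ?thesis
      by (rule has_field_derivative_transform_within_open[where S="{0<..}"])
        (use 1 in \<open>auto simp: flat_fun_def\<close>)
  next
    case 2
    have "((\<lambda>x. 0) has_real_derivative flat_fun ([:0, 0, 1:] * (p - pderiv p)) x) (at x)"
      using 2 by (auto simp: flat_fun_def)
    then show ?thesis
      by (rule has_field_derivative_transform_within_open[where S="{..<0}"])
        (use 2 in \<open>auto simp: flat_fun_def\<close>)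
  next
    case 3
    have "((\<lambda>h. flat_fun p h / h) \<longlongrightarrow> 0) (at 0)"
    proof (rule filterlim_split_at_real)
      have "((\<lambda>h. inverse h ^ 1 * poly p (inverse h) * exp (- inverse h)) \<longlongrightarrow> 0) (at_right (0::real))"
        by (rule filterlim_compose[OF poly_exp_decay filterlim_inverse_at_top_right])
      then show "((\<lambda>h. flat_fun p h / h) \<longlongrightarrow> 0) (at_right 0)"
        by (rule Lim_transform_eventually)
          (auto simp: eventually_at_filter flat_fun_def field_simps)
      show "((\<lambda>h. flat_fun p h / h) \<longlongrightarrow> 0) (at_left 0)"
        by (rule Lim_transform_eventually[OF tendsto_const])
          (auto simp: eventually_at_filter flat_fun_def)
    qed
    then show ?thesis using 3 by (simp add: DERIV_def flat_fun_def)
  qed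
qed

lemma smooth_flat_fun: "smooth (flat_fun p)"
proof -
  have "C_k k (flat_fun p)" for k
  proof (induction k arbitrary: p)
    case 0
    then show ?case
      using has_real_derivative_flat_fun by (auto intro!: continuous_at_imp_continuous_on DERIV_isCont)
  next
    case (Suc k)
    let ?q = "[:0, 0, 1:] * (p - pderiv p)"
    have D: "(flat_fun p has_derivative (\<lambda>v. v * flat_fun ?q x)) (at x)" for x
      using has_real_derivative_flat_fun[of p x]
      unfolding has_field_derivative_def by (rule has_derivative_eq_rhs) (simp add: fun_eq_iff mult.commute)
    have eq: "frechet_derivative (flat_fun p) (at x) v = v * flat_fun ?q x" for x v
      using frechet_derivative_at[OF D] by metis
    have "C_k k (\<lambda>x. v * flat_fun ?q x)" for v
      by (rule C_k_bounded_linear[OF bounded_linear_mult_right Suc.IH])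
    moreover have "flat_fun p differentiable (at x)" for x using D differentiable_def by blast
    ultimately show ?case by (simp add: eq)
  qed
  then show ?thesis by (simp add: smooth_def)
qed

definition box_bump :: "nat \<Rightarrow> 'a::euclidean_space \<Rightarrow> 'a \<Rightarrow> 'a \<Rightarrow> real" where
  "box_bump n a b x =
     (\<Prod>e\<in>Basis. flat_fun 1 (real n * (x \<bullet> e - a \<bullet> e)) * flat_fun 1 (real n * (b \<bullet> e - x \<bullet> e)))"

lemma flat_fun_1_bounds: "0 \<le> flat_fun 1 x" "flat_fun 1 x \<le> 1"
  by (auto simp: flat_fun_def)

lemma smooth_box_bump: "smooth (box_bump n a b)"
proof -
  have "smooth (\<lambda>x. flat_fun 1 (real n * (x \<bullet> e - a \<bullet> e)))" for e :: 'a
    using smooth_compose_affine[OF _ smooth_flat_fun, of "\<lambda>x. real n * (x \<bullet> e)" 1 "- real n * (a \<bullet> e)"]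
    by (simp add: algebra_simps bounded_linear_const_mult bounded_linear_inner_left)
  moreover have "smooth (\<lambda>x. flat_fun 1 (real n * (b \<bullet> e - x \<bullet> e)))" for e :: 'a
    using smooth_compose_affine[OF _ smooth_flat_fun, of "\<lambda>x. (- real n) * (x \<bullet> e)" 1 "real n * (b \<bullet> e)"]
    by (simp add: algebra_simps bounded_linear_const_mult bounded_linear_inner_left bounded_linear_minus)
  ultimately have "smooth (\<lambda>x. \<Prod>e\<in>Basis. flat_fun 1 (real n * (x \<bullet> e - a \<bullet> e)) *
      flat_fun 1 (real n * (b \<bullet> e - x \<bullet> e)))"
    by (intro smooth_prod smooth_mult)
  then show ?thesis by (simp add: box_bump_def[abs_def])
qed

lemma box_bump_bounds: "0 \<le> box_bump n a b x" "box_bump n a b x \<le> 1"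
  unfolding box_bump_def
  by (auto intro!: prod_nonneg prod_le_1 mult_nonneg_nonneg mult_le_one flat_fun_1_bounds)

lemma box_bump_eq_0: "x \<notin> box a b \<Longrightarrow> box_bump n a b x = 0"
  unfolding box_bump_def
  by (force simp: mem_box flat_fun_def zero_less_mult_iff not_less intro!: prod_zero)

text \<open>The support does not move with \<open>n\<close>, but \<open>exp (- 1 / (n * \<tau>))\<close> tends to \<open>1\<close> for each
  \<open>\<tau> > 0\<close>: smooth functions supported in a closed box approximate the indicator of its interior from inside.\<close>

lemma box_bump_tendsto_indicator:
  "(\<lambda>n. box_bump n a b x) \<longlonglongrightarrow> indicator (box a b) x"
proof (cases "x \<in> box a b")
  case True
  have lim: "(\<lambda>n. flat_fun 1 (real n * t)) \<longlonglongrightarrow> 1" if "t > 0" for t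
  proof -
    have "filterlim (\<lambda>n. real n * t) at_top sequentially"
      using that by (simp add: filterlim_real_sequentially
          filterlim_tendsto_pos_mult_at_top[OF tendsto_const] mult.commute[of _ t])
    then have "(\<lambda>n. exp (- inverse (real n * t))) \<longlonglongrightarrow> exp (- 0)"
      by (intro tendsto_intros tendsto_inverse_0_at_top)
    then show ?thesis
      by (rule Lim_transform_eventually[OF tendsto_eq_rhs])
        (use that in \<open>auto simp: flat_fun_def eventually_sequentially intro!: exI[of _ 1]\<close>)
  qed
  have "(\<lambda>n. box_bump n a b x) \<longlonglongrightarrow> (\<Prod>e\<in>(Basis::'a set). 1 * 1)"
    unfolding box_bump_def
    using True by (intro tendsto_prod tendsto_mult lim) (auto simp: mem_box)
  then show ?thesis using True by simp
qed (simp add: box_bump_eq_0)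

lemma box_bump_test_function:
  assumes "cbox a b \<subseteq> \<Omega>"
  shows "(\<lambda>x. complex_of_real (box_bump n a b x)) \<in> test_functions \<Omega>"
proof -
  have sub: "closure {x. complex_of_real (box_bump n a b x) \<noteq> 0} \<subseteq> cbox a b"
    using box_bump_eq_0 box_subset_cbox by (intro closure_minimal) fastforce+
  then have "compact (closure {x. complex_of_real (box_bump n a b x) \<noteq> 0})"
    by (meson bounded_cbox bounded_subset closed_closure compact_eq_bounded_closed)
  then show ?thesis
    using sub assms smooth_bounded_linear[OF bounded_linear_of_real smooth_box_bump]
    by (auto simp: test_functions_def)
qed

lemma test_functions_smooth: "\<phi> \<in> test_functions \<Omega> \<Longrightarrow> smooth \<phi>"
  by (auto simp: test_functions_def)

lemma test_functions_continuous: "\<phi> \<in> test_functions \<Omega> \<Longrightarrow> continuous_on S \<phi>"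
  using test_functions_smooth smooth_continuous_on by blast

lemma test_functions_has_derivative:
  "\<phi> \<in> test_functions \<Omega> \<Longrightarrow> (\<phi> has_derivative frechet_derivative \<phi> (at x)) (at x)"
  using test_functions_smooth smooth_differentiable frechet_derivative_works by blast

text \<open>The common reason why products, multiples and derivatives of test functions are test functions.\<close>

lemma test_functions_smaller_support:
  assumes "\<phi> \<in> test_functions \<Omega>" "smooth \<psi>" "\<And>x. x \<notin> closure {x. \<phi> x \<noteq> 0} \<Longrightarrow> \<psi> x = 0"
  shows "\<psi> \<in> test_functions \<Omega>"
proof -
  have "{x. \<psi> x \<noteq> 0} \<subseteq> closure {x. \<phi> x \<noteq> 0}" using assms(3) by blast
  then have sub: "closure {x. \<psi> x \<noteq> 0} \<subseteq> closure {x. \<phi> x \<noteq> 0}" by (intro closure_minimal) auto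
  moreover have "compact (closure {x. \<psi> x \<noteq> 0})"
    using assms(1) sub bounded_subset[OF _ sub]
    by (auto simp: test_functions_def compact_eq_bounded_closed)
  ultimately show ?thesis using assms(1,2) by (auto simp: test_functions_def)
qed

lemma test_functions_frechet_derivative:
  assumes "\<phi> \<in> test_functions \<Omega>"
  shows "(\<lambda>x. frechet_derivative \<phi> (at x) v) \<in> test_functions \<Omega>"
proof (rule test_functions_smaller_support[OF assms])
  show "smooth (\<lambda>x. frechet_derivative \<phi> (at x) v)"
    using assms by (intro smooth_frechet_derivative test_functions_smooth)
  fix x assume x: "x \<notin> closure {x. \<phi> x \<noteq> 0}"
  have "((\<lambda>x. 0) has_derivative frechet_derivative \<phi> (at x)) (at x)"
    by (rule has_derivative_transform_within_open[OF test_functions_has_derivative[OF assms],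
          of "- closure {x. \<phi> x \<noteq> 0}"])
      (use x closure_subset[of "{x. \<phi> x \<noteq> 0}"] in auto)
  then show "frechet_derivative \<phi> (at x) v = 0"
    by (metis frechet_derivative_at frechet_derivative_const)
qed

lemma test_functions_cmult:
  assumes "\<phi> \<in> test_functions \<Omega>"
  shows "(\<lambda>x. c * \<phi> x) \<in> test_functions \<Omega>"
  by (rule test_functions_smaller_support[OF assms])
    (use assms closure_subset[of "{x. \<phi> x \<noteq> 0}"] in
      \<open>auto intro!: smooth_mult smooth_const simp: test_functions_smooth\<close>)

lemma test_functions_mult:
  assumes "\<phi> \<in> test_functions \<Omega>" "\<psi> \<in> test_functions \<Omega>'"
  shows "(\<lambda>x. \<phi> x * \<psi> x) \<in> test_functions \<Omega>"
  by (rule test_functions_smaller_support[OF assms(1)])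
    (use assms closure_subset[of "{x. \<phi> x \<noteq> 0}"] in
      \<open>auto intro!: smooth_mult smooth_const simp: test_functions_smooth\<close>)

lemma test_functions_bounded_support:
  assumes "\<phi> \<in> test_functions \<Omega>"
  obtains R where "R > 0" "\<And>x. norm x > R \<Longrightarrow> \<phi> x = 0"
proof -
  have "bounded (closure {x. \<phi> x \<noteq> 0})"
    using assms compact_imp_bounded by (auto simp: test_functions_def)
  then have "bounded {x. \<phi> x \<noteq> 0}"
    by (rule bounded_subset) (rule closure_subset)
  then obtain R where "R > 0" "\<And>x. \<phi> x \<noteq> 0 \<Longrightarrow> norm x \<le> R" unfolding bounded_pos by auto
  then show ?thesis using that[of R] by force
qed

lemma test_functions_bounded:
  assumes "\<phi> \<in> test_functions \<Omega>"
  obtains C where "\<And>x. cmod (\<phi> x) \<le> C"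
proof -
  let ?K = "closure {x. \<phi> x \<noteq> 0}"
  have "compact (\<phi> ` ?K)"
    using assms by (intro compact_continuous_image test_functions_continuous[OF assms])
      (auto simp: test_functions_def)
  then have "bounded (\<phi> ` ?K)" by (rule compact_imp_bounded)
  then obtain C where C: "\<And>x. x \<in> ?K \<Longrightarrow> cmod (\<phi> x) \<le> C"
    unfolding bounded_iff by blast
  have "cmod (\<phi> x) \<le> max C 0" for x
  proof (cases "\<phi> x = 0")
    case False
    then have "x \<in> ?K" using closure_subset[of "{x. \<phi> x \<noteq> 0}"] by auto
    then show ?thesis using C[of x] by simp
  qed simp
  then show ?thesis by (rule that)
qed

lemma test_functions_borel: "\<phi> \<in> test_functions \<Omega> \<Longrightarrow> \<phi> \<in> borel_measurable borel"
  by (intro borel_measurable_continuous_onI test_functions_continuous)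

lemma bounded_measurable_times_test_integrable:
  assumes "\<phi> \<in> test_functions \<Omega>" "w \<in> borel_measurable lebesgue" "\<And>x. cmod (w x) \<le> C"
  shows "integrable lebesgue (\<lambda>x. w x * \<phi> x)"
proof -
  obtain R where R: "\<And>x. norm x > R \<Longrightarrow> \<phi> x = 0" using test_functions_bounded_support[OF assms(1)] by blast
  obtain D where D: "\<And>x. cmod (\<phi> x) \<le> D" using test_functions_bounded[OF assms(1)] by blast
  have *: "integrable lebesgue (indicat_real (cball 0 R :: 'a set))"
    using emeasure_bounded_finite[OF bounded_cball] by (intro integrable_real_indicator) auto
  show ?thesis
  proof (rule Bochner_Integration.integrable_bound[OF integrable_mult_right[OF *, of "C * D"]])
    show "(\<lambda>x. w x * \<phi> x) \<in> borel_measurable lebesgue"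
      using assms(2) test_functions_borel[OF assms(1)]
      by (intro borel_measurable_times) (auto intro: measurable_completion)
    have "0 \<le> C" "0 \<le> D" using assms(3)[of 0] D[of 0] norm_ge_zero order_trans by blast+
    have "cmod (w x * \<phi> x) \<le> norm (C * D * indicat_real (cball 0 R) x)" for x
    proof (cases "norm x > R")
      case False
      then show ?thesis using mult_mono[OF assms(3) D \<open>0 \<le> C\<close>] \<open>0 \<le> C\<close> \<open>0 \<le> D\<close>
        by (auto simp: norm_mult indicator_def)
    qed (use R in auto)
    then show "AE x in lebesgue. norm (w x * \<phi> x) \<le> norm (C * D * indicat_real (cball 0 R) x)" by auto
  qed
qed

section \<open>Square-integrable functions\<close>

lemma cmod_add_sq_le: "(cmod (a + b))\<^sup>2 \<le> 2 * (cmod a)\<^sup>2 + 2 * (cmod b)\<^sup>2"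
proof -
  have "(cmod (a + b))\<^sup>2 \<le> (cmod a + cmod b)\<^sup>2" by (intro power_mono norm_triangle_ineq) auto
  also have "\<dots> \<le> 2 * (cmod a)\<^sup>2 + 2 * (cmod b)\<^sup>2"
    using sum_squares_bound[of "cmod a" "cmod b"] by (simp add: power2_sum)
  finally show ?thesis .
qed

lemma L2_space_integrable: "f \<in> L2_space M \<Longrightarrow> integrable M (\<lambda>x. (cmod (f x))\<^sup>2)"
  by (simp add: L2_space_def)

lemma L2_norm_nonneg: "0 \<le> L2_norm M f"
  by (simp add: L2_norm_def)

lemma L2_norm_power2: "(L2_norm M f)\<^sup>2 = (\<integral>x. (cmod (f x))\<^sup>2 \<partial>M)"
  by (simp add: L2_norm_def)

lemma L2_space_cmult: "f \<in> L2_space M \<Longrightarrow> (\<lambda>x. c * f x) \<in> L2_space M"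
  by (auto simp: L2_space_def norm_mult power_mult_distrib)

lemma L2_space_add:
  assumes "f \<in> L2_space M" "g \<in> L2_space M"
  shows "(\<lambda>x. f x + g x) \<in> L2_space M"
proof -
  have [measurable]: "f \<in> borel_measurable M" "g \<in> borel_measurable M"
    using assms by (auto simp: L2_space_def)
  have "integrable M (\<lambda>x. (cmod (f x + g x))\<^sup>2)"
  proof (rule Bochner_Integration.integrable_bound)
    show "integrable M (\<lambda>x. 2 * (cmod (f x))\<^sup>2 + 2 * (cmod (g x))\<^sup>2)"
      using assms by (auto simp: L2_space_def)
  qed (auto intro!: cmod_add_sq_le)
  then show ?thesis by (simp add: L2_space_def)
qed

lemma L2_space_diff:
  "f \<in> L2_space M \<Longrightarrow> g \<in> L2_space M \<Longrightarrow> (\<lambda>x. f x - g x) \<in> L2_space M"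
  using L2_space_add[of f M "\<lambda>x. (-1) * g x"] L2_space_cmult[of g M "-1"] by simp

lemma L2_space_bounded_mult:
  assumes "f \<in> L2_space M" and [measurable]: "w \<in> borel_measurable M" and "\<And>x. cmod (w x) \<le> C"
  shows "(\<lambda>x. w x * f x) \<in> L2_space M"
proof -
  have [measurable]: "f \<in> borel_measurable M" using assms by (auto simp: L2_space_def)
  have "integrable M (\<lambda>x. (cmod (w x * f x))\<^sup>2)"
  proof (rule Bochner_Integration.integrable_bound)
    show "integrable M (\<lambda>x. C\<^sup>2 * (cmod (f x))\<^sup>2)"
      using assms by (auto simp: L2_space_def)
    have "(cmod (w x * f x))\<^sup>2 \<le> C\<^sup>2 * (cmod (f x))\<^sup>2" for x
      using assms(3)[of x] by (auto simp: norm_mult power_mult_distrib intro!: mult_right_mono power_mono)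
    then show "AE x in M. norm ((cmod (w x * f x))\<^sup>2) \<le> norm (C\<^sup>2 * (cmod (f x))\<^sup>2)" by auto
  qed auto
  then show ?thesis by (simp add: L2_space_def)
qed

lemma L2_space_mult_integrable:
  assumes "f \<in> L2_space M" "g \<in> L2_space M"
  shows "integrable M (\<lambda>x. f x * g x)"
proof -
  have [measurable]: "f \<in> borel_measurable M" "g \<in> borel_measurable M"
    using assms by (auto simp: L2_space_def)
  show ?thesis
  proof (rule Bochner_Integration.integrable_bound)
    show "integrable M (\<lambda>x. (cmod (f x))\<^sup>2 + (cmod (g x))\<^sup>2)"
      using assms by (auto simp: L2_space_def)
    have "cmod (f x * g x) \<le> (cmod (f x))\<^sup>2 + (cmod (g x))\<^sup>2" for x
    proof -
      have "2 * (cmod (f x) * cmod (g x)) \<le> (cmod (f x))\<^sup>2 + (cmod (g x))\<^sup>2"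
        using sum_squares_bound[of "cmod (f x)" "cmod (g x)"] by simp
      moreover have "0 \<le> cmod (f x) * cmod (g x)" by simp
      ultimately show ?thesis unfolding norm_mult by linarith
    qed
    then show "AE x in M. norm (f x * g x) \<le> norm ((cmod (f x))\<^sup>2 + (cmod (g x))\<^sup>2)" by auto
  qed auto
qed

lemma L2_norm_cmult: "L2_norm M (\<lambda>x. c * f x) = cmod c * L2_norm M f"
  by (simp add: L2_norm_def norm_mult power_mult_distrib real_sqrt_mult)

lemma L2_norm_cong_AE:
  assumes "f \<in> L2_space M" "g \<in> L2_space M" "AE x in M. f x = g x"
  shows "L2_norm M f = L2_norm M g"
proof -
  have [measurable]: "f \<in> borel_measurable M" "g \<in> borel_measurable M"
    using assms by (auto simp: L2_space_def)
  show ?thesis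
    unfolding L2_norm_def
    by (rule arg_cong[where f=sqrt], rule integral_cong_AE) (use assms(3) in auto)
qed

lemma L2_norm_power2_add_le:
  assumes "f \<in> L2_space M" "g \<in> L2_space M"
  shows "(L2_norm M (\<lambda>x. f x + g x))\<^sup>2 \<le> 2 * (L2_norm M f)\<^sup>2 + 2 * (L2_norm M g)\<^sup>2"
proof -
  have "(\<integral>x. (cmod (f x + g x))\<^sup>2 \<partial>M) \<le> (\<integral>x. 2 * (cmod (f x))\<^sup>2 + 2 * (cmod (g x))\<^sup>2 \<partial>M)"
    using assms L2_space_add[OF assms]
    by (intro integral_mono cmod_add_sq_le) (auto simp: L2_space_def)
  then show ?thesis using assms by (simp add: L2_norm_power2 L2_space_def)
qed

text \<open>Young's inequality with a free weight \<open>t\<close>; integrated, it yields convergence of squared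
  \<open>L\<^sup>2\<close> norms by choosing \<open>t\<close> small first and the error small afterwards.\<close>

lemma cmod_sq_diff_le:
  assumes "0 < t"
  shows "\<bar>(cmod a)\<^sup>2 - (cmod b)\<^sup>2\<bar> \<le> t * (cmod b)\<^sup>2 + (1 + 1 / t) * (cmod (a - b))\<^sup>2"
proof -
  have "\<bar>(cmod a)\<^sup>2 - (cmod b)\<^sup>2\<bar> = \<bar>cmod a - cmod b\<bar> * (cmod a + cmod b)"
    by (simp add: power2_eq_square square_diff_square_factored abs_mult mult.commute)
  also have "\<dots> \<le> cmod (a - b) * (2 * cmod b + cmod (a - b))"
    using norm_triangle_ineq3[of a b] norm_triangle_ineq2[of a b] by (intro mult_mono) auto
  also have "\<dots> = 2 * (cmod b * cmod (a - b)) + (cmod (a - b))\<^sup>2"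
    by (simp add: algebra_simps power2_eq_square)
  also have "2 * (cmod b * cmod (a - b)) \<le> t * (cmod b)\<^sup>2 + (1 / t) * (cmod (a - b))\<^sup>2"
    using sum_squares_bound[of "sqrt t * cmod b" "cmod (a - b) / sqrt t"] assms
    by (simp add: power_mult_distrib power_divide mult_ac)
  finally show ?thesis by (simp add: algebra_simps)
qed

lemma L2_norm_power2_tendsto:
  assumes f: "\<And>n. f n \<in> L2_space M" and g: "g \<in> L2_space M"
    and lim: "(\<lambda>n. L2_norm M (\<lambda>x. f n x - g x)) \<longlonglongrightarrow> 0"
  shows "(\<lambda>n. (L2_norm M (f n))\<^sup>2) \<longlonglongrightarrow> (L2_norm M g)\<^sup>2"
proof (rule LIMSEQ_I)
  fix r :: real assume r: "r > 0"
  define N where "N = (L2_norm M g)\<^sup>2"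
  \<comment> \<open>the shift by \<open>1\<close> avoids division by zero when \<open>g\<close> vanishes\<close>
  define t where "t = r / 2 / (N + 1)"
  have N0: "N \<ge> 0" by (simp add: N_def)
  have t: "t > 0" using r N0 by (auto simp: t_def)
  have "(\<lambda>n. (1 + 1 / t) * (L2_norm M (\<lambda>x. f n x - g x))\<^sup>2) \<longlonglongrightarrow> (1 + 1 / t) * 0\<^sup>2"
    by (intro tendsto_intros lim)
  then have "\<forall>\<^sub>F n in sequentially. (1 + 1 / t) * (L2_norm M (\<lambda>x. f n x - g x))\<^sup>2 < r / 2"
    using r by (intro order_tendstoD(2)[where y=0]) auto
  moreover have "\<bar>(L2_norm M (f n))\<^sup>2 - N\<bar> \<le> t * N + (1 + 1 / t) * (L2_norm M (\<lambda>x. f n x - g x))\<^sup>2" for n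
  proof -
    have int: "integrable M (\<lambda>x. (cmod (f n x))\<^sup>2)" "integrable M (\<lambda>x. (cmod (g x))\<^sup>2)"
      "integrable M (\<lambda>x. (cmod (f n x - g x))\<^sup>2)"
      using f g L2_space_diff[OF f g] by (auto simp: L2_space_def)
    have "\<bar>(L2_norm M (f n))\<^sup>2 - N\<bar> = \<bar>\<integral>x. (cmod (f n x))\<^sup>2 - (cmod (g x))\<^sup>2 \<partial>M\<bar>"
      using int by (simp add: N_def L2_norm_power2)
    also have "\<dots> \<le> (\<integral>x. \<bar>(cmod (f n x))\<^sup>2 - (cmod (g x))\<^sup>2\<bar> \<partial>M)"
      by (rule integral_abs_bound)
    also have "\<dots> \<le> (\<integral>x. t * (cmod (g x))\<^sup>2 + (1 + 1 / t) * (cmod (f n x - g x))\<^sup>2 \<partial>M)"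
      using int by (intro integral_mono cmod_sq_diff_le t) auto
    also have "\<dots> = t * N + (1 + 1 / t) * (L2_norm M (\<lambda>x. f n x - g x))\<^sup>2"
      using int by (simp add: N_def L2_norm_power2)
    finally show ?thesis .
  qed
  moreover have "t * N \<le> r / 2"
  proof -
    have "t * N \<le> t * (N + 1)" using t by simp
    also have "\<dots> = r / 2" 
    proof -
      have "N + 1 \<noteq> 0" using N0 by simp
      then show ?thesis by (simp add: t_def nonzero_divide_eq_eq)
    qed
    finally show ?thesis .
  qed
  ultimately have "\<forall>\<^sub>F n in sequentially. norm ((L2_norm M (f n))\<^sup>2 - N) < r"
    by (auto elim!: eventually_mono) (smt (verit))
  then show "\<exists>no. \<forall>n\<ge>no. norm ((L2_norm M (f n))\<^sup>2 - (L2_norm M g)\<^sup>2) < r"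
    by (simp add: N_def eventually_sequentially)
qed

section \<open>Uniqueness and linearity of weak derivatives\<close>

text \<open>Boxes are stable under intersection and generate the Borel sets, so the integral vanishes over
  every Borel set; integrating over the set where a Borel version of \<open>g\<close> is positive gives the claim.\<close>

lemma AE_le_0_if_box_integrals_0:
  fixes g :: "'a::euclidean_space \<Rightarrow> real"
  assumes int: "integrable lebesgue g"
    and box0: "\<And>a b. (\<integral>x. indicator (box a b) x *\<^sub>R g x \<partial>lebesgue) = 0"
  shows "AE x in lebesgue. g x \<le> 0"
proof -
  let ?I = "\<lambda>A. (\<integral>x. indicator A x *\<^sub>R g x \<partial>lebesgue)"
  have intA: "integrable lebesgue (\<lambda>x. indicator A x *\<^sub>R g x)" if "A \<in> sets lebesgue" for A
    using integrable_mult_indicator[OF that int] .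
  have total: "?I UNIV = 0"
  proof -
    have "(\<lambda>n. ?I (box (- real n *\<^sub>R One) (real n *\<^sub>R One))) \<longlonglongrightarrow> ?I UNIV"
    proof (rule integral_dominated_convergence[where w="\<lambda>x. norm (g x)"])
      show "AE x in lebesgue. (\<lambda>n. indicator (box (- real n *\<^sub>R One) (real n *\<^sub>R One)) x *\<^sub>R g x)
          \<longlonglongrightarrow> indicator UNIV x *\<^sub>R g x"
      proof (rule AE_I2)
        fix x :: 'a
        obtain m :: nat where m: "norm x < real m" using reals_Archimedean2 by blast
        have "x \<in> box (- real n *\<^sub>R One) (real n *\<^sub>R One)" if "n \<ge> m" for n
        proof -
          have "\<bar>x \<bullet> e\<bar> < real n" if "e \<in> Basis" for e
            using Basis_le_norm[OF that, of x] m \<open>n \<ge> m\<close> by linarith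
          then show ?thesis by (force simp: mem_box abs_less_iff)
        qed
        then have "\<forall>\<^sub>F n in sequentially. indicator UNIV x *\<^sub>R g x
            = indicator (box (- real n *\<^sub>R One) (real n *\<^sub>R One)) x *\<^sub>R g x"
          by (auto simp: eventually_sequentially intro!: exI[of _ m])
        then show "(\<lambda>n. indicator (box (- real n *\<^sub>R One) (real n *\<^sub>R One)) x *\<^sub>R g x)
          \<longlonglongrightarrow> indicator UNIV x *\<^sub>R g x"
          by (rule Lim_transform_eventually[OF tendsto_const])
      qed
    next
      show "(\<lambda>x. indicator UNIV x *\<^sub>R g x) \<in> borel_measurable lebesgue"
        using intA[of UNIV] by (simp del: indicator_UNIV)
      show "(\<lambda>x. indicator (box (- real n *\<^sub>R One) (real n *\<^sub>R One)) x *\<^sub>R g x) \<in> borel_measurable lebesgue"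
        for n
        by (rule borel_measurable_integrable[OF intA]) auto
    qed (use int in \<open>auto simp: indicator_def\<close>)
    then show ?thesis unfolding box0 using LIMSEQ_unique tendsto_const by blast
  qed
  have all0: "?I A = 0" if "A \<in> sets borel" for A
  proof -
    let ?G = "range (\<lambda>(a, b). box a b :: 'a set)"
    have "Int_stable ?G" by (auto simp: Int_stable_def box_Int_box)
    moreover have "?G \<subseteq> Pow UNIV" by simp
    moreover have "A \<in> sigma_sets UNIV ?G"
      using that by (simp add: borel_eq_box)
    ultimately show ?thesis
    proof (induction rule: sigma_sets_induct_disjoint)
      case (compl B)
      then have IH: "?I B = 0" by simp
      from compl have "B \<in> sigma_sets UNIV ?G" by simp
      then have B: "B \<in> sets borel" by (simp add: borel_eq_box)
      have "?I (UNIV - B) = (\<integral>x. indicator UNIV x *\<^sub>R g x - indicator B x *\<^sub>R g x \<partial>lebesgue)"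
        by (intro Bochner_Integration.integral_cong) (auto simp: indicator_def)
      also have "\<dots> = ?I UNIV - ?I B"
        using B by (intro Bochner_Integration.integral_diff intA) auto
      finally show ?case unfolding IH total by simp
    next
      case (union B)
      then have disj: "disjoint_family B" and IH: "\<And>i. ?I (B i) = 0" by auto
      from union have "range B \<subseteq> sigma_sets UNIV ?G" by simp
      then have B: "B i \<in> sets borel" for i by (auto simp: borel_eq_box)
      have "(LINT x:(\<Union>i. B i)|lebesgue. g x) = (\<Sum>i. (LINT x:(B i)|lebesgue. g x))"
        using B disj intA[of "\<Union>i. B i"]
        by (intro lebesgue_integral_countable_add)
          (auto simp: disjoint_family_on_def set_integrable_def)
      then show ?case unfolding set_lebesgue_integral_def by (simp only: IH suminf_zero)
    qed (auto simp: box0 simp del: real_scaleR_def)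
  qed
  have "g \<in> borel_measurable (completion lborel)" using int by auto
  then obtain g0 where [measurable]: "g0 \<in> borel_measurable lborel" and g0: "AE x in lborel. g x = g0 x"
    using completion_ex_borel_measurable_real by blast
  let ?A = "{x. g0 x > 0}"
  have A: "?A \<in> sets borel" by measurable
  have ae: "AE x in lebesgue. indicator ?A x *\<^sub>R g x \<ge> 0"
    using AE_completion[OF g0] by eventually_elim (auto simp: indicator_def)
  have "AE x in lebesgue. indicator ?A x *\<^sub>R g x = 0"
    using integral_nonneg_eq_0_iff_AE[OF intA[of ?A] ae] all0[OF A] A by auto
  then show ?thesis
    using AE_completion[OF g0] by eventually_elim (auto simp: indicator_def split: if_splits)
qed

text \<open>The real case applied to \<open>\<plusminus> Re g\<close> and \<open>\<plusminus> Im g\<close>.\<close>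

lemma AE_0_if_box_integrals_0:
  fixes g :: "'a::euclidean_space \<Rightarrow> complex"
  assumes int: "integrable lebesgue g"
    and box0: "\<And>a b. (\<integral>x. indicator (box a b) x *\<^sub>R g x \<partial>lebesgue) = 0"
  shows "AE x in lebesgue. g x = 0"
proof -
  have *: "AE x in lebesgue. T (g x) \<le> 0" if T: "bounded_linear T" for T :: "complex \<Rightarrow> real"
  proof (rule AE_le_0_if_box_integrals_0)
    show "integrable lebesgue (\<lambda>x. T (g x))"
      using T int by (rule integrable_bounded_linear)
    fix a b :: 'a
    have "(\<integral>x. indicator (box a b) x *\<^sub>R T (g x) \<partial>lebesgue)
        = (\<integral>x. T (indicator (box a b) x *\<^sub>R g x) \<partial>lebesgue)"
      by (simp add: linear_scale[OF bounded_linear.linear[OF T]])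
    also have "\<dots> = T (\<integral>x. indicator (box a b) x *\<^sub>R g x \<partial>lebesgue)"
      by (rule integral_bounded_linear[OF T integrable_mult_indicator[OF _ int]]) auto
    also have "\<dots> = 0" using T by (simp add: box0 linear_0 bounded_linear.linear)
    finally show "(\<integral>x. indicator (box a b) x *\<^sub>R T (g x) \<partial>lebesgue) = 0" .
  qed
  show ?thesis
    using *[OF bounded_linear_Re] *[OF bounded_linear_Im]
      *[OF bounded_linear_minus[OF bounded_linear_Re]] *[OF bounded_linear_minus[OF bounded_linear_Im]]
    by eventually_elim (auto simp: complex_eq_iff)
qed

lemma lebesgue_on_integral:
  fixes f :: "'a::euclidean_space \<Rightarrow> 'b::{banach, second_countable_topology}"
  shows "open \<Omega> \<Longrightarrow> integral\<^sup>L (lebesgue_on \<Omega>) f = (\<integral>x. indicator \<Omega> x *\<^sub>R f x \<partial>lebesgue)"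
  by (rule integral_restrict_space) (auto simp: borel_open)

lemma lebesgue_on_integrable:
  fixes f :: "'a::euclidean_space \<Rightarrow> 'b::{banach, second_countable_topology}"
  shows "open \<Omega> \<Longrightarrow> integrable (lebesgue_on \<Omega>) f \<longleftrightarrow> integrable lebesgue (\<lambda>x. indicator \<Omega> x *\<^sub>R f x)"
  by (rule integrable_restrict_space) (auto simp: borel_open)

text \<open>Testing with smooth approximations of the indicator of a box shows that the integral of \<open>g\<close> over each
  box whose closure lies in \<open>\<Omega>\<close> vanishes. Inside one such box the intersections with other boxes are
  again such boxes, so \<open>g\<close> vanishes there almost everywhere, and countably many boxes cover \<open>\<Omega>\<close>.\<close>

lemma fundamental_lemma_calculus_of_variations:
  fixes g :: "'a::euclidean_space \<Rightarrow> complex"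
  assumes \<Omega>: "open \<Omega>" and g: "g \<in> L2_space (lebesgue_on \<Omega>)"
    and orth: "\<And>\<eta>. \<eta> \<in> test_functions \<Omega> \<Longrightarrow> (\<integral>x. g x * \<eta> x \<partial>lebesgue_on \<Omega>) = 0"
  shows "AE x in lebesgue_on \<Omega>. g x = 0"
proof -
  have sO: "\<Omega> \<in> sets lebesgue" using \<Omega> by (auto simp: borel_open)
  have locint: "integrable lebesgue (\<lambda>x. indicator (box c d) x *\<^sub>R g x)" if sub: "cbox c d \<subseteq> \<Omega>" for c d
  proof -
    have "emeasure lebesgue (box c d) < \<infinity>"
      using emeasure_lborel_box_finite[of c d] by simp
    then have 1: "integrable lebesgue (indicat_real (box c d))"
      by (intro integrable_real_indicator) auto
    have 2: "integrable lebesgue (\<lambda>x. indicator \<Omega> x *\<^sub>R (cmod (g x))\<^sup>2)"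
      using g \<Omega> by (simp add: L2_space_def lebesgue_on_integrable)
    have boxs: "box c d \<subseteq> \<Omega>" using sub box_subset_cbox by blast
    have "(\<lambda>x. indicator \<Omega> x *\<^sub>R g x) \<in> borel_measurable lebesgue"
      using g sO borel_measurable_restrict_space_iff[of \<Omega> lebesgue g] by (simp add: L2_space_def)
    then have "(\<lambda>x. indicator (box c d) x *\<^sub>R (indicator \<Omega> x *\<^sub>R g x)) \<in> borel_measurable lebesgue"
      by (rule borel_measurable_scaleR[OF borel_measurable_indicator, rotated]) auto
    moreover have eq: "indicator (box c d) x *\<^sub>R (indicator \<Omega> x *\<^sub>R g x) = indicator (box c d) x *\<^sub>R g x" for x
      using boxs by (auto simp: indicator_def)
    ultimately have 3: "(\<lambda>x. indicator (box c d) x *\<^sub>R g x) \<in> borel_measurable lebesgue" by (simp only: eq)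
    show ?thesis
    proof (rule Bochner_Integration.integrable_bound[OF Bochner_Integration.integrable_add[OF 1 2] 3], rule AE_I2)
      fix x
      have "2 * cmod (g x) \<le> 1 + (cmod (g x))\<^sup>2"
        using sum_squares_bound[of 1 "cmod (g x)"] by simp
      then have "cmod (g x) \<le> 1 + (cmod (g x))\<^sup>2" using norm_ge_zero[of "g x"] by linarith
      then show "norm (indicator (box c d) x *\<^sub>R g x)
          \<le> norm (indicat_real (box c d) x + indicator \<Omega> x *\<^sub>R (cmod (g x))\<^sup>2)"
        using boxs by (auto simp: indicator_def)
    qed
  qed
  have box0: "(\<integral>x. indicator (box c d) x *\<^sub>R g x \<partial>lebesgue) = 0" if sub: "cbox c d \<subseteq> \<Omega>" for c d
  proof -
    note int = locint[OF sub]
    have "(\<lambda>n. \<integral>x. box_bump n c d x *\<^sub>R g x \<partial>lebesgue) \<longlonglongrightarrow> (\<integral>x. indicator (box c d) x *\<^sub>R g x \<partial>lebesgue)"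
    proof (rule integral_dominated_convergence[where w="\<lambda>x. norm (indicator (box c d) x *\<^sub>R g x)"])
      show "AE x in lebesgue. (\<lambda>n. box_bump n c d x *\<^sub>R g x) \<longlonglongrightarrow> indicator (box c d) x *\<^sub>R g x"
        by (intro AE_I2 tendsto_scaleR box_bump_tendsto_indicator tendsto_const)
      fix n
      have eq: "box_bump n c d x *\<^sub>R g x = box_bump n c d x *\<^sub>R (indicator (box c d) x *\<^sub>R g x)" for x
        using box_bump_eq_0[of x c d n] by (auto simp: indicator_def)
      have "box_bump n c d \<in> borel_measurable lebesgue"
        by (intro measurable_completion)
          (simp add: borel_measurable_continuous_onI smooth_continuous_on[OF smooth_box_bump])
      then show "(\<lambda>x. box_bump n c d x *\<^sub>R g x) \<in> borel_measurable lebesgue"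
        unfolding eq by (rule borel_measurable_scaleR[OF _ borel_measurable_integrable[OF int]])
      show "AE x in lebesgue. norm (box_bump n c d x *\<^sub>R g x) \<le> norm (indicator (box c d) x *\<^sub>R g x)"
        using box_bump_bounds[of n c d] box_bump_eq_0[of _ c d n]
        by (intro AE_I2) (auto simp: indicator_def mult_left_le_one_le)
    next
      show "integrable lebesgue (\<lambda>x. norm (indicator (box c d) x *\<^sub>R g x))"
        by (rule integrable_norm[OF int])
      show "(\<lambda>x. indicator (box c d) x *\<^sub>R g x) \<in> borel_measurable lebesgue"
        by (rule borel_measurable_integrable[OF int])
    qed
    moreover have "(\<integral>x. box_bump n c d x *\<^sub>R g x \<partial>lebesgue) = 0" for n
    proof -
      have "(\<integral>x. box_bump n c d x *\<^sub>R g x \<partial>lebesgue)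
          = (\<integral>x. indicator \<Omega> x *\<^sub>R (g x * complex_of_real (box_bump n c d x)) \<partial>lebesgue)"
        using sub box_subset_cbox[of c d] box_bump_eq_0[of _ c d n]
        by (intro Bochner_Integration.integral_cong) (auto simp: indicator_def scaleR_conv_of_real)
      also have "\<dots> = 0"
        using orth[OF box_bump_test_function[OF sub]] \<Omega> by (simp add: lebesgue_on_integral)
      finally show ?thesis .
    qed
    ultimately show ?thesis by (simp add: LIMSEQ_const_iff)
  qed
  have ae_box: "AE x in lebesgue. x \<in> cbox c d \<longrightarrow> g x = 0" if sub: "cbox c d \<subseteq> \<Omega>" for c d
  proof -
    have "AE x in lebesgue. indicator (box c d) x *\<^sub>R g x = 0"
    proof (rule AE_0_if_box_integrals_0[OF locint[OF sub]])
      fix a b :: 'a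
      let ?l = "\<Sum>i\<in>Basis. max (a \<bullet> i) (c \<bullet> i) *\<^sub>R i" and ?u = "\<Sum>i\<in>Basis. min (b \<bullet> i) (d \<bullet> i) *\<^sub>R i"
      have eq: "indicator (box a b) x *\<^sub>R indicator (box c d) x *\<^sub>R g x = indicator (box ?l ?u) x *\<^sub>R g x" for x
        unfolding box_Int_box[symmetric] by (auto simp: indicator_def)
      moreover have "cbox ?l ?u \<subseteq> \<Omega>"
        using sub Int_interval[of a b c d] by auto
      ultimately show "(\<integral>x. indicator (box a b) x *\<^sub>R indicator (box c d) x *\<^sub>R g x \<partial>lebesgue) = 0"
        unfolding eq by (intro box0)
    qed
    moreover have "AE x in lebesgue. x \<notin> cbox c d - box c d"
      using negligible_frontier_interval[of c d] unfolding negligible_iff_null_sets by (rule AE_not_in)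
    ultimately show ?thesis by eventually_elim (auto simp: indicator_def split: if_splits)
  qed
  obtain \<D> where "countable \<D>" and D: "\<D> \<subseteq> Pow \<Omega>" "\<And>X. X \<in> \<D> \<Longrightarrow> \<exists>a b. X = cbox a b" "\<Union>\<D> = \<Omega>"
    using open_countable_Union_open_cbox[OF \<Omega>] by blast
  have "AE x in lebesgue. x \<in> X \<longrightarrow> g x = 0" if X: "X \<in> \<D>" for X
  proof -
    obtain c d where X': "X = cbox c d" using D(2)[OF X] by blast
    have "X \<subseteq> \<Omega>" using D(1) X by blast
    then show ?thesis unfolding X' by (rule ae_box)
  qed
  then have "AE x in lebesgue. \<forall>X\<in>\<D>. x \<in> X \<longrightarrow> g x = 0"
    by (intro iffD2[OF AE_ball_countable[OF \<open>countable \<D>\<close>]] ballI)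
  then have "AE x in lebesgue. x \<in> \<Omega> \<longrightarrow> g x = 0"
    by eventually_elim (use D(3) in blast)
  then show ?thesis using sO by (simp add: AE_restrict_space_iff)
qed

lemma test_functions_outside: "\<phi> \<in> test_functions \<Omega> \<Longrightarrow> x \<notin> \<Omega> \<Longrightarrow> \<phi> x = 0"
  using closure_subset[of "{x. \<phi> x \<noteq> 0}"] by (auto simp: test_functions_def)

lemma test_functions_lebesgue_measurable:
  "\<phi> \<in> test_functions \<Omega>' \<Longrightarrow> \<phi> \<in> borel_measurable (lebesgue_on \<Omega>)"
  by (intro measurable_restrict_space1 measurable_completion) (simp add: test_functions_borel)

lemma test_functions_integrable_lborel:
  assumes "\<phi> \<in> test_functions \<Omega>"
  shows "integrable lborel \<phi>"
proof -
  have "integrable lebesgue (\<lambda>x. 1 * \<phi> x)"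
    by (rule bounded_measurable_times_test_integrable[OF assms, where C=1]) auto
  then show ?thesis using assms by (simp add: integrable_completion test_functions_borel)
qed

lemma test_functions_L2:
  assumes "\<phi> \<in> test_functions \<Omega>'" "open \<Omega>"
  shows "\<phi> \<in> L2_space (lebesgue_on \<Omega>)"
proof -
  obtain C where C: "\<And>x. cmod (\<phi> x) \<le> C" using test_functions_bounded[OF assms(1)] by blast
  have "integrable lebesgue (\<lambda>x. cnj (\<phi> x) * \<phi> x)"
  proof (rule bounded_measurable_times_test_integrable[OF assms(1)])
    have "(\<lambda>x. cnj (\<phi> x)) \<in> borel_measurable borel"
      by (intro borel_measurable_continuous_onI continuous_on_cnj test_functions_continuous[OF assms(1)])
    then show "(\<lambda>x. cnj (\<phi> x)) \<in> borel_measurable lebesgue" by (simp add: measurable_completion)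
    show "cmod (cnj (\<phi> x)) \<le> C" for x using C by simp
  qed
  then have "integrable lebesgue (\<lambda>x. norm (cnj (\<phi> x) * \<phi> x))" by (rule integrable_norm)
  then have "integrable lebesgue (\<lambda>x. (cmod (\<phi> x))\<^sup>2)" by (simp add: norm_mult power2_eq_square)
  then have "integrable lebesgue (\<lambda>x. indicator \<Omega> x *\<^sub>R (cmod (\<phi> x))\<^sup>2)"
    using assms(2) by (intro integrable_mult_indicator) (auto simp: borel_open)
  then show ?thesis
    using assms by (simp add: L2_space_def lebesgue_on_integrable test_functions_lebesgue_measurable)
qed

lemma lborel_integral_translate:
  fixes f :: "'a::euclidean_space \<Rightarrow> complex"
  assumes "f \<in> borel_measurable borel"
  shows "(\<integral>x. f (c + x) \<partial>lborel) = (\<integral>x. f x \<partial>lborel)"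
  using integral_distr[of "(+) c" lborel borel f] assms by (simp add: lborel_distr_plus)

text \<open>The derivative is the limit of difference quotients, whose integrals vanish by translation
  invariance; the quotients are bounded by the supremum of the derivative on a fixed ball.\<close>

lemma integral_derivative_test_function:
  assumes \<psi>: "\<psi> \<in> test_functions \<Omega>"
  shows "(\<integral>x. frechet_derivative \<psi> (at x) e \<partial>lebesgue) = 0"
proof -
  let ?D = "\<lambda>x. frechet_derivative \<psi> (at x) e"
  have D: "?D \<in> test_functions \<Omega>" by (rule test_functions_frechet_derivative[OF \<psi>])
  obtain C where C: "\<And>x. cmod (?D x) \<le> C" using test_functions_bounded[OF D] by blast
  have C0: "0 \<le> C" using C norm_ge_zero order_trans by blast
  obtain R where R: "\<And>x. norm x > R \<Longrightarrow> \<psi> x = 0" using test_functions_bounded_support[OF \<psi>] by blast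
  let ?f = "\<lambda>n x. real (Suc n) *\<^sub>R (\<psi> (inverse (real (Suc n)) *\<^sub>R e + x) - \<psi> x)"
  have vd: "((\<lambda>t. \<psi> (t *\<^sub>R e + x)) has_vector_derivative ?D (t *\<^sub>R e + x)) (at t within T)" for t x T
  proof -
    have "((\<lambda>t. \<psi> (t *\<^sub>R e + x)) has_derivative (\<lambda>h. frechet_derivative \<psi> (at (t *\<^sub>R e + x)) (h *\<^sub>R e))) (at t within T)"
      by (rule has_derivative_compose[OF _ test_functions_has_derivative[OF \<psi>]])
        (auto intro!: derivative_eq_intros)
    moreover have "linear (frechet_derivative \<psi> (at (t *\<^sub>R e + x)))"
      using test_functions_has_derivative[OF \<psi>] has_derivative_linear by blast
    ultimately show ?thesis by (simp add: has_vector_derivative_def linear_scale)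
  qed
  have bound: "cmod (?f n x) \<le> C" for n x
  proof -
    let ?h = "inverse (real (Suc n))"
    have h: "?h > 0" by simp
    have "cmod (\<psi> (?h *\<^sub>R e + x) - \<psi> (0 *\<^sub>R e + x)) \<le> C * ?h - C * 0"
    proof (rule differentiable_bound_general[OF h, where f="\<lambda>t. \<psi> (t *\<^sub>R e + x)" and \<phi>="\<lambda>t. C * t"
          and f'="\<lambda>t. ?D (t *\<^sub>R e + x)" and \<phi>'="\<lambda>t. C"])
      show "continuous_on {0..?h} (\<lambda>t. \<psi> (t *\<^sub>R e + x))"
        by (rule continuous_on_compose2[OF test_functions_continuous[OF \<psi>, of UNIV]])
          (auto intro!: continuous_intros)
      show "((\<lambda>t. C * t) has_vector_derivative C) (at t)" for t
        by (auto intro!: derivative_eq_intros simp: has_real_derivative_iff_has_vector_derivative[symmetric])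
    qed (auto intro!: continuous_intros vd C)
    then have "real (Suc n) * cmod (\<psi> (?h *\<^sub>R e + x) - \<psi> x) \<le> real (Suc n) * (C * ?h)"
      by (intro mult_left_mono) auto
    also have "\<dots> = C" by simp
    finally show ?thesis by (simp del: of_nat_Suc)
  qed
  have supp: "?f n x = 0" if "norm x > R + norm e" for n x
  proof -
    have "norm (inverse (real (Suc n)) *\<^sub>R e) \<le> norm e"
      by (simp add: mult_left_le_one_le inverse_le_1_iff del: of_nat_Suc)
    then have "norm (inverse (real (Suc n)) *\<^sub>R e + x) > R"
      using that norm_triangle_ineq4[of "inverse (real (Suc n)) *\<^sub>R e + x" "inverse (real (Suc n)) *\<^sub>R e"]
      by simp
    moreover have "norm x > R" using that norm_ge_zero[of e] by linarith
    ultimately show ?thesis using R by simp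
  qed
  have meas[measurable]: "\<psi> \<in> borel_measurable borel" by (rule test_functions_borel[OF \<psi>])
  have "(\<lambda>n. \<integral>x. ?f n x \<partial>lborel) \<longlonglongrightarrow> (\<integral>x. ?D x \<partial>lborel)"
  proof (rule integral_dominated_convergence[where w="\<lambda>x. C * indicat_real (cball 0 (R + norm e)) x"])
    have "integrable lborel (indicat_real (cball 0 (R + norm e) :: 'a set))"
      using emeasure_bounded_finite[OF bounded_cball] by (intro integrable_real_indicator) auto
    then show "integrable lborel (\<lambda>x::'a. C * indicat_real (cball 0 (R + norm e)) x)" by simp
    show "AE x in lborel. (\<lambda>n. ?f n x) \<longlonglongrightarrow> ?D x"
    proof (rule AE_I2)
      fix x
      have "((\<lambda>t. \<psi> (t *\<^sub>R e + x)) has_vector_derivative ?D x) (at 0)"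
        using vd[where t=0 and x=x and T=UNIV] by simp
      then have "((\<lambda>h. (\<psi> (h *\<^sub>R e + x) - \<psi> x) /\<^sub>R h) \<longlongrightarrow> ?D x) (at 0)"
        by (simp add: has_vector_derivative_complex_iff DERIV_def tendsto_complex_iff divide_inverse mult.commute)
      moreover have "filterlim (\<lambda>n. inverse (real (Suc n))) (at 0) sequentially"
        by (simp add: filterlim_at LIMSEQ_inverse_real_of_nat del: of_nat_Suc)
      ultimately have "(\<lambda>n. (\<psi> (inverse (real (Suc n)) *\<^sub>R e + x) - \<psi> x) /\<^sub>R inverse (real (Suc n))) \<longlonglongrightarrow> ?D x"
        by (rule filterlim_compose)
      then show "(\<lambda>n. ?f n x) \<longlonglongrightarrow> ?D x" by (simp del: of_nat_Suc)
    qed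
    show "AE x in lborel. norm (?f n x) \<le> C * indicat_real (cball 0 (R + norm e)) x" for n
      using bound[of n] supp[of _ n] by (intro AE_I2) (auto simp: indicator_def not_le)
    show "?D \<in> borel_measurable lborel" using test_functions_borel[OF D] by simp
  qed measurable
  moreover have "(\<integral>x. ?f n x \<partial>lborel) = 0" for n
  proof -
    have i1: "integrable lborel \<psi>" by (rule test_functions_integrable_lborel[OF \<psi>])
    have "integrable (distr lborel borel ((+) (inverse (real (Suc n)) *\<^sub>R e))) \<psi>"
      using i1 by (simp add: lborel_distr_plus)
    then have "integrable lborel (\<lambda>x. \<psi> (inverse (real (Suc n)) *\<^sub>R e + x))"
      by (simp add: integrable_distr_eq del: lborel_distr_plus)
    then show ?thesis using i1 by (simp add: lborel_integral_translate del: of_nat_Suc)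
  qed
  ultimately have "(\<integral>x. ?D x \<partial>lborel) = 0" by (simp add: LIMSEQ_const_iff)
  then show ?thesis using test_functions_borel[OF D] by (simp add: integral_completion)
qed

text \<open>The product \<open>\<phi> * \<eta>\<close> is a test function, and the integral of its derivative vanishes.\<close>

lemma test_function_has_weak_derivative:
  assumes \<Omega>: "open \<Omega>" and \<phi>: "\<phi> \<in> test_functions \<Omega>'"
  shows "has_weak_derivative \<Omega> e \<phi> (\<lambda>x. frechet_derivative \<phi> (at x) e)"
  unfolding has_weak_derivative_def
proof
  let ?M = "lebesgue_on \<Omega>"
  fix \<eta> assume \<eta>: "\<eta> \<in> test_functions \<Omega>"
  let ?d\<phi> = "\<lambda>x. frechet_derivative \<phi> (at x) e" and ?d\<eta> = "\<lambda>x. frechet_derivative \<eta> (at x) e"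
  have d: "?d\<phi> \<in> test_functions \<Omega>'" "?d\<eta> \<in> test_functions \<Omega>"
    using \<phi> \<eta> by (auto intro: test_functions_frechet_derivative)
  have i1: "integrable ?M (\<lambda>x. \<phi> x * ?d\<eta> x)"
    using test_functions_L2[OF \<phi> \<Omega>] test_functions_L2[OF d(2) \<Omega>] by (rule L2_space_mult_integrable)
  have i2: "integrable ?M (\<lambda>x. ?d\<phi> x * \<eta> x)"
    using test_functions_L2[OF d(1) \<Omega>] test_functions_L2[OF \<eta> \<Omega>] by (rule L2_space_mult_integrable)
  have "((\<lambda>x. \<phi> x * \<eta> x) has_derivative
      (\<lambda>v. \<phi> x * frechet_derivative \<eta> (at x) v + frechet_derivative \<phi> (at x) v * \<eta> x)) (at x)" for x
    by (rule has_derivative_mult[OF test_functions_has_derivative[OF \<phi>] test_functions_has_derivative[OF \<eta>]])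
  from frechet_derivative_at[OF this]
  have prod: "frechet_derivative (\<lambda>x. \<phi> x * \<eta> x) (at x) e = \<phi> x * ?d\<eta> x + ?d\<phi> x * \<eta> x" for x
    by metis
  have "(\<integral>x. \<phi> x * ?d\<eta> x \<partial>?M) + (\<integral>x. ?d\<phi> x * \<eta> x \<partial>?M)
      = (\<integral>x. \<phi> x * ?d\<eta> x + ?d\<phi> x * \<eta> x \<partial>?M)"
    using i1 i2 by simp
  also have "\<dots> = (\<integral>x. indicator \<Omega> x *\<^sub>R (\<phi> x * ?d\<eta> x + ?d\<phi> x * \<eta> x) \<partial>lebesgue)"
    by (rule lebesgue_on_integral[OF \<Omega>])
  also have "\<dots> = (\<integral>x. frechet_derivative (\<lambda>x. \<phi> x * \<eta> x) (at x) e \<partial>lebesgue)"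
    using test_functions_outside[OF \<eta>] test_functions_outside[OF d(2)]
    by (intro Bochner_Integration.integral_cong) (auto simp: prod indicator_def)
  also have "\<dots> = 0"
    by (rule integral_derivative_test_function[OF test_functions_mult[OF \<phi> \<eta>]])
  finally show "(\<integral>x. \<phi> x * ?d\<eta> x \<partial>?M) = - (\<integral>x. ?d\<phi> x * \<eta> x \<partial>?M)"
    by (simp add: eq_neg_iff_add_eq_0)
qed

lemma has_weak_derivative_lincomb:
  assumes \<Omega>: "open \<Omega>"
    and L2: "u \<in> L2_space (lebesgue_on \<Omega>)" "g \<in> L2_space (lebesgue_on \<Omega>)"
      "v \<in> L2_space (lebesgue_on \<Omega>)" "h \<in> L2_space (lebesgue_on \<Omega>)"
    and wd: "has_weak_derivative \<Omega> e u g" "has_weak_derivative \<Omega> e v h"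
  shows "has_weak_derivative \<Omega> e (\<lambda>x. c * u x + d * v x) (\<lambda>x. c * g x + d * h x)"
  unfolding has_weak_derivative_def
proof
  let ?M = "lebesgue_on \<Omega>"
  fix \<eta> assume \<eta>: "\<eta> \<in> test_functions \<Omega>"
  let ?d\<eta> = "\<lambda>x. frechet_derivative \<eta> (at x) e"
  note L = test_functions_L2[OF \<eta> \<Omega>] test_functions_L2[OF test_functions_frechet_derivative[OF \<eta>] \<Omega>]
  have int: "integrable ?M (\<lambda>x. u x * ?d\<eta> x)" "integrable ?M (\<lambda>x. v x * ?d\<eta> x)"
    "integrable ?M (\<lambda>x. g x * \<eta> x)" "integrable ?M (\<lambda>x. h x * \<eta> x)"
    using L L2 by (auto intro!: L2_space_mult_integrable)
  have "(\<integral>x. (c * u x + d * v x) * ?d\<eta> x \<partial>?M)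
      = c * (\<integral>x. u x * ?d\<eta> x \<partial>?M) + d * (\<integral>x. v x * ?d\<eta> x \<partial>?M)"
    using int by (simp add: distrib_right mult.assoc)
  also have "\<dots> = - (c * (\<integral>x. g x * \<eta> x \<partial>?M) + d * (\<integral>x. h x * \<eta> x \<partial>?M))"
    using wd \<eta> by (simp add: has_weak_derivative_def)
  also have "c * (\<integral>x. g x * \<eta> x \<partial>?M) + d * (\<integral>x. h x * \<eta> x \<partial>?M)
      = (\<integral>x. (c * g x + d * h x) * \<eta> x \<partial>?M)"
    using int by (simp add: distrib_right mult.assoc)
  finally show "(\<integral>x. (c * u x + d * v x) * ?d\<eta> x \<partial>?M)
      = - (\<integral>x. (c * g x + d * h x) * \<eta> x \<partial>?M)" .
qed

lemma has_weak_derivative_unique: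
  assumes \<Omega>: "open \<Omega>"
    and L2: "g \<in> L2_space (lebesgue_on \<Omega>)" "h \<in> L2_space (lebesgue_on \<Omega>)"
    and wd: "has_weak_derivative \<Omega> e u g" "has_weak_derivative \<Omega> e u h"
  shows "AE x in lebesgue_on \<Omega>. g x = h x"
proof -
  let ?M = "lebesgue_on \<Omega>"
  have "AE x in ?M. g x - h x = 0"
  proof (rule fundamental_lemma_calculus_of_variations[OF \<Omega> L2_space_diff[OF L2]])
    fix \<eta> assume \<eta>: "\<eta> \<in> test_functions \<Omega>"
    have "integrable ?M (\<lambda>x. g x * \<eta> x)" "integrable ?M (\<lambda>x. h x * \<eta> x)"
      using L2 test_functions_L2[OF \<eta> \<Omega>] by (auto intro!: L2_space_mult_integrable)
    then show "(\<integral>x. (g x - h x) * \<eta> x \<partial>?M) = 0"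
      using wd \<eta> by (simp add: has_weak_derivative_def left_diff_distrib)
  qed
  then show ?thesis by simp
qed

lemma weak_derivative_works:
  assumes "u \<in> sobolev_H1 \<Omega>" "e \<in> Basis"
  shows "weak_derivative \<Omega> e u \<in> L2_space (lebesgue_on \<Omega>)"
    and "has_weak_derivative \<Omega> e u (weak_derivative \<Omega> e u)"
proof -
  have "\<exists>g. g \<in> L2_space (lebesgue_on \<Omega>) \<and> has_weak_derivative \<Omega> e u g"
    using assms by (auto simp: sobolev_H1_def)
  from someI_ex[OF this]
  show "weak_derivative \<Omega> e u \<in> L2_space (lebesgue_on \<Omega>)"
    "has_weak_derivative \<Omega> e u (weak_derivative \<Omega> e u)"
    by (auto simp: weak_derivative_def)
qed

lemma weak_derivative_eqI:
  assumes "open \<Omega>" "u \<in> sobolev_H1 \<Omega>" "e \<in> Basis"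
    "g \<in> L2_space (lebesgue_on \<Omega>)" "has_weak_derivative \<Omega> e u g"
  shows "AE x in lebesgue_on \<Omega>. weak_derivative \<Omega> e u x = g x"
  using assms weak_derivative_works[OF assms(2,3)] has_weak_derivative_unique by blast

lemma sobolev_H1_L2: "u \<in> sobolev_H1 \<Omega> \<Longrightarrow> u \<in> L2_space (lebesgue_on \<Omega>)"
  by (simp add: sobolev_H1_def)

lemma sobolev_H1_lincomb:
  assumes \<Omega>: "open \<Omega>" and u: "u \<in> sobolev_H1 \<Omega>" and v: "v \<in> sobolev_H1 \<Omega>"
  shows "(\<lambda>x. c * u x + d * v x) \<in> sobolev_H1 \<Omega>"
proof -
  let ?M = "lebesgue_on \<Omega>"
  have "\<exists>g\<in>L2_space ?M. has_weak_derivative \<Omega> e (\<lambda>x. c * u x + d * v x) g"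
    if e: "e \<in> Basis" for e
    using has_weak_derivative_lincomb[OF \<Omega> sobolev_H1_L2[OF u] weak_derivative_works(1)[OF u e]
        sobolev_H1_L2[OF v] weak_derivative_works(1)[OF v e] weak_derivative_works(2)[OF u e]
        weak_derivative_works(2)[OF v e], of c d]
      weak_derivative_works(1)[OF u e] weak_derivative_works(1)[OF v e]
    by (intro bexI[of _ "\<lambda>x. c * weak_derivative \<Omega> e u x + d * weak_derivative \<Omega> e v x"])
      (auto intro: L2_space_add L2_space_cmult)
  then show ?thesis
    using sobolev_H1_L2[OF u] sobolev_H1_L2[OF v] by (auto simp: sobolev_H1_def intro: L2_space_add L2_space_cmult)
qed

lemma weak_derivative_lincomb:
  assumes \<Omega>: "open \<Omega>" and u: "u \<in> sobolev_H1 \<Omega>" and v: "v \<in> sobolev_H1 \<Omega>" and e: "e \<in> Basis"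
  shows "AE x in lebesgue_on \<Omega>. weak_derivative \<Omega> e (\<lambda>x. c * u x + d * v x) x
    = c * weak_derivative \<Omega> e u x + d * weak_derivative \<Omega> e v x"
  using weak_derivative_works(1)[OF u e] weak_derivative_works(1)[OF v e]
  by (intro weak_derivative_eqI[OF \<Omega> sobolev_H1_lincomb[OF \<Omega> u v] e]
      has_weak_derivative_lincomb[OF \<Omega> sobolev_H1_L2[OF u] weak_derivative_works(1)[OF u e]
        sobolev_H1_L2[OF v] weak_derivative_works(1)[OF v e] weak_derivative_works(2)[OF u e]
        weak_derivative_works(2)[OF v e]])
    (auto intro: L2_space_add L2_space_cmult)

lemma test_function_sobolev_H1:
  assumes "open \<Omega>" "\<phi> \<in> test_functions \<Omega>'"
  shows "\<phi> \<in> sobolev_H1 \<Omega>"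
  using assms test_functions_L2[OF assms(2,1)] test_function_has_weak_derivative[OF assms]
    test_functions_L2[OF test_functions_frechet_derivative[OF assms(2)] assms(1)]
  by (auto simp: sobolev_H1_def)

lemma weak_derivative_test_function:
  assumes "open \<Omega>" "\<phi> \<in> test_functions \<Omega>'" "e \<in> Basis"
  shows "AE x in lebesgue_on \<Omega>. weak_derivative \<Omega> e \<phi> x = frechet_derivative \<phi> (at x) e"
  by (rule weak_derivative_eqI[OF assms(1) test_function_sobolev_H1[OF assms(1,2)] assms(3)
      test_functions_L2[OF test_functions_frechet_derivative[OF assms(2)] assms(1)]
      test_function_has_weak_derivative[OF assms(1,2)]])

section \<open>The energy inequality for test functions\<close>

text \<open>The fundamental theorem of calculus followed by the Cauchy-Schwarz inequality. The right-hand side is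
  an extended nonnegative integral, so that it can be enlarged and integrated further by Tonelli's theorem.\<close>

lemma increment_sq_le:
  fixes F F' :: "real \<Rightarrow> complex"
  assumes "a \<le> b"
    and deriv: "\<And>t. a \<le> t \<Longrightarrow> t \<le> b \<Longrightarrow> (F has_vector_derivative F' t) (at t within {a..b})"
    and cont: "continuous_on {a..b} F'"
  shows "ennreal ((cmod (F b - F a))\<^sup>2)
    \<le> ennreal (b - a) * (\<integral>\<^sup>+t. indicator {a..b} t * ennreal ((cmod (F' t))\<^sup>2) \<partial>lborel)"
proof -
  let ?f = "\<lambda>t. indicator {a..b} t *\<^sub>R F' t"
  have hb: "has_bochner_integral lborel ?f (F b - F a)"
    by (rule has_bochner_integral_FTC_Icc[OF assms])
  then have int: "integrable lborel ?f" by (rule integrable.intros)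
  then have meas: "(\<lambda>t. ennreal (norm (?f t))) \<in> borel_measurable lborel" by measurable
  have "ennreal (cmod (F b - F a)) \<le> (\<integral>\<^sup>+t. norm (?f t) \<partial>lborel)"
    using has_bochner_integral_norm_bound[OF hb] .
  also have "\<dots> = (\<integral>\<^sup>+t. indicator {a..b} t * ennreal (norm (?f t)) \<partial>lborel)"
    by (intro nn_integral_cong) (auto simp: indicator_def)
  finally have "(ennreal (cmod (F b - F a)))\<^sup>2
      \<le> (\<integral>\<^sup>+t. indicator {a..b} t * ennreal (norm (?f t)) \<partial>lborel)\<^sup>2"
    by (intro power_mono) auto
  also have "\<dots> \<le> (\<integral>\<^sup>+t. (indicator {a..b} t)\<^sup>2 \<partial>lborel) * (\<integral>\<^sup>+t. (ennreal (norm (?f t)))\<^sup>2 \<partial>lborel)"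
    by (intro Cauchy_Schwarz_nn_integral meas) auto
  also have "(\<integral>\<^sup>+t. (indicator {a..b} t :: ennreal)\<^sup>2 \<partial>lborel) = (\<integral>\<^sup>+t. indicator {a..b} t \<partial>lborel)"
    by (intro nn_integral_cong) (auto simp: indicator_def)
  also have "\<dots> = ennreal (b - a)" using \<open>a \<le> b\<close> by simp
  also have "(\<integral>\<^sup>+t. (ennreal (norm (?f t)))\<^sup>2 \<partial>lborel)
      = (\<integral>\<^sup>+t. indicator {a..b} t * ennreal ((cmod (F' t))\<^sup>2) \<partial>lborel)"
    by (intro nn_integral_cong) (auto simp: indicator_def ennreal_power)
  finally show ?thesis by (simp add: ennreal_power)
qed

lemma robin_square_identity:
  fixes w z :: complex and a \<beta> :: real
  shows "(cmod (w - \<i> * a * z + \<beta> * z))\<^sup>2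
    = (cmod (\<i> * w + a * z))\<^sup>2 + \<beta>\<^sup>2 * (cmod z)\<^sup>2 + \<beta> * (2 * (Re z * Re w + Im z * Im w))"
  by (simp only: cmod_power2) (simp add: power2_eq_square algebra_simps)

text \<open>Expanding \<open>\<bar>f' - \<i> a f + \<beta> f\<bar>\<^sup>2\<close> produces the cross term \<open>\<beta> (\<bar>f\<bar>\<^sup>2)'\<close>; the magnetic part of the
  cross term is purely imaginary and drops out. Integrating the cross term gives the Robin boundary term.\<close>

lemma robin_half_line:
  fixes f f' :: "real \<Rightarrow> complex" and a \<beta> h R :: real
  assumes deriv: "\<And>y. (f has_vector_derivative f' y) (at y)" and cont: "continuous_on UNIV f'"
    and supp: "\<And>y. y > R \<Longrightarrow> f y = 0" "\<And>y. y > R \<Longrightarrow> f' y = 0" and \<beta>: "\<beta> > 0"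
  shows "(\<integral>\<^sup>+y. indicator {h<..} y * ennreal ((cmod (\<i> * f' y + a * f y))\<^sup>2 + \<beta>\<^sup>2 * (cmod (f y))\<^sup>2) \<partial>lborel)
    = ennreal (\<beta> * (cmod (f h))\<^sup>2)
      + (\<integral>\<^sup>+y. indicator {h<..} y * ennreal ((cmod (f' y - \<i> * a * f y + \<beta> * f y))\<^sup>2) \<partial>lborel)"
proof -
  define M where "M = max h R + 1"
  have M: "h \<le> M" "M > R" by (auto simp: M_def)
  let ?L = "\<lambda>y. (cmod (\<i> * f' y + a * f y))\<^sup>2 + \<beta>\<^sup>2 * (cmod (f y))\<^sup>2"
  let ?G = "\<lambda>y. (cmod (f' y - \<i> * a * f y + \<beta> * f y))\<^sup>2"
  let ?N = "\<lambda>y. \<beta> * (2 * (Re (f y) * Re (f' y) + Im (f y) * Im (f' y)))"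
  have contf: "continuous_on UNIV f"
    using deriv by (auto intro!: continuous_at_imp_continuous_on has_vector_derivative_continuous)
  have conts: "continuous_on UNIV ?L" "continuous_on UNIV ?G" "continuous_on UNIV ?N"
    using contf cont by (auto intro!: continuous_intros)
  have nn: "(\<integral>\<^sup>+y. indicator {h<..} y * ennreal (u y) \<partial>lborel) = ennreal (\<integral>y. u y * indicator {h..M} y \<partial>lborel)"
    and ii: "integrable lborel (\<lambda>y. u y * indicator {h..M} y)"
    if u: "continuous_on UNIV u" "\<And>y. u y \<ge> 0" "\<And>y. y > R \<Longrightarrow> u y = 0" for u :: "real \<Rightarrow> real"
  proof -
    have "integrable lborel (\<lambda>y. indicator {h..M} y *\<^sub>R u y)"
      by (rule borel_integrable_compact) (auto intro: continuous_on_subset[OF u(1)])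
    then show ii: "integrable lborel (\<lambda>y. u y * indicator {h..M} y)" by (simp add: mult.commute)
    have "(\<integral>\<^sup>+y. indicator {h<..} y * ennreal (u y) \<partial>lborel) = (\<integral>\<^sup>+y. ennreal (u y * indicator {h..M} y) \<partial>lborel)"
    proof (rule nn_integral_cong_AE)
      show "AE y in lborel. indicator {h<..} y * ennreal (u y) = ennreal (u y * indicator {h..M} y)"
        using AE_lborel_singleton[of h] by eventually_elim (use M u(3) in \<open>auto simp: indicator_def\<close>)
    qed
    also have "\<dots> = ennreal (\<integral>y. u y * indicator {h..M} y \<partial>lborel)"
      using u(2) by (intro nn_integral_eq_integral ii) auto
    finally show "(\<integral>\<^sup>+y. indicator {h<..} y * ennreal (u y) \<partial>lborel) = ennreal (\<integral>y. u y * indicator {h..M} y \<partial>lborel)" .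
  qed
  have ftc: "has_bochner_integral lborel (\<lambda>y. ?N y * indicator {h..M} y) (\<beta> * (cmod (f M))\<^sup>2 - \<beta> * (cmod (f h))\<^sup>2)"
  proof (rule has_bochner_integral_FTC_Icc_real[OF M(1)])
    fix y
    show "isCont ?N y" using conts(3) by (simp add: continuous_on_eq_continuous_at)
    have "((\<lambda>y. Re (f y)) has_real_derivative Re (f' y)) (at y)" "((\<lambda>y. Im (f y)) has_real_derivative Im (f' y)) (at y)"
      using deriv[of y] by (auto simp: has_vector_derivative_complex_iff)
    then show "((\<lambda>y. \<beta> * (cmod (f y))\<^sup>2) has_real_derivative ?N y) (at y)"
      unfolding cmod_power2
      by (intro DERIV_cong[OF DERIV_cmult[OF DERIV_add[OF DERIV_power DERIV_power]]]) (auto simp: algebra_simps)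
  qed
  have fM: "f M = 0" using supp M by simp
  note L = nn[OF conts(1)] ii[OF conts(1)] and G = nn[OF conts(2)] ii[OF conts(2)]
  have "(\<integral>y. ?G y * indicator {h..M} y \<partial>lborel)
      = (\<integral>y. ?L y * indicator {h..M} y + ?N y * indicator {h..M} y \<partial>lborel)"
    by (intro Bochner_Integration.integral_cong) (auto simp: robin_square_identity distrib_right)
  also have "\<dots> = (\<integral>y. ?L y * indicator {h..M} y \<partial>lborel) + (\<beta> * (cmod (f M))\<^sup>2 - \<beta> * (cmod (f h))\<^sup>2)"
    using ftc L(2) supp by (subst Bochner_Integration.integral_add)
      (auto simp: has_bochner_integral_iff)
  finally have eq: "(\<integral>y. ?L y * indicator {h..M} y \<partial>lborel)
      = \<beta> * (cmod (f h))\<^sup>2 + (\<integral>y. ?G y * indicator {h..M} y \<partial>lborel)"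
    using fM by simp
  have "(\<integral>y. ?G y * indicator {h..M} y \<partial>lborel) \<ge> 0" by (intro Bochner_Integration.integral_nonneg) auto
  then show ?thesis
    using L(1) G(1) supp \<beta> by (simp add: eq ennreal_plus)
qed

text \<open>The four numbers \<open>p00, p10, p01, p11\<close> stand for the values of a function at the corners of the rectangle
  with vertices \<open>(x, y)\<close> and \<open>(x', y + s)\<close>, and \<open>q\<close> for its value at the boundary point \<open>(x, h)\<close>.
  The factor in \<open>W\<close> turns \<open>\<partial>\<^sub>y - \<i> B x + \<beta>\<close> into \<open>\<partial>\<^sub>y\<close>, so the right-hand side measures how far the function is
  from being parallel along the sides. Passing from height \<open>y\<close> to \<open>y + s\<close> multiplies by a number
  \<open>E\<close> above \<open>x\<close> and by \<open>- E\<close> above \<open>x'\<close>, since the flux through the rectangle is \<open>pi\<close>. Two paths from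
  \<open>p00\<close> to \<open>p11\<close> thus disagree in sign, which bounds \<open>p00\<close> and then \<open>q\<close>.\<close>

lemma holonomy_estimate:
  fixes p00 p01 p10 p11 q :: complex and \<beta> B x x' h y s H Y :: real
  defines "W \<equiv> (\<lambda>x y p. exp (complex_of_real (\<beta> * y) - \<i> * complex_of_real (B * x * y)) * p)"
  assumes \<beta>: "\<beta> > 0" and flux: "B * (x' - x) * s = pi" and s: "s > 0"
    and h: "\<bar>h\<bar> \<le> H" and y: "0 \<le> y" "y \<le> Y" "s \<le> Y" "H \<le> Y"
  shows "(cmod q)\<^sup>2 \<le> 5 * exp (\<beta> * Y) ^ 6 *
    ((cmod (W x (y + s) p01 - W x y p00))\<^sup>2 + (cmod (W x' (y + s) p11 - W x' y p10))\<^sup>2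
      + (cmod (p10 - p00))\<^sup>2 + (cmod (p11 - p01))\<^sup>2 + (cmod (W x y p00 - W x h q))\<^sup>2)"
proof -
  define E where "E = exp (complex_of_real (\<beta> * s) - \<i> * complex_of_real (B * x * s))"
  define E1 where "E1 = exp (\<beta> * Y)"
  define v0 where "v0 = cmod (W x (y + s) p01 - W x y p00)"
  define v1 where "v1 = cmod (W x' (y + s) p11 - W x' y p10)"
  define v2 where "v2 = cmod (W x y p00 - W x h q)"
  define k0 where "k0 = cmod (p10 - p00)"
  define k1 where "k1 = cmod (p11 - p01)"
  have nn: "v0 \<ge> 0" "v1 \<ge> 0" "v2 \<ge> 0" "k0 \<ge> 0" "k1 \<ge> 0" by (auto simp: v0_def v1_def v2_def k0_def k1_def)
  have W: "cmod (W x y p) = exp (\<beta> * y) * cmod p" for x y p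
    by (simp add: W_def norm_mult)
  have E1: "E1 \<ge> 1" "exp (\<beta> * y) \<le> E1" "exp (\<beta> * s) \<le> E1" "exp (- (\<beta> * h)) \<le> E1"
  proof -
    have "- h \<le> Y" using h y by linarith
    then have "\<beta> * (- h) \<le> \<beta> * Y" using \<beta> by (intro mult_left_mono) auto
    then show "exp (- (\<beta> * h)) \<le> E1" by (simp add: E1_def)
    show "E1 \<ge> 1" using y \<beta> by (simp add: E1_def)
  qed (use y \<beta> in \<open>auto simp: E1_def\<close>)
  have cE: "cmod E \<le> E1" using E1 by (simp add: E_def)
  have Wx: "W x (y + s) p = W x y (E * p)" for p
  proof -
    have "exp (complex_of_real (\<beta> * (y + s)) - \<i> * complex_of_real (B * x * (y + s)))
        = exp (complex_of_real (\<beta> * y) - \<i> * complex_of_real (B * x * y)) * E"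
      unfolding E_def exp_add[symmetric] by (rule arg_cong[where f=exp]) (simp add: algebra_simps)
    then show ?thesis by (simp add: W_def)
  qed
  have Wx': "W x' (y + s) p = W x' y (- E * p)" for p
  proof -
    have "exp (complex_of_real (\<beta> * (y + s)) - \<i> * complex_of_real (B * x' * (y + s)))
        = exp (complex_of_real (\<beta> * y) - \<i> * complex_of_real (B * x' * y))
          * (E * exp (- (\<i> * complex_of_real (B * (x' - x) * s))))"
      unfolding E_def exp_add[symmetric] by (rule arg_cong[where f=exp]) (simp add: algebra_simps)
    also have "exp (- (\<i> * complex_of_real (B * (x' - x) * s))) = -1"
      unfolding flux by (simp add: exp_minus)
    finally show ?thesis by (simp add: W_def)
  qed
  have Wdiff: "cmod (W x y p - W x y p') = exp (\<beta> * y) * cmod (p - p')" for x p p'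
    using W[of x y "p - p'"] by (simp add: W_def right_diff_distrib)
  have ey: "exp (\<beta> * y) \<ge> 1" using \<beta> y by simp
  have a0: "cmod (E * p01 - p00) \<le> v0"
    using mult_right_mono[OF ey norm_ge_zero[of "E * p01 - p00"]] by (simp add: v0_def Wx Wdiff)
  have a1: "cmod (E * p11 + p10) \<le> v1"
  proof -
    have "cmod (E * p11 + p10) = cmod (- E * p11 - p10)"
      by (metis minus_diff_eq mult_minus_left norm_minus_cancel diff_minus_eq_add add.commute)
    also have "\<dots> \<le> v1"
      using mult_right_mono[OF ey norm_ge_zero[of "- E * p11 - p10"]] by (simp add: v1_def Wx' Wdiff)
    finally show ?thesis .
  qed
  have a2: "cmod (E * (p01 - p11)) \<le> E1 * k1"
    using mult_right_mono[OF cE nn(5)] by (simp add: norm_mult k1_def norm_minus_commute)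
  have "2 * p00 = (p00 - E * p01) + (E * p11 + p10) + E * (p01 - p11) - (p10 - p00)"
    by (simp add: algebra_simps)
  then have "cmod (2 * p00) \<le> cmod (p00 - E * p01) + cmod (E * p11 + p10) + cmod (E * (p01 - p11)) + cmod (p10 - p00)"
    by (metis (no_types, opaque_lifting) add_mono norm_triangle_le norm_triangle_le_diff order_refl)
  then have "2 * cmod p00 \<le> v0 + v1 + E1 * k1 + k0"
    using a0 a1 a2 by (simp add: norm_mult norm_minus_commute k0_def)
  also have "\<dots> \<le> E1 * (v0 + v1 + k1 + k0)"
    using mult_right_mono[OF E1(1) nn(1)] mult_right_mono[OF E1(1) nn(2)] mult_right_mono[OF E1(1) nn(4)]
    by (simp add: algebra_simps)
  finally have p00: "2 * cmod p00 \<le> E1 * (v0 + v1 + k1 + k0)" .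
  have "exp (\<beta> * h) * cmod q \<le> cmod (W x y p00) + v2"
    using norm_triangle_ineq2[of "W x h q" "W x y p00"] by (simp add: W v2_def norm_minus_commute)
  then have "exp (- (\<beta> * h)) * (exp (\<beta> * h) * cmod q) \<le> exp (- (\<beta> * h)) * (exp (\<beta> * y) * cmod p00 + v2)"
    unfolding W by (intro mult_left_mono) auto
  then have "cmod q \<le> exp (- (\<beta> * h)) * (exp (\<beta> * y) * cmod p00 + v2)"
    by (simp add: mult.assoc[symmetric] exp_add[symmetric])
  also have "\<dots> \<le> E1 * (E1 * (E1 * (v0 + v1 + k1 + k0)) + v2)"
  proof (intro mult_mono add_mono E1 order_refl)
    have "0 \<le> E1 * (v0 + v1 + k1 + k0)" using p00 norm_ge_zero[of p00] by linarith
    then show "cmod p00 \<le> E1 * (v0 + v1 + k1 + k0)" using p00 by linarith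
  qed (use E1 nn in auto)
  also have "\<dots> \<le> E1 * (E1 * (E1 * (v0 + v1 + k1 + k0)) + E1 * (E1 * v2))"
    using E1(1) nn mult_mono[OF E1(1) E1(1)] mult_right_mono[of 1 "E1 * E1" v2]
    by (intro mult_left_mono add_left_mono) (auto simp: mult.assoc)
  also have "\<dots> = E1 ^ 3 * (v0 + v1 + k0 + k1 + v2)" by (simp add: algebra_simps power3_eq_cube)
  finally have "(cmod q)\<^sup>2 \<le> (E1 ^ 3 * (v0 + v1 + k0 + k1 + v2))\<^sup>2"
    by (intro power_mono) auto
  also have "\<dots> = E1 ^ 6 * (v0 + v1 + k0 + k1 + v2)\<^sup>2"
    by (simp add: power_mult_distrib flip: power_mult)
  also have "\<dots> \<le> E1 ^ 6 * (5 * (v0\<^sup>2 + v1\<^sup>2 + k0\<^sup>2 + k1\<^sup>2 + v2\<^sup>2))"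
  proof (rule mult_left_mono)
    \<comment> \<open>Cauchy-Schwarz for five numbers, as a sum of squares of differences\<close>
    have "0 \<le> (v0 - v1)\<^sup>2 + (v0 - k0)\<^sup>2 + (v0 - k1)\<^sup>2 + (v0 - v2)\<^sup>2 + (v1 - k0)\<^sup>2 + (v1 - k1)\<^sup>2
        + (v1 - v2)\<^sup>2 + (k0 - k1)\<^sup>2 + (k0 - v2)\<^sup>2 + (k1 - v2)\<^sup>2" by simp
    then show "(v0 + v1 + k0 + k1 + v2)\<^sup>2 \<le> 5 * (v0\<^sup>2 + v1\<^sup>2 + k0\<^sup>2 + k1\<^sup>2 + v2\<^sup>2)"
      by (simp add: power2_eq_square algebra_simps)
  qed (use E1 in auto)
  also have "\<dots> = 5 * E1 ^ 6 * (v0\<^sup>2 + v1\<^sup>2 + k0\<^sup>2 + k1\<^sup>2 + v2\<^sup>2)" by simp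
  finally show ?thesis
    unfolding E1_def v0_def v1_def k0_def k1_def v2_def .
qed

abbreviation dx :: "(real \<times> real \<Rightarrow> complex) \<Rightarrow> real \<times> real \<Rightarrow> complex" where
  "dx \<phi> p \<equiv> frechet_derivative \<phi> (at p) (1, 0)"

abbreviation dy :: "(real \<times> real \<Rightarrow> complex) \<Rightarrow> real \<times> real \<Rightarrow> complex" where
  "dy \<phi> p \<equiv> frechet_derivative \<phi> (at p) (0, 1)"

lemma partial_derivatives:
  fixes \<phi> :: "real \<times> real \<Rightarrow> complex"
  assumes "\<phi> \<in> test_functions \<Omega>"
  shows "((\<lambda>x. \<phi> (x, y)) has_vector_derivative dx \<phi> (x, y)) (at x within S)"
    and "((\<lambda>y. \<phi> (x, y)) has_vector_derivative dy \<phi> (x, y)) (at y within S)"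
proof -
  have lin: "frechet_derivative \<phi> (at p) (c *\<^sub>R v) = c *\<^sub>R frechet_derivative \<phi> (at p) v" for p c v
    using has_derivative_linear[OF test_functions_has_derivative[OF assms]] by (rule linear_scale)
  have "((\<lambda>x. (x, y)) has_derivative (\<lambda>h. h *\<^sub>R (1, 0))) (at x within S)"
    using has_derivative_Pair[OF has_derivative_ident has_derivative_const] by simp
  from has_derivative_compose[OF this test_functions_has_derivative[OF assms]]
  show "((\<lambda>x. \<phi> (x, y)) has_vector_derivative dx \<phi> (x, y)) (at x within S)"
    unfolding has_vector_derivative_def lin .
  have "((\<lambda>y. (x, y)) has_derivative (\<lambda>h. h *\<^sub>R (0, 1))) (at y within S)"
    using has_derivative_Pair[OF has_derivative_const has_derivative_ident] by simp
  from has_derivative_compose[OF this test_functions_has_derivative[OF assms]]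
  show "((\<lambda>y. \<phi> (x, y)) has_vector_derivative dy \<phi> (x, y)) (at y within S)"
    unfolding has_vector_derivative_def lin .
qed

lemma nn_integral_lborel_pair:
  fixes f :: "real \<times> real \<Rightarrow> ennreal"
  assumes f: "f \<in> borel_measurable borel"
  shows "(\<integral>\<^sup>+x. \<integral>\<^sup>+y. f (x, y) \<partial>lborel \<partial>lborel) = (\<integral>\<^sup>+p. f p \<partial>lborel)"
    and "(\<integral>\<^sup>+y. \<integral>\<^sup>+x. f (x, y) \<partial>lborel \<partial>lborel) = (\<integral>\<^sup>+p. f p \<partial>lborel)"
    and "(\<lambda>x. \<integral>\<^sup>+y. f (x, y) \<partial>lborel) \<in> borel_measurable borel"
    and "(\<lambda>y. \<integral>\<^sup>+x. f (x, y) \<partial>lborel) \<in> borel_measurable borel"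
proof -
  have m: "f \<in> borel_measurable (lborel \<Otimes>\<^sub>M lborel)" using f by (simp add: lborel_prod)
  show "(\<integral>\<^sup>+x. \<integral>\<^sup>+y. f (x, y) \<partial>lborel \<partial>lborel) = (\<integral>\<^sup>+p. f p \<partial>lborel)"
    using lborel.nn_integral_fst[OF m] by (simp add: lborel_prod)
  show "(\<integral>\<^sup>+y. \<integral>\<^sup>+x. f (x, y) \<partial>lborel \<partial>lborel) = (\<integral>\<^sup>+p. f p \<partial>lborel)"
    using lborel_pair.nn_integral_snd[OF m] by (simp add: lborel_prod)
  show "(\<lambda>x. \<integral>\<^sup>+y. f (x, y) \<partial>lborel) \<in> borel_measurable borel"
    using lborel.borel_measurable_nn_integral_fst[OF m] by simp
  have "(\<lambda>(y, x). f (x, y)) \<in> borel_measurable (lborel \<Otimes>\<^sub>M lborel)"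
    using m by (rule measurable_pair_swap)
  then show "(\<lambda>y. \<integral>\<^sup>+x. f (x, y) \<partial>lborel) \<in> borel_measurable borel"
    using lborel.borel_measurable_nn_integral_fst by fastforce
qed

text \<open>The number \<open>Y\<close> is the largest height reached by the rectangles of width \<open>t\<close> and flux \<open>pi\<close> that start between the
  heights \<open>H\<close> and \<open>H + 1\<close>.\<close>

definition holonomy_const :: "real \<Rightarrow> real \<Rightarrow> real \<Rightarrow> real \<Rightarrow> real \<Rightarrow> real" where
  "holonomy_const B \<beta> t H m =
    (let Y = H + 1 + pi / (B * t) in 5 * exp (\<beta> * Y) ^ 6 * (4 * Y * (exp (\<beta> * Y))\<^sup>2 + t) * (2 + 4 * m))"

lemma holonomy_const_mono:
  assumes "B > 0" "t > 0" "H \<ge> 0" "m \<ge> 0" "\<beta> \<le> \<beta>'"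
  shows "holonomy_const B \<beta> t H m \<le> holonomy_const B \<beta>' t H m"
proof -
  have "H + 1 + pi / (B * t) \<ge> 0" using assms by simp
  then show ?thesis
    unfolding holonomy_const_def Let_def using assms
    by (intro mult_mono power_mono add_mono order_refl) (auto intro!: mult_right_mono)
qed

lemma holonomy_const_pos:
  assumes "B > 0" "t > 0" "H \<ge> 0" "m \<ge> 0"
  shows "holonomy_const B \<beta> t H m > 0"
proof -
  define Y where "Y = H + 1 + pi / (B * t)"
  have "Y \<ge> 0" "2 + 4 * m > 0" using assms by (simp_all add: Y_def)
  moreover have "4 * Y * (exp (\<beta> * Y))\<^sup>2 + t > 0" using \<open>Y \<ge> 0\<close> assms by (simp add: add_nonneg_pos)
  ultimately show ?thesis
    unfolding holonomy_const_def Let_def Y_def[symmetric] by simp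
qed

definition epigraph :: "(real \<Rightarrow> real) \<Rightarrow> (real \<times> real) set" where
  "epigraph h = {p. h (fst p) < snd p}"

lemma open_epigraph: "continuous_on UNIV h \<Longrightarrow> open (epigraph h)"
  unfolding epigraph_def
  by (intro open_Collect_less continuous_on_compose2[of UNIV h UNIV fst] continuous_on_fst
      continuous_on_snd continuous_on_id) auto

text \<open>For each \<open>x\<close> in \<open>[-m, m]\<close> the rectangle of width \<open>t\<close> and flux \<open>pi\<close> is started at every height between \<open>H\<close> and
  \<open>H + 1\<close>, above the whole graph. The increments along the sides are controlled by \<open>g\<close> on vertical
  lines and by \<open>\<partial>\<^sub>x \<phi>\<close> on horizontal ones. Averaging over the starting height and integrating over \<open>x\<close> turns these
  line integrals into integrals over the region above the graph.\<close>

lemma holonomy_hardy: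
  fixes \<phi> :: "real \<times> real \<Rightarrow> complex" and a h :: "real \<Rightarrow> real" and B \<beta> t H m \<alpha> :: real
  defines "g \<equiv> \<lambda>p. dy \<phi> p - \<i> * complex_of_real (B * a (fst p)) * \<phi> p + \<beta> * \<phi> p"
  assumes \<phi>: "\<phi> \<in> test_functions \<Omega>" and B: "B > 0" and \<beta>: "\<beta> > 0" and t: "t > 0" and m: "m \<ge> 0"
    and mt: "m + t < \<alpha>" and a[measurable]: "a \<in> borel_measurable borel"
    and ax: "\<And>x. \<bar>x\<bar> < \<alpha> \<Longrightarrow> a x = x"
    and h: "continuous_on UNIV h" and hH: "\<And>x. \<bar>h x\<bar> \<le> H"
  shows "(\<integral>\<^sup>+x. indicator {-m..m} x * ennreal ((cmod (\<phi> (x, h x)))\<^sup>2) \<partial>lborel)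
    \<le> ennreal (holonomy_const B \<beta> t H m) *
      ((\<integral>\<^sup>+p. indicator (epigraph h) p * ennreal ((cmod (dx \<phi> p))\<^sup>2) \<partial>lborel)
       + (\<integral>\<^sup>+p. indicator (epigraph h) p * ennreal ((cmod (g p))\<^sup>2) \<partial>lborel))"
proof -
  \<comment> \<open>the height for which the flux \<open>B * t * s\<close> equals \<open>pi\<close>\<close>
  define s where "s = pi / (B * t)"
  define Y where "Y = H + 1 + s"
  define E1 where "E1 = exp (\<beta> * Y)"
  define K where "K = 5 * E1 ^ 6 * (4 * Y * E1\<^sup>2 + t)"
  define \<Gamma> where "\<Gamma> x = (\<integral>\<^sup>+y. indicator (epigraph h) (x, y) * ennreal ((cmod (g (x, y)))\<^sup>2) \<partial>lborel)" for x
  define \<Phi> where "\<Phi> y = (\<integral>\<^sup>+x. indicator (epigraph h) (x, y) * ennreal ((cmod (dx \<phi> (x, y)))\<^sup>2) \<partial>lborel)" for y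
  define G where "G = (\<integral>\<^sup>+p. indicator (epigraph h) p * ennreal ((cmod (g p))\<^sup>2) \<partial>lborel)"
  define P where "P = (\<integral>\<^sup>+p. indicator (epigraph h) p * ennreal ((cmod (dx \<phi> p))\<^sup>2) \<partial>lborel)"
  let ?e = "\<lambda>x y. exp (complex_of_real (\<beta> * y) - \<i> * complex_of_real (B * x * y))"
  let ?W = "\<lambda>x y p. exp (complex_of_real (\<beta> * y) - \<i> * complex_of_real (B * x * y)) * p"
  have H0: "H \<ge> 0" using hH[of 0] by linarith
  have s: "s > 0" using B t by (simp add: s_def)
  have Y: "Y > 0" "s \<le> Y" "H \<le> Y" using H0 s by (auto simp: Y_def)
  have E1: "E1 \<ge> 1" using \<beta> Y by (simp add: E1_def)
  have K0: "K \<ge> 0" using E1 Y t by (simp add: K_def)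
  have Kh: "holonomy_const B \<beta> t H m = K * (2 + 4 * m)"
    by (simp add: holonomy_const_def Let_def K_def E1_def Y_def s_def)
  have [measurable]: "epigraph h \<in> sets borel"
    using open_epigraph[OF h] by (rule borel_open)
  have [measurable]: "\<phi> \<in> borel_measurable borel" "(\<lambda>p. dx \<phi> p) \<in> borel_measurable borel"
    "(\<lambda>p. dy \<phi> p) \<in> borel_measurable borel"
    using \<phi> by (auto intro!: test_functions_borel[of _ \<Omega>] test_functions_frechet_derivative)
  have [measurable]: "(fst :: real \<times> real \<Rightarrow> real) \<in> borel_measurable borel"
    by (intro borel_measurable_continuous_onI continuous_on_fst continuous_on_id)
  have gm[measurable]: "g \<in> borel_measurable borel" unfolding g_def by measurable
  have mG: "(\<lambda>p. indicator (epigraph h) p * ennreal ((cmod (g p))\<^sup>2)) \<in> borel_measurable borel"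
    and mP: "(\<lambda>p. indicator (epigraph h) p * ennreal ((cmod (dx \<phi> p))\<^sup>2)) \<in> borel_measurable borel"
    by measurable
  have intG: "(\<integral>\<^sup>+x. \<Gamma> x \<partial>lborel) = G" and [measurable]: "\<Gamma> \<in> borel_measurable borel"
    unfolding \<Gamma>_def G_def using nn_integral_lborel_pair[OF mG] by auto
  have intP: "(\<integral>\<^sup>+y. \<Phi> y \<partial>lborel) = P" and [measurable]: "\<Phi> \<in> borel_measurable borel"
    unfolding \<Phi>_def P_def using nn_integral_lborel_pair[OF mP] by auto
  have shift: "(\<integral>\<^sup>+x. u (x + c) \<partial>lborel) = (\<integral>\<^sup>+x. u x \<partial>lborel)"
    if "u \<in> borel_measurable borel" for u :: "real \<Rightarrow> ennreal" and c
    using nn_integral_real_affine[OF that, of 1 c] by (simp add: add.commute)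

  have vert: "ennreal ((cmod (?W x y2 (\<phi> (x, y2)) - ?W x y1 (\<phi> (x, y1))))\<^sup>2) \<le> ennreal (2 * Y * E1\<^sup>2) * \<Gamma> x"
    if x: "\<bar>x\<bar> < \<alpha>" and y: "h x \<le> y1" "y1 \<le> y2" "y2 \<le> Y" for x y1 y2
  proof -
    let ?F' = "\<lambda>y. ?e x y * g (x, y)"
    have "ennreal ((cmod (?W x y2 (\<phi> (x, y2)) - ?W x y1 (\<phi> (x, y1))))\<^sup>2)
        \<le> ennreal (y2 - y1) * (\<integral>\<^sup>+y. indicator {y1..y2} y * ennreal ((cmod (?F' y))\<^sup>2) \<partial>lborel)"
    proof (rule increment_sq_le[OF y(2)])
      have gx: "g (x, y) = dy \<phi> (x, y) + (complex_of_real \<beta> - \<i> * complex_of_real (B * x)) * \<phi> (x, y)" for y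
        using ax[OF x] by (simp add: g_def algebra_simps)
      have "((\<lambda>y. \<phi> (x, y)) has_vector_derivative dy \<phi> (x, y)) (at y within T)" for y T
        by (rule partial_derivatives(2)[OF \<phi>])
      moreover have "((\<lambda>y. ?e x y) has_vector_derivative
          (?e x y * (complex_of_real \<beta> - \<i> * complex_of_real (B * x)))) (at y within T)" for y T
      proof -
        have "((\<lambda>z. exp (z * (complex_of_real \<beta> - \<i> * complex_of_real (B * x)))) has_field_derivative
          (exp (of_real y * (complex_of_real \<beta> - \<i> * complex_of_real (B * x))) * (complex_of_real \<beta> - \<i> * complex_of_real (B * x)))) (at (of_real y))"
          by (auto intro!: derivative_eq_intros)
        from has_vector_derivative_real_field[OF this] show ?thesis
          by (simp add: algebra_simps o_def)
      qed
      ultimately have "((\<lambda>y. ?W x y (\<phi> (x, y))) has_vector_derivative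
          (?e x y * dy \<phi> (x, y)
           + ?e x y * (complex_of_real \<beta> - \<i> * complex_of_real (B * x)) * \<phi> (x, y)))
          (at y within T)" for y T
        by (intro has_vector_derivative_mult)
      then show "((\<lambda>y. ?W x y (\<phi> (x, y))) has_vector_derivative ?F' y) (at y within {y1..y2})" for y
        by (rule has_vector_derivative_eq_rhs) (simp add: gx distrib_left mult.assoc)
      have "continuous_on {y1..y2} (\<lambda>y. \<phi> (x, y))" "continuous_on {y1..y2} (\<lambda>y. dy \<phi> (x, y))"
        by (auto intro!: continuous_intros continuous_on_compose2[OF test_functions_continuous[of _ \<Omega> UNIV]]
            \<phi> test_functions_frechet_derivative)
      then show "continuous_on {y1..y2} ?F'" unfolding gx by (intro continuous_intros)
    qed
    also have "\<dots> \<le> ennreal (2 * Y) * (ennreal (E1\<^sup>2) * \<Gamma> x)"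
    proof (intro mult_mono)
      show "ennreal (y2 - y1) \<le> ennreal (2 * Y)"
        using hH[of x] y Y by (intro ennreal_leI) linarith
      have "(\<integral>\<^sup>+y. indicator {y1..y2} y * ennreal ((cmod (?F' y))\<^sup>2) \<partial>lborel)
          \<le> (\<integral>\<^sup>+y. ennreal (E1\<^sup>2) * (indicator (epigraph h) (x, y) * ennreal ((cmod (g (x, y)))\<^sup>2)) \<partial>lborel)"
      proof (rule nn_integral_mono_AE)
        have le: "(cmod (?F' y))\<^sup>2 \<le> E1\<^sup>2 * (cmod (g (x, y)))\<^sup>2" if "y \<le> y2" for y
        proof -
          have "exp (\<beta> * y) \<le> E1" using \<beta> that \<open>y2 \<le> Y\<close> by (simp add: E1_def)
          then have "(exp (\<beta> * y))\<^sup>2 \<le> E1\<^sup>2" by (intro power_mono) auto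
          then show ?thesis by (simp add: norm_mult power_mult_distrib mult_right_mono)
        qed
        show "AE y in lborel. indicator {y1..y2} y * ennreal ((cmod (?F' y))\<^sup>2)
          \<le> ennreal (E1\<^sup>2) * (indicator (epigraph h) (x, y) * ennreal ((cmod (g (x, y)))\<^sup>2))"
          using AE_lborel_singleton[of "h x"]
        proof eventually_elim
          case (elim y)
          show ?case
          proof (cases "y \<in> {y1..y2}")
            case True
            then have "(x, y) \<in> epigraph h" using elim y(1) by (auto simp: epigraph_def)
            then show ?thesis using True le[of y] by (simp add: ennreal_leI flip: ennreal_mult)
          qed simp
        qed
      qed
      also have "\<dots> = ennreal (E1\<^sup>2) * \<Gamma> x"
        unfolding \<Gamma>_def by (rule nn_integral_cmult) measurable
      finally show "(\<integral>\<^sup>+y. indicator {y1..y2} y * ennreal ((cmod (?F' y))\<^sup>2) \<partial>lborel) \<le> ennreal (E1\<^sup>2) * \<Gamma> x" .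
    qed auto
    also have "\<dots> = ennreal (2 * Y * E1\<^sup>2) * \<Gamma> x" using Y by (simp add: ennreal_mult mult.assoc)
    finally show ?thesis .
  qed
  have horiz: "ennreal ((cmod (\<phi> (x + t, y) - \<phi> (x, y)))\<^sup>2) \<le> ennreal t * \<Phi> y" if y: "y > H" for x y
  proof -
    have "ennreal ((cmod (\<phi> (x + t, y) - \<phi> (x, y)))\<^sup>2)
        \<le> ennreal (x + t - x) * (\<integral>\<^sup>+\<xi>. indicator {x..x + t} \<xi> * ennreal ((cmod (dx \<phi> (\<xi>, y)))\<^sup>2) \<partial>lborel)"
      using t by (intro increment_sq_le partial_derivatives(1)[OF \<phi>])
       (auto intro!: continuous_intros continuous_on_compose2[OF test_functions_continuous[of _ \<Omega> UNIV]]
            \<phi> test_functions_frechet_derivative)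
    also have "(\<integral>\<^sup>+\<xi>. indicator {x..x + t} \<xi> * ennreal ((cmod (dx \<phi> (\<xi>, y)))\<^sup>2) \<partial>lborel) \<le> \<Phi> y"
      unfolding \<Phi>_def
    proof (rule nn_integral_mono)
      fix \<xi>
      have "(\<xi>, y) \<in> epigraph h" using hH[of \<xi>] y by (auto simp: epigraph_def)
      then show "indicator {x..x + t} \<xi> * ennreal ((cmod (dx \<phi> (\<xi>, y)))\<^sup>2)
          \<le> indicator (epigraph h) (\<xi>, y) * ennreal ((cmod (dx \<phi> (\<xi>, y)))\<^sup>2)"
        by (auto simp: indicator_def)
    qed
    finally show ?thesis by (simp add: mult_left_mono)
  qed
  have point: "ennreal ((cmod (\<phi> (x, h x)))\<^sup>2) \<le> ennreal K * (\<Gamma> x + \<Gamma> (x + t) + (\<Phi> y + \<Phi> (y + s)))"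
    if x: "x \<in> {-m..m}" and y: "H < y" "y < H + 1" for x y
  proof -
    have xa: "\<bar>x\<bar> < \<alpha>" "\<bar>x + t\<bar> < \<alpha>" using x mt t m by (auto simp: abs_less_iff)
    have hy: "h x \<le> y" "h (x + t) \<le> y" using hH[of x] hH[of "x + t"] y by linarith+
    have ys: "y \<le> Y" "y + s \<le> Y" using y s by (auto simp: Y_def)
    have flux: "B * (x + t - x) * s = pi" using B t by (simp add: s_def)
    define v0 where "v0 = (cmod (?W x (y + s) (\<phi> (x, y + s)) - ?W x y (\<phi> (x, y))))\<^sup>2"
    define v1 where "v1 = (cmod (?W (x + t) (y + s) (\<phi> (x + t, y + s)) - ?W (x + t) y (\<phi> (x + t, y))))\<^sup>2"
    define k0 where "k0 = (cmod (\<phi> (x + t, y) - \<phi> (x, y)))\<^sup>2"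
    define k1 where "k1 = (cmod (\<phi> (x + t, y + s) - \<phi> (x, y + s)))\<^sup>2"
    define v2 where "v2 = (cmod (?W x y (\<phi> (x, y)) - ?W x (h x) (\<phi> (x, h x))))\<^sup>2"
    have nn: "v0 \<ge> 0" "v1 \<ge> 0" "k0 \<ge> 0" "k1 \<ge> 0" "v2 \<ge> 0"
      by (auto simp: v0_def v1_def k0_def k1_def v2_def)
    have "(cmod (\<phi> (x, h x)))\<^sup>2 \<le> 5 * E1 ^ 6 * (v0 + v1 + k0 + k1 + v2)"
      unfolding v0_def v1_def k0_def k1_def v2_def E1_def
      by (rule holonomy_estimate[OF \<beta> flux s hH]) (use y H0 ys Y in auto)
    then have "ennreal ((cmod (\<phi> (x, h x)))\<^sup>2) \<le> ennreal (5 * E1 ^ 6 * (v0 + v1 + k0 + k1 + v2))"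
      by (rule ennreal_leI)
    also have "\<dots> = ennreal (5 * E1 ^ 6) * (ennreal v0 + ennreal v1 + ennreal k0 + ennreal k1 + ennreal v2)"
      using nn E1 by (simp add: ennreal_mult ennreal_plus)
    also have "\<dots> \<le> ennreal (5 * E1 ^ 6) * (ennreal (2 * Y * E1\<^sup>2) * \<Gamma> x + ennreal (2 * Y * E1\<^sup>2) * \<Gamma> (x + t)
        + ennreal t * \<Phi> y + ennreal t * \<Phi> (y + s) + ennreal (2 * Y * E1\<^sup>2) * \<Gamma> x)"
      unfolding v0_def v1_def k0_def k1_def v2_def using xa hy ys y s
      by (intro mult_left_mono add_mono vert horiz) auto
    also have "\<dots> \<le> ennreal (5 * E1 ^ 6) * (ennreal (4 * Y * E1\<^sup>2 + t) * \<Gamma> x + ennreal (4 * Y * E1\<^sup>2 + t) * \<Gamma> (x + t)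
        + (ennreal (4 * Y * E1\<^sup>2 + t) * \<Phi> y + ennreal (4 * Y * E1\<^sup>2 + t) * \<Phi> (y + s)))"
    proof (rule mult_left_mono)
      have 1: "ennreal (2 * Y * E1\<^sup>2) * \<Gamma> x + ennreal (2 * Y * E1\<^sup>2) * \<Gamma> x \<le> ennreal (4 * Y * E1\<^sup>2 + t) * \<Gamma> x"
        unfolding distrib_right[symmetric] using Y t
        by (intro mult_right_mono) (auto simp flip: ennreal_plus intro!: ennreal_leI)
      have 2: "ennreal (2 * Y * E1\<^sup>2) * \<Gamma> (x + t) \<le> ennreal (4 * Y * E1\<^sup>2 + t) * \<Gamma> (x + t)"
        using Y t by (intro mult_right_mono ennreal_leI) (auto intro!: add_increasing2 mult_right_mono)
      have 3: "ennreal t * \<Phi> y \<le> ennreal (4 * Y * E1\<^sup>2 + t) * \<Phi> y" for y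
        using Y t by (intro mult_right_mono ennreal_leI) auto
      show "ennreal (2 * Y * E1\<^sup>2) * \<Gamma> x + ennreal (2 * Y * E1\<^sup>2) * \<Gamma> (x + t)
        + ennreal t * \<Phi> y + ennreal t * \<Phi> (y + s) + ennreal (2 * Y * E1\<^sup>2) * \<Gamma> x
        \<le> ennreal (4 * Y * E1\<^sup>2 + t) * \<Gamma> x + ennreal (4 * Y * E1\<^sup>2 + t) * \<Gamma> (x + t)
        + (ennreal (4 * Y * E1\<^sup>2 + t) * \<Phi> y + ennreal (4 * Y * E1\<^sup>2 + t) * \<Phi> (y + s))"
        using add_mono[OF add_mono[OF 1 2] add_mono[OF 3[of y] 3[of "y + s"]]] by (simp add: ac_simps)
    qed auto
    also have "\<dots> = ennreal K * (\<Gamma> x + \<Gamma> (x + t) + (\<Phi> y + \<Phi> (y + s)))"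
    proof -
      have "ennreal K = ennreal (5 * E1 ^ 6) * ennreal (4 * Y * E1\<^sup>2 + t)"
        unfolding K_def using E1 Y t by (intro ennreal_mult) auto
      then show ?thesis by (simp only: mult.assoc distrib_left)
    qed
    finally show ?thesis .
  qed
  have slice: "ennreal ((cmod (\<phi> (x, h x)))\<^sup>2) \<le> ennreal K * (\<Gamma> x + \<Gamma> (x + t) + (P + P))" if x: "x \<in> {-m..m}" for x
  proof -
    have "ennreal ((cmod (\<phi> (x, h x)))\<^sup>2) = (\<integral>\<^sup>+y. ennreal ((cmod (\<phi> (x, h x)))\<^sup>2) * indicator {H<..<H + 1} y \<partial>lborel)"
      by (simp add: nn_integral_cmult_indicator)
    also have "\<dots> \<le> (\<integral>\<^sup>+y. ennreal K * ((\<Gamma> x + \<Gamma> (x + t)) * indicator {H<..<H + 1} y + (\<Phi> y + \<Phi> (y + s))) \<partial>lborel)"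
    proof (rule nn_integral_mono)
      fix y show "ennreal ((cmod (\<phi> (x, h x)))\<^sup>2) * indicator {H<..<H + 1} y
          \<le> ennreal K * ((\<Gamma> x + \<Gamma> (x + t)) * indicator {H<..<H + 1} y + (\<Phi> y + \<Phi> (y + s)))"
        using point[OF x, of y] by (auto simp: indicator_def)
    qed
    also have "\<dots> = ennreal K * ((\<integral>\<^sup>+y. (\<Gamma> x + \<Gamma> (x + t)) * indicator {H<..<H + 1} y \<partial>lborel)
        + ((\<integral>\<^sup>+y. \<Phi> y \<partial>lborel) + (\<integral>\<^sup>+y. \<Phi> (y + s) \<partial>lborel)))"
      by (subst nn_integral_cmult, measurable, subst nn_integral_add, measurable, subst nn_integral_add, measurable)
    also have "\<dots> = ennreal K * (\<Gamma> x + \<Gamma> (x + t) + (P + P))"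
      by (simp add: nn_integral_cmult_indicator shift intP)
    finally show ?thesis .
  qed
  have "(\<integral>\<^sup>+x. indicator {-m..m} x * ennreal ((cmod (\<phi> (x, h x)))\<^sup>2) \<partial>lborel)
      \<le> (\<integral>\<^sup>+x. ennreal K * ((\<Gamma> x + \<Gamma> (x + t)) + (P + P) * indicator {-m..m} x) \<partial>lborel)"
  proof (rule nn_integral_mono)
    fix x show "indicator {-m..m} x * ennreal ((cmod (\<phi> (x, h x)))\<^sup>2)
        \<le> ennreal K * ((\<Gamma> x + \<Gamma> (x + t)) + (P + P) * indicator {-m..m} x)"
      using slice[of x] by (auto simp: indicator_def)
  qed
  also have "\<dots> = ennreal K * (((\<integral>\<^sup>+x. \<Gamma> x \<partial>lborel) + (\<integral>\<^sup>+x. \<Gamma> (x + t) \<partial>lborel))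
      + (\<integral>\<^sup>+x. (P + P) * indicator {-m..m} x \<partial>lborel))"
    by (subst nn_integral_cmult, measurable, subst nn_integral_add, measurable, subst nn_integral_add, measurable)
  also have "\<dots> = ennreal K * ((G + G) + (P + P) * ennreal (2 * m))"
    using m by (simp add: nn_integral_cmult_indicator shift intG)
  also have "\<dots> \<le> ennreal K * (ennreal (2 + 4 * m) * (P + G))"
  proof (rule mult_left_mono)
    have "G + G = ennreal 2 * G" by (simp add: mult_2)
    also have "\<dots> \<le> ennreal (2 + 4 * m) * G" using m by (intro mult_right_mono ennreal_leI) auto
    finally have 1: "G + G \<le> ennreal (2 + 4 * m) * G" .
    have "(P + P) * ennreal (2 * m) = ennreal (4 * m) * P"
    proof -
      have "(P + P) * ennreal (2 * m) = (ennreal 2 * ennreal (2 * m)) * P" by (simp add: mult_2 distrib_left distrib_right ac_simps)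
      also have "ennreal 2 * ennreal (2 * m) = ennreal (4 * m)" using m by (simp only: ennreal_mult[symmetric]) simp
      finally show ?thesis .
    qed
    also have "\<dots> \<le> ennreal (2 + 4 * m) * P" using m by (intro mult_right_mono ennreal_leI) auto
    finally have 2: "(P + P) * ennreal (2 * m) \<le> ennreal (2 + 4 * m) * P" .
    show "(G + G) + (P + P) * ennreal (2 * m) \<le> ennreal (2 + 4 * m) * (P + G)"
      using add_mono[OF 1 2] by (simp add: distrib_left add.commute)
  qed auto
  also have "\<dots> = ennreal (holonomy_const B \<beta> t H m) * (P + G)"
    using K0 m by (simp add: Kh ennreal_mult mult.assoc)
  finally show ?thesis by (simp add: P_def G_def)
qed

text \<open>In the application \<open>T\<close> is the boundary integral with respect to arc length, which exceeds the one with respect to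
  \<open>dx\<close> by little. Integrating the completed square over all vertical lines pays for the latter, and
  the Hardy type inequality pays for the excess. No term is subtracted, so values may be infinite.\<close>

lemma robin_energy_test_function:
  fixes \<phi> :: "real \<times> real \<Rightarrow> complex" and a h :: "real \<Rightarrow> real" and B \<beta> t H m \<alpha> \<kappa> :: real and T :: ennreal
  assumes \<phi>: "\<phi> \<in> test_functions \<Omega>" and B: "B > 0" and \<beta>: "\<beta> > 0" and t: "t > 0" and m: "m \<ge> 0"
    and mt: "m + t < \<alpha>" and a[measurable]: "a \<in> borel_measurable borel"
    and ax: "\<And>x. \<bar>x\<bar> < \<alpha> \<Longrightarrow> a x = x"
    and h: "continuous_on UNIV h" and hH: "\<And>x. \<bar>h x\<bar> \<le> H"
    and \<kappa>: "\<kappa> \<ge> 0" "2 * \<beta> * \<kappa> * holonomy_const B \<beta> t H m \<le> 1"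
    and T: "T \<le> (\<integral>\<^sup>+x. ennreal ((cmod (\<phi> (x, h x)))\<^sup>2) \<partial>lborel)
      + ennreal (2 * \<kappa>) * (\<integral>\<^sup>+x. indicator {-m..m} x * ennreal ((cmod (\<phi> (x, h x)))\<^sup>2) \<partial>lborel)"
  shows "ennreal \<beta> * T \<le> (\<integral>\<^sup>+p. indicator (epigraph h) p * ennreal ((cmod (dx \<phi> p))\<^sup>2) \<partial>lborel)
    + (\<integral>\<^sup>+p. indicator (epigraph h) p * ennreal ((cmod (\<i> * dy \<phi> p + complex_of_real (B * a (fst p)) * \<phi> p))\<^sup>2
        + \<beta>\<^sup>2 * (cmod (\<phi> p))\<^sup>2) \<partial>lborel)"
proof -
  let ?E = "epigraph h"
  define g where "g p = dy \<phi> p - \<i> * complex_of_real (B * a (fst p)) * \<phi> p + \<beta> * \<phi> p" for p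
  define L where "L p = (cmod (\<i> * dy \<phi> p + complex_of_real (B * a (fst p)) * \<phi> p))\<^sup>2 + \<beta>\<^sup>2 * (cmod (\<phi> p))\<^sup>2" for p
  define X where "X = (\<integral>\<^sup>+x. ennreal ((cmod (\<phi> (x, h x)))\<^sup>2) \<partial>lborel)"
  define XI where "XI = (\<integral>\<^sup>+x. indicator {-m..m} x * ennreal ((cmod (\<phi> (x, h x)))\<^sup>2) \<partial>lborel)"
  define P where "P = (\<integral>\<^sup>+p. indicator ?E p * ennreal ((cmod (dx \<phi> p))\<^sup>2) \<partial>lborel)"
  define G where "G = (\<integral>\<^sup>+p. indicator ?E p * ennreal ((cmod (g p))\<^sup>2) \<partial>lborel)"
  define K where "K = holonomy_const B \<beta> t H m"
  have H0: "H \<ge> 0" using hH[of 0] by linarith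
  have K0: "K > 0" unfolding K_def using B t H0 m by (rule holonomy_const_pos)
  have [measurable]: "?E \<in> sets borel" using open_epigraph[OF h] by (rule borel_open)
  have [measurable]: "\<phi> \<in> borel_measurable borel" "(\<lambda>p. dx \<phi> p) \<in> borel_measurable borel"
    "(\<lambda>p. dy \<phi> p) \<in> borel_measurable borel"
    using \<phi> by (auto intro!: test_functions_borel[of _ \<Omega>] test_functions_frechet_derivative)
  have [measurable]: "(fst :: real \<times> real \<Rightarrow> real) \<in> borel_measurable borel"
    by (intro borel_measurable_continuous_onI continuous_on_fst continuous_on_id)
  have mG: "(\<lambda>p. indicator ?E p * ennreal ((cmod (g p))\<^sup>2)) \<in> borel_measurable borel"
    and mL: "(\<lambda>p. indicator ?E p * ennreal (L p)) \<in> borel_measurable borel"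
    unfolding g_def L_def by measurable
  have trace_borel[measurable]: "(\<lambda>x. \<phi> (x, h x)) \<in> borel_measurable borel"
    by (intro borel_measurable_continuous_onI continuous_on_compose2[OF test_functions_continuous[OF \<phi>, of UNIV]]
        continuous_on_Pair continuous_on_id h) auto
  obtain R where R: "\<And>p. norm p > R \<Longrightarrow> \<phi> p = 0" using test_functions_bounded_support[OF \<phi>] by blast
  obtain R' where R': "\<And>p. norm p > R' \<Longrightarrow> dy \<phi> p = 0"
    using test_functions_bounded_support[OF test_functions_frechet_derivative[OF \<phi>]] by blast
  have snd_le: "y > r \<Longrightarrow> norm (x, y) > r" for x y r :: real
    using norm_snd_le[of y x] by simp
  have line: "(\<integral>\<^sup>+y. indicator ?E (x, y) * ennreal (L (x, y)) \<partial>lborel)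
      = ennreal (\<beta> * (cmod (\<phi> (x, h x)))\<^sup>2) + (\<integral>\<^sup>+y. indicator ?E (x, y) * ennreal ((cmod (g (x, y)))\<^sup>2) \<partial>lborel)" for x
  proof -
    have ind: "indicator ?E (x, y) = indicator {h x<..} y" for y
      by (simp add: epigraph_def indicator_def)
    have z: "y > max R R' \<Longrightarrow> \<phi> (x, y) = 0" "y > max R R' \<Longrightarrow> dy \<phi> (x, y) = 0" for y
      using R[of "(x, y)"] R'[of "(x, y)"] snd_le[of _ y x] by auto
    have "continuous_on UNIV (\<lambda>y. dy \<phi> (x, y))"
      by (rule continuous_on_compose2[OF test_functions_continuous[OF test_functions_frechet_derivative[OF \<phi>], of UNIV]])
        (auto intro!: continuous_intros)
    then have "(\<integral>\<^sup>+y. indicator {h x<..} y * ennreal ((cmod (\<i> * dy \<phi> (x, y) + complex_of_real (B * a x) * \<phi> (x, y)))\<^sup>2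
          + \<beta>\<^sup>2 * (cmod (\<phi> (x, y)))\<^sup>2) \<partial>lborel)
      = ennreal (\<beta> * (cmod (\<phi> (x, h x)))\<^sup>2)
        + (\<integral>\<^sup>+y. indicator {h x<..} y * ennreal ((cmod (dy \<phi> (x, y)
            - \<i> * complex_of_real (B * a x) * \<phi> (x, y) + \<beta> * \<phi> (x, y)))\<^sup>2) \<partial>lborel)"
      by (intro robin_half_line[where R="max R R'"] partial_derivatives(2)[OF \<phi>] z \<beta>)
    then show ?thesis unfolding ind L_def g_def fst_conv .
  qed
  have "(\<integral>\<^sup>+p. indicator ?E p * ennreal (L p) \<partial>lborel)
      = (\<integral>\<^sup>+x. \<integral>\<^sup>+y. indicator ?E (x, y) * ennreal (L (x, y)) \<partial>lborel \<partial>lborel)"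
    using nn_integral_lborel_pair(1)[OF mL] by simp
  also have "\<dots> = (\<integral>\<^sup>+x. ennreal \<beta> * ennreal ((cmod (\<phi> (x, h x)))\<^sup>2)
      + (\<integral>\<^sup>+y. indicator ?E (x, y) * ennreal ((cmod (g (x, y)))\<^sup>2) \<partial>lborel) \<partial>lborel)"
    unfolding line using \<beta> by (simp add: ennreal_mult)
  also have "\<dots> = (\<integral>\<^sup>+x. ennreal \<beta> * ennreal ((cmod (\<phi> (x, h x)))\<^sup>2) \<partial>lborel)
      + (\<integral>\<^sup>+x. \<integral>\<^sup>+y. indicator ?E (x, y) * ennreal ((cmod (g (x, y)))\<^sup>2) \<partial>lborel \<partial>lborel)"
    using nn_integral_lborel_pair(3)[OF mG] by (intro nn_integral_add) auto
  also have "\<dots> = ennreal \<beta> * X + G"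
    using nn_integral_lborel_pair(1)[OF mG] by (simp add: nn_integral_cmult X_def G_def)
  finally have energy: "(\<integral>\<^sup>+p. indicator ?E p * ennreal (L p) \<partial>lborel) = ennreal \<beta> * X + G" .
  have hardy: "XI \<le> ennreal K * (P + G)"
    unfolding XI_def K_def P_def G_def g_def
    by (rule holonomy_hardy[OF \<phi> B \<beta> t m mt a ax h hH])
  have "ennreal \<beta> * T \<le> ennreal \<beta> * (X + ennreal (2 * \<kappa>) * XI)"
    using T unfolding X_def XI_def by (rule mult_left_mono) simp
  also have "\<dots> \<le> ennreal \<beta> * (X + ennreal (2 * \<kappa>) * (ennreal K * (P + G)))"
    by (intro mult_left_mono add_left_mono hardy) auto
  also have "\<dots> = ennreal \<beta> * X + ennreal (2 * \<beta> * \<kappa> * K) * (P + G)"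
  proof -
    have "ennreal (2 * \<beta> * \<kappa> * K) = ennreal \<beta> * (ennreal (2 * \<kappa>) * ennreal K)"
      using \<beta> \<kappa> K0 by (simp only: ennreal_mult[symmetric] mult_nonneg_nonneg less_imp_le zero_le_numeral)
        (simp add: mult_ac)
    then show ?thesis by (simp add: distrib_left mult.assoc)
  qed
  also have "\<dots> \<le> ennreal \<beta> * X + ennreal 1 * (P + G)"
    using \<kappa>(2) unfolding K_def[symmetric] by (intro add_left_mono mult_right_mono ennreal_leI) auto
  also have "\<dots> = P + (\<integral>\<^sup>+p. indicator ?E p * ennreal (L p) \<partial>lborel)"
    by (simp only: energy ennreal_1 mult_1_left add_ac)
  finally show ?thesis by (simp add: P_def L_def)
qed

section \<open>Curves of small curvature\<close>

lemma smooth_real_deriv: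
  fixes f :: "real \<Rightarrow> real"
  assumes "smooth f"
  shows "(f has_real_derivative deriv f x) (at x)" and "smooth (deriv f)"
proof -
  have eq: "frechet_derivative f (at x) 1 = deriv f x" for x
  proof -
    have "(f has_derivative frechet_derivative f (at x)) (at x)"
      using smooth_differentiable[OF assms] by (simp add: frechet_derivative_works)
    moreover from has_derivative_linear[OF this]
    have "frechet_derivative f (at x) v = frechet_derivative f (at x) 1 * v" for v
      using linear_scale[of "frechet_derivative f (at x)" v 1] by (simp add: mult.commute)
    then have "frechet_derivative f (at x) = (*) (frechet_derivative f (at x) 1)" by (rule ext)
    ultimately have "(f has_real_derivative frechet_derivative f (at x) 1) (at x)"
      by (simp add: has_field_derivative_def)
    then show ?thesis by (rule DERIV_imp_deriv[symmetric])
  qed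
  show "(f has_real_derivative deriv f x) (at x)"
    using smooth_differentiable[OF assms, of x]
    by (simp add: DERIV_deriv_iff_real_differentiable)
  show "smooth (deriv f)"
    using smooth_frechet_derivative[OF assms, of 1] by (simp add: eq)
qed

text \<open>The component \<open>f\<close> of a unit speed curve comes from \<open>-\<infinity>\<close> with locally constant velocity \<open>\<plusminus> 1\<close> below
  the level \<open>c\<close>. Up to the first time \<open>s1\<close> at which it reaches \<open>c\<close> the velocity is constant, and
  the value \<open>-1\<close> is incompatible with the limit at \<open>-\<infinity>\<close>.\<close>

lemma unit_speed_before_entry:
  fixes f f' :: "real \<Rightarrow> real"
  assumes deriv: "\<And>s. (f has_real_derivative f' s) (at s)" and cont: "continuous_on UNIV f'"
    and deriv2: "\<And>s. f s < c \<Longrightarrow> (f' has_real_derivative 0) (at s)"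
    and unit: "\<And>s. f s < c \<Longrightarrow> (f' s)\<^sup>2 = 1"
    and bot: "filterlim f at_bot at_bot" and reach: "f r0 \<ge> c"
  obtains s1 where "f s1 = c" "\<And>s. s < s1 \<Longrightarrow> f s < c" "\<And>s. s \<le> s1 \<Longrightarrow> f' s = 1"
proof -
  have contf: "continuous_on UNIV f"
    using deriv by (meson DERIV_isCont continuous_at_imp_continuous_on)
  define S where "S = {s. f s \<ge> c}"
  define s1 where "s1 = Inf S"
  have "closed S" unfolding S_def by (intro closed_Collect_le continuous_on_const contf)
  moreover have ne: "S \<noteq> {}" using reach by (auto simp: S_def)
  moreover have bdd: "bdd_below S"
  proof -
    have "\<forall>\<^sub>F s in at_bot. f s < c" using bot by (rule filterlim_at_bot_dense[THEN iffD1, rule_format])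
    then obtain N where "\<And>s. s \<le> N \<Longrightarrow> f s < c" by (auto simp: eventually_at_bot_linorder)
    then have "\<not> s \<le> N" if "s \<in> S" for s using that by (auto simp: S_def not_less[symmetric])
    then show ?thesis by (intro bdd_belowI[of _ N]) (simp add: less_imp_le not_le)
  qed
  ultimately have "s1 \<in> S" unfolding s1_def by (intro closed_contains_Inf)
  then have ge: "f s1 \<ge> c" by (simp add: S_def)
  have lt: "f s < c" if "s < s1" for s
    using cInf_lower[OF _ bdd, of s] that by (force simp: S_def s1_def not_le)
  have limits: "P s1" if "closed {s. P s}" "\<And>s. s < s1 \<Longrightarrow> P s" for P
  proof -
    have "closure {..<s1} \<subseteq> {s. P s}" using that by (intro closure_minimal) auto
    then show ?thesis by auto
  qed
  have "f s1 \<le> c"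
    by (rule limits[where P="\<lambda>s. f s \<le> c"]) (auto intro!: closed_Collect_le contf continuous_on_const less_imp_le lt)
  then have eq: "f s1 = c" using ge by simp
  have "\<exists>k. \<forall>s\<in>{..<s1}. f' s = k"
    by (rule has_field_derivative_zero_constant) (auto intro: has_field_derivative_at_within deriv2 lt)
  then obtain k where k: "\<And>s. s < s1 \<Longrightarrow> f' s = k" by auto
  have "k\<^sup>2 = 1" using unit[OF lt, of "s1 - 1"] k[of "s1 - 1"] by simp
  then have "k = 1 \<or> k = -1" by (simp add: power2_eq_1_iff)
  moreover have "k \<noteq> -1"
  proof
    assume "k = -1"
    have "\<forall>\<^sub>F s in at_bot. f s < f (s1 - 1) \<and> s < s1 - 1"
      by (intro eventually_conj filterlim_at_bot_dense[THEN iffD1, rule_format, OF bot] eventually_gt_at_bot)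
    then obtain s where s: "f s < f (s1 - 1)" "s < s1 - 1" using eventually_happens by fastforce
    have "f (s1 - 1) \<le> f s"
    proof (rule DERIV_nonpos_imp_nonincreasing[of s "s1 - 1"])
      fix x assume "x \<le> s1 - 1"
      then have "f' x \<le> 0" using k[of x] \<open>k = -1\<close> by simp
      then show "\<exists>y. (f has_real_derivative y) (at x) \<and> y \<le> 0" using deriv by blast
    qed (use s in simp)
    then show False using s by simp
  qed
  ultimately have k1: "f' s = 1" if "s < s1" for s using k that by auto
  have "f' s1 = 1"
    by (rule limits[where P="\<lambda>s. f' s = 1"]) (auto intro!: closed_Collect_eq cont continuous_on_const k1)
  then have "f' s = 1" if "s \<le> s1" for s using k1[of s] that by (cases "s = s1") auto
  then show ?thesis using that eq lt by blast
qed

text \<open>Since \<open>a'\<^sup>2 + b'\<^sup>2 = 1\<close>, the curvature satisfies \<open>a'' = \<gamma> b'\<close>, so \<open>a'\<close> changes at rate at most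
  \<open>\<epsilon>\<close>. The curve enters the middle strip \<open>\<bar>x\<bar> \<le> m\<close> with \<open>a' = 1\<close>; as long as \<open>a' \<ge> 2/3\<close> it crosses the strip
  within arc length \<open>3 * m\<close>, and during that time \<open>a'\<close> drops by at most \<open>\<epsilon> * (3 * m) \<le> \<kappa>\<close>. By injectivity it
  cannot come back: the part of the axis to the right of the strip is already used by the end of the curve.\<close>

lemma admissible_curve_almost_straight:
  fixes a b :: "real \<Rightarrow> real" and \<alpha> \<delta> \<epsilon> \<kappa> m :: real
  defines "m \<equiv> \<alpha> - \<delta>"
  assumes adm: "admissible_curve \<alpha> \<delta> a b" and m: "m > 0"
    and curv: "\<And>s. \<bar>signed_curvature a b s\<bar> \<le> \<epsilon>" and \<epsilon>: "\<epsilon> * (3 * m) \<le> \<kappa>" "\<kappa> \<le> 1 / 3"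
  shows "1 - \<kappa> \<le> deriv a s" and "deriv a s \<le> 1" and "\<bar>a s\<bar> > m \<Longrightarrow> deriv a s = 1"
    and "\<bar>b s\<bar> \<le> 3 * m"
proof -
  let ?A = "deriv a" and ?B = "deriv b"
  have sm: "smooth a" "smooth b" and unit: "\<And>s. (?A s)\<^sup>2 + (?B s)\<^sup>2 = 1"
    and top: "filterlim a at_top at_top" and bot: "filterlim a at_bot at_bot"
    and inj: "inj (\<lambda>s. (a s, b s))"
    and rng: "range (\<lambda>s. (a s, b s)) \<inter> ({..<-\<alpha>+\<delta>} \<union> {\<alpha>-\<delta><..}) \<times> UNIV
       = ({..<-\<alpha>+\<delta>} \<union> {\<alpha>-\<delta><..}) \<times> {0}"
    using adm by (auto simp: admissible_curve_def)
  have da: "(a has_real_derivative ?A s) (at s)" and db: "(b has_real_derivative ?B s) (at s)"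
    and dA: "(?A has_real_derivative deriv ?A s) (at s)" and dB: "(?B has_real_derivative deriv ?B s) (at s)" for s
    using sm smooth_real_deriv by blast+
  have conts: "continuous_on S a" "continuous_on S b" "continuous_on S ?A" for S
    using sm smooth_real_deriv(2)[OF sm(1)] by (auto intro: smooth_continuous_on)
  have \<epsilon>0: "\<epsilon> \<ge> 0" using curv[of 0] by linarith
  have absB: "\<bar>?B s\<bar> \<le> 1" and absA: "\<bar>?A s\<bar> \<le> 1" for s
    using unit[of s] by (auto simp: abs_square_le_1[symmetric]) (smt (verit) zero_le_power2)+
  have frenet: "deriv ?A s = signed_curvature a b s * ?B s" for s
  proof -
    have "((\<lambda>s. (?A s)\<^sup>2 + (?B s)\<^sup>2) has_real_derivative 2 * (?A s * deriv ?A s + ?B s * deriv ?B s)) (at s)"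
      by (rule derivative_eq_intros dA dB refl | simp)+
    moreover have "((\<lambda>s. (?A s)\<^sup>2 + (?B s)\<^sup>2) has_real_derivative 0) (at s)" by (simp add: unit)
    ultimately have "?A s * deriv ?A s + ?B s * deriv ?B s = 0" using DERIV_unique by fastforce
    then have "?B s * deriv ?B s = - (?A s * deriv ?A s)" by simp
    then have "signed_curvature a b s * ?B s = ((?A s)\<^sup>2 + (?B s)\<^sup>2) * deriv ?A s"
      by (simp add: signed_curvature_def power2_eq_square algebra_simps)
    then show ?thesis by (simp add: unit)
  qed
  have out0: "b s = 0" if "\<bar>a s\<bar> > m" for s
  proof -
    have "(a s, b s) \<in> ({..<-\<alpha>+\<delta>} \<union> {\<alpha>-\<delta><..}) \<times> {0}"
      unfolding rng[symmetric] using that by (auto simp: m_def abs_if split: if_splits)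
    then show ?thesis by auto
  qed
  have outB: "?B s = 0" if "\<bar>a s\<bar> > m" for s
  proof -
    have "open {s. \<bar>a s\<bar> > m}" by (intro open_Collect_less continuous_intros conts)
    then have "(b has_real_derivative 0) (at s)"
      by (rule has_field_derivative_transform_within_open[OF DERIV_const[of 0]]) (use that out0 in auto)
    then show ?thesis using DERIV_unique[OF db] by blast
  qed
  have outA: "(?A s)\<^sup>2 = 1" "(?A has_real_derivative 0) (at s)" if "\<bar>a s\<bar> > m" for s
    using unit[of s] outB[OF that] dA[of s] frenet[of s] by simp_all
  obtain r0 where r0: "a r0 > m"
    using top eventually_happens[OF filterlim_at_top_dense[THEN iffD1, rule_format, OF top, of m]] by auto
  obtain r1 where r1: "a r1 < - m"
    using eventually_happens[OF filterlim_at_bot_dense[THEN iffD1, rule_format, OF bot, of "-m"]] by auto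
  obtain s1 where s1: "a s1 = - m" "\<And>s. s < s1 \<Longrightarrow> a s < - m" "\<And>s. s \<le> s1 \<Longrightarrow> ?A s = 1"
  proof (rule unit_speed_before_entry[of a ?A "-m" r0])
    show "filterlim a at_bot at_bot" by (rule bot)
  qed (use da conts outA r0 m in auto)
  \<comment> \<open>the right end is the left end of the curve traversed backwards and reflected\<close>
  obtain s2' where s2': "- a (- s2') = - m" "\<And>s. s < s2' \<Longrightarrow> - a (- s) < - m" "\<And>s. s \<le> s2' \<Longrightarrow> ?A (- s) = 1"
  proof (rule unit_speed_before_entry[of "\<lambda>s. - a (- s)" "\<lambda>s. ?A (- s)" "-m" "- r1"])
    show "((\<lambda>s. - a (- s)) has_real_derivative ?A (- s)) (at s)" for s
      using DERIV_minus[OF DERIV_chain'[OF DERIV_minus[OF DERIV_ident] da]] by simp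
    show "continuous_on UNIV (\<lambda>s. ?A (- s))"
      by (rule continuous_on_compose2[OF conts(3)[of UNIV]]) (auto intro: continuous_intros)
    show "((\<lambda>s. ?A (- s)) has_real_derivative 0) (at s)" if "- a (- s) < - m" for s
      using DERIV_chain'[OF DERIV_minus[OF DERIV_ident] outA(2)[of "- s"]] that by simp
    show "filterlim (\<lambda>s. - a (- s)) at_bot at_bot"
      using filterlim_compose[OF filterlim_uminus_at_bot_at_top filterlim_compose[OF top filterlim_uminus_at_top_at_bot]] .
  qed (use outA r1 m in auto)
  define s2 where "s2 = - s2'"
  have s2: "a s2 = m" "\<And>s. s > s2 \<Longrightarrow> a s > m" "\<And>s. s \<ge> s2 \<Longrightarrow> ?A s = 1"
    using s2'(1) s2'(2)[of "- s" for s] s2'(3)[of "- s" for s] by (auto simp: s2_def)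
  have mid: "1 - \<kappa> \<le> ?A s" if s: "s1 \<le> s" "s \<le> s1 + 3 * m" for s
  proof -
    have "\<bar>?A s - ?A s1\<bar> \<le> \<epsilon> * \<bar>s - s1\<bar>"
    proof (rule field_differentiable_bound[of UNIV ?A "deriv ?A" \<epsilon> s s1, simplified])
      fix r
      show "(?A has_real_derivative deriv ?A r) (at r)" by (rule dA)
      show "\<bar>deriv ?A r\<bar> \<le> \<epsilon>"
        using mult_mono[OF curv[of r] absB[of r] \<epsilon>0] by (simp add: frenet abs_mult)
    qed
    also have "\<dots> \<le> \<epsilon> * (3 * m)" using s \<epsilon>0 by (intro mult_left_mono) auto
    finally show ?thesis using s1(3)[of s1] \<epsilon> by linarith
  qed
  have mono_mid: "a r \<le> a s" if "s1 \<le> r" "r \<le> s" "s \<le> s1 + 3 * m" for r s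
  proof (rule DERIV_nonneg_imp_nondecreasing[OF that(2)])
    fix x assume "r \<le> x" "x \<le> s"
    then have "?A x \<ge> 0" using mid[of x] that \<epsilon> by linarith
    then show "\<exists>y. (a has_real_derivative y) (at x) \<and> 0 \<le> y" using da by blast
  qed
  have "a (s1 + 3 * m) \<ge> m"
  proof -
    have "a s1 - (2 / 3) * s1 \<le> a (s1 + 3 * m) - (2 / 3) * (s1 + 3 * m)"
    proof (rule DERIV_nonneg_imp_nondecreasing[where f="\<lambda>s. a s - (2 / 3) * s"])
      fix s assume s: "s1 \<le> s" "s \<le> s1 + 3 * m"
      have "((\<lambda>s. a s - (2 / 3) * s) has_real_derivative ?A s - 2 / 3) (at s)"
        by (auto intro!: derivative_eq_intros da)
      moreover have "?A s - 2 / 3 \<ge> 0" using mid[OF s] \<epsilon> by linarith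
      ultimately show "\<exists>y. ((\<lambda>s. a s - (2 / 3) * s) has_real_derivative y) (at s) \<and> 0 \<le> y" by blast
    qed (use m in auto)
    moreover have "(2 / 3) * (s1 + 3 * m) = (2 / 3) * s1 + 2 * m" by (simp add: algebra_simps)
    ultimately show ?thesis using s1(1) by linarith
  qed
  then obtain s3 where s3: "s1 \<le> s3" "s3 \<le> s1 + 3 * m" "a s3 = m"
    using IVT'[of a s1 m "s1 + 3 * m"] conts m s1(1) by auto
  have "s3 \<le> s2" using s2(2)[of s3] s3(3) by force
  have s32: "s3 = s2"
  proof (rule ccontr)
    assume "s3 \<noteq> s2"
    then have lt: "s3 < s2" using \<open>s3 \<le> s2\<close> by simp
    have "?A s3 > 0" using mid[OF s3(1,2)] \<epsilon> by linarith
    from DERIV_pos_inc_right[OF da this] obtain d where d: "d > 0" "\<And>h. 0 < h \<Longrightarrow> h < d \<Longrightarrow> a s3 < a (s3 + h)" by blast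
    \<comment> \<open>a point just after leaving the strip, which the final part of the curve visits again\<close>
    define s where "s = s3 + min d (s2 - s3) / 2"
    have s: "a s > m" "s < s2"
      using d(2)[of "min d (s2 - s3) / 2"] d(1) lt s3(3) by (auto simp: s_def min_def field_simps)
    obtain N where N: "N \<ge> s2" "a N \<ge> a s"
    proof -
      have "\<forall>\<^sub>F r in at_top. a s \<le> a r \<and> s2 \<le> r"
        using top by (intro eventually_conj eventually_ge_at_top) (simp add: filterlim_at_top)
      then show ?thesis using that eventually_happens by fastforce
    qed
    obtain s' where s': "s2 \<le> s'" "a s' = a s"
      using IVT'[of a s2 "a s" N] conts N s s2(1) by auto
    have "b s' = b s" using out0[of s] out0[of s'] s s' m by simp
    then have "s' = s" using inj s' by (auto dest: injD)
    then show False using s s' by simp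
  qed
  have cases: "s \<le> s1 \<or> (s1 \<le> s \<and> s \<le> s3) \<or> s \<ge> s2" using s32 by linarith
  show "1 - \<kappa> \<le> ?A s"
  proof -
    have "\<kappa> \<ge> 0" using \<epsilon>(1) \<epsilon>0 m by (smt (verit) mult_nonneg_nonneg)
    then show ?thesis using cases s1(3)[of s] s2(3)[of s] mid[of s] s3 by fastforce
  qed
  show "?A s \<le> 1" using absA[of s] by linarith
  show "?A s = 1" if "\<bar>a s\<bar> > m"
  proof -
    have "\<not> (s1 \<le> s \<and> s \<le> s3)"
      using mono_mid[of s1 s] mono_mid[of s s3] s1(1) s3 that by (auto simp: abs_if split: if_splits)
    then show ?thesis using cases s1(3)[of s] s2(3)[of s] by auto
  qed
  have bs1: "b s1 = 0"
  proof -
    have "closure {..<s1} \<subseteq> {s. b s = 0}"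
      using out0 s1(2) m by (intro closure_minimal closed_Collect_eq conts continuous_on_const) force+
    then show ?thesis by auto
  qed
  show "\<bar>b s\<bar> \<le> 3 * m"
  proof (cases "s1 \<le> s \<and> s \<le> s3")
    case True
    have "\<bar>b s - b s1\<bar> \<le> \<bar>s - s1\<bar>"
      by (rule field_differentiable_bound[of UNIV b ?B 1 s s1, simplified]) (use db absB in auto)
    then show ?thesis using bs1 True s3 by simp
  next
    case False
    then have "s < s1 \<or> s > s2" using s32 by auto
    then have "\<bar>a s\<bar> > m" using s1(2)[of s] s2(2)[of s] m by auto
    then show ?thesis using out0 m by simp
  qed
qed

text \<open>For a continuous function an almost everywhere bound holds everywhere, because nonempty open
  sets have positive measure.\<close>

lemma Linf_norm_bound:
  assumes "continuous_on UNIV f" "Linf_norm f < ereal \<epsilon>"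
  shows "\<bar>f s\<bar> \<le> \<epsilon>"
proof -
  have "AE s in lborel. ereal \<bar>f s\<bar> \<le> Linf_norm f"
    unfolding Linf_norm_def by (rule esssup_AE)
  then have "AE s in lborel. s \<in> {s. \<bar>f s\<bar> \<le> \<epsilon>}"
    by eventually_elim (use assms(2) in \<open>metis ereal_less_eq(3) less_imp_le mem_Collect_eq order_trans\<close>)
  then have "AE s in lebesgue. s \<in> {s. \<bar>f s\<bar> \<le> \<epsilon>}" by (rule AE_completion)
  moreover have "closed {s. \<bar>f s\<bar> \<le> \<epsilon>}"
    by (intro closed_Collect_le continuous_intros assms(1))
  ultimately show ?thesis using mem_closed_if_AE_lebesgue by blast
qed

lemma continuous_signed_curvature:
  assumes "smooth a" "smooth b"
  shows "continuous_on UNIV (signed_curvature a b)"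
proof -
  note sm = assms[THEN smooth_real_deriv(2)] assms[THEN smooth_real_deriv(2), THEN smooth_real_deriv(2)]
  show ?thesis
    unfolding signed_curvature_def[abs_def]
    by (intro continuous_intros smooth_continuous_on sm)
qed

lemma graph_parametrization:
  fixes a b :: "real \<Rightarrow> real"
  assumes da: "\<And>s. (a has_real_derivative a' s) (at s)" and pos: "\<And>s. a' s > 0"
    and top: "filterlim a at_top at_top" and bot: "filterlim a at_bot at_bot"
    and b: "continuous_on UNIV b"
  obtains h where "continuous_on UNIV h" "\<And>s. b s = h (a s)" "strict_mono a" "surj a"
proof -
  have conta: "continuous_on S a" for S using da by (meson DERIV_isCont continuous_at_imp_continuous_on)
  have mono: "strict_mono a"
    by (rule strict_monoI) (metis DERIV_pos_imp_increasing da pos)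
  have surj: "surj a"
  proof -
    have "\<exists>s. a s = x" for x
    proof -
      have "\<forall>\<^sub>F r in at_top. x \<le> a r \<and> 0 \<le> r"
        using top by (intro eventually_conj eventually_ge_at_top) (simp add: filterlim_at_top)
      then obtain r where r: "x \<le> a r" "0 \<le> r" using eventually_happens by fastforce
      have "\<forall>\<^sub>F l in at_bot. a l \<le> x \<and> l \<le> 0"
        using bot by (intro eventually_conj eventually_le_at_bot) (simp add: filterlim_at_bot)
      then obtain l where l: "a l \<le> x" "l \<le> 0" using eventually_happens by fastforce
      show ?thesis using IVT'[of a l x r] l r conta by auto
    qed
    then show ?thesis by (metis surjI)
  qed
  have inj: "inj a" using mono by (rule strict_mono_imp_inj_on)
  have inv: "inv a (a s) = s" for s using inj by simp
  have "isCont (inv a) x" for x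
  proof -
    obtain s where s: "x = a s" using surj by (metis surjD)
    show ?thesis unfolding s
      by (rule isCont_inverse_function[of 1 s "inv a" a]) (use inv conta[of UNIV] in \<open>auto simp: continuous_on_eq_continuous_at\<close>)
  qed
  then have "continuous_on UNIV (inv a)" by (simp add: continuous_at_imp_continuous_on)
  then have "continuous_on UNIV (\<lambda>x. b (inv a x))"
    by (rule continuous_on_compose2[OF b]) auto
  then show ?thesis using that[of "\<lambda>x. b (inv a x)"] mono surj inv by simp
qed

lemma connected_epigraph:
  assumes "continuous_on UNIV h"
  shows "connected (epigraph h)"
proof -
  have eq: "epigraph h = (\<lambda>(x, y). (x, y + h x)) ` (UNIV \<times> {0<..})"
  proof (rule set_eqI)
    fix p
    have "p = (\<lambda>(x, y). (x, y + h x)) (fst p, snd p - h (fst p))" by simp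
    then have "p \<in> epigraph h \<Longrightarrow> p \<in> (\<lambda>(x, y). (x, y + h x)) ` (UNIV \<times> {0<..})"
      by (rule image_eqI) (simp add: epigraph_def)
    then show "p \<in> epigraph h \<longleftrightarrow> p \<in> (\<lambda>(x, y). (x, y + h x)) ` (UNIV \<times> {0<..})"
      by (auto simp: epigraph_def)
  qed
  have "connected ((UNIV :: real set) \<times> {0::real<..})"
    by (intro connected_Times connected_UNIV) simp
  moreover have "continuous_on (UNIV \<times> {0<..}) (\<lambda>(x, y). (x, y + h x))"
    unfolding case_prod_unfold
    by (intro continuous_on_Pair continuous_on_add continuous_on_fst continuous_on_snd continuous_on_id
        continuous_on_compose2[OF assms]) auto
  ultimately show ?thesis unfolding eq by (intro connected_continuous_image)
qed

text \<open>The region above the graph is connected and meets \<open>\<Omega>\<close>, so it lies in the component \<open>\<Omega>\<close>;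
  conversely a connected set avoiding the graph cannot meet both sides of it.\<close>

lemma curvilinear_upper_half_plane_graph:
  assumes h: "continuous_on UNIV h" and bh: "\<And>s. b s = h (a s)" and surj: "surj a"
    and \<Omega>: "curvilinear_upper_half_plane a b \<Omega>"
  shows "\<Omega> = epigraph h"
proof -
  let ?\<Gamma> = "range (\<lambda>s. (a s, b s))"
  have \<Gamma>: "p \<in> ?\<Gamma> \<longleftrightarrow> snd p = h (fst p)" for p
  proof
    assume "snd p = h (fst p)"
    moreover obtain s where "fst p = a s" using surj by (metis surjD)
    ultimately have "p = (a s, b s)" by (simp add: bh prod_eq_iff)
    then show "p \<in> ?\<Gamma>" by blast
  qed (auto simp: bh)
  have comp: "\<Omega> \<in> components (- ?\<Gamma>)" using \<Omega> by (simp add: curvilinear_upper_half_plane_def)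
  have "\<forall>\<^sub>F y in at_top. (0, y) \<in> \<Omega> \<and> h 0 < y"
    using \<Omega> by (intro eventually_conj eventually_gt_at_top) (simp add: curvilinear_upper_half_plane_def)
  then obtain y where y: "(0, y) \<in> \<Omega>" "h 0 < y" using eventually_happens by fastforce
  then have meet: "(0, y) \<in> epigraph h" by (simp add: epigraph_def)
  have "epigraph h \<subseteq> \<Omega>"
  proof (rule components_maximal[OF comp connected_epigraph[OF h]])
    show "epigraph h \<subseteq> - ?\<Gamma>"
    proof
      fix p assume "p \<in> epigraph h"
      then show "p \<in> - ?\<Gamma>" unfolding Compl_iff \<Gamma> by (simp add: epigraph_def)
    qed
    show "\<Omega> \<inter> epigraph h \<noteq> {}" using y meet by blast
  qed
  moreover have "\<Omega> \<subseteq> epigraph h"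
  proof (rule ccontr)
    assume not: "\<not> \<Omega> \<subseteq> epigraph h"
    let ?V = "{p. snd p < h (fst p)}"
    have "open ?V"
      by (intro open_Collect_less continuous_on_compose2[of UNIV h UNIV fst] continuous_on_fst
          continuous_on_snd continuous_on_id h) auto
    moreover have "\<Omega> \<subseteq> epigraph h \<union> ?V"
    proof
      fix p assume "p \<in> \<Omega>"
      then have "p \<notin> ?\<Gamma>" using in_components_subset[OF comp] by blast
      then show "p \<in> epigraph h \<union> ?V" unfolding \<Gamma> by (auto simp: epigraph_def)
    qed
    moreover have "epigraph h \<inter> ?V \<inter> \<Omega> = {}" by (auto simp: epigraph_def)
    moreover have "epigraph h \<inter> \<Omega> \<noteq> {}" using y meet by blast
    moreover have "?V \<inter> \<Omega> \<noteq> {}" using not \<open>\<Omega> \<subseteq> epigraph h \<union> ?V\<close> by blast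
    ultimately show False
      using connectedD[OF in_components_connected[OF comp] open_epigraph[OF h], of ?V] by blast
  qed
  ultimately show ?thesis by blast
qed

text \<open>Where \<open>\<bar>a s\<bar> \<le> m\<close> one has \<open>1 \<le> (1 + 2 * \<kappa>) * a' s\<close>, elsewhere \<open>a' s = 1\<close>; then \<open>x = a s\<close> is substituted.\<close>

lemma arc_length_integral_le:
  fixes \<psi> a :: "real \<Rightarrow> real" and \<kappa> m R :: real
  assumes da: "\<And>s. (a has_real_derivative a' s) (at s)" and cont: "continuous_on UNIV a'"
    and mono: "strict_mono a" and surj: "surj a"
    and \<kappa>: "\<kappa> \<le> 1 / 2" and lower: "\<And>s. 1 - \<kappa> \<le> a' s" and out: "\<And>s. \<bar>a s\<bar> > m \<Longrightarrow> a' s = 1"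
    and \<psi>[measurable]: "\<psi> \<in> borel_measurable borel" and nonneg: "\<And>x. \<psi> x \<ge> 0"
    and supp: "\<And>x. \<bar>x\<bar> > R \<Longrightarrow> \<psi> x = 0" and \<kappa>0: "\<kappa> \<ge> 0"
  shows "(\<integral>\<^sup>+s. ennreal (\<psi> (a s)) \<partial>lborel)
    \<le> (\<integral>\<^sup>+x. ennreal (\<psi> x) \<partial>lborel) + ennreal (2 * \<kappa>) * (\<integral>\<^sup>+x. indicator {-m..m} x * ennreal (\<psi> x) \<partial>lborel)"
proof -
  let ?w = "\<lambda>x. 1 + 2 * \<kappa> * indicator {-m..m} x"
  define r where "r = max R 0 + 1"
  have r: "r > 0" "r > R" by (auto simp: r_def)
  \<comment> \<open>a compact parameter interval outside of which the integrand vanishes\<close>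
  obtain u v where uv: "a u = - r" "a v = r" using surj by (metis surjD)
  have "u < v" using strict_mono_less[OF mono, of u v] uv r by simp
  have [measurable]: "a \<in> borel_measurable borel"
    using da by (meson DERIV_isCont continuous_at_imp_continuous_on borel_measurable_continuous_onI)
  have [measurable]: "a' \<in> borel_measurable borel" using cont by (rule borel_measurable_continuous_onI)
  have "(\<integral>\<^sup>+s. ennreal (\<psi> (a s)) \<partial>lborel)
      \<le> (\<integral>\<^sup>+s. ennreal (\<psi> (a s) * ?w (a s)) * ennreal (a' s) * indicator {u..v} s \<partial>lborel)"
  proof (rule nn_integral_mono)
    fix s
    show "ennreal (\<psi> (a s)) \<le> ennreal (\<psi> (a s) * ?w (a s)) * ennreal (a' s) * indicator {u..v} s"
    proof (cases "s \<in> {u..v}")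
      case True
      have "1 \<le> ?w (a s) * a' s"
      proof (cases "\<bar>a s\<bar> > m")
        case False
        then have w: "?w (a s) = 1 + 2 * \<kappa>" by (auto simp: indicator_def abs_le_iff)
        have "1 * 1 \<le> (1 + 2 * \<kappa>) * (1 - \<kappa>)"
        proof -
          have "\<kappa> * (2 * \<kappa>) \<le> \<kappa> * 1" using \<kappa> \<kappa>0 by (intro mult_left_mono) auto
          then show ?thesis by (simp add: algebra_simps)
        qed
        moreover have "(1 + 2 * \<kappa>) * (1 - \<kappa>) \<le> (1 + 2 * \<kappa>) * a' s"
          using lower[of s] \<kappa>0 by (intro mult_left_mono) auto
        ultimately show ?thesis unfolding w by linarith
      qed (auto simp: out indicator_def)
      then have "\<psi> (a s) * 1 \<le> \<psi> (a s) * (?w (a s) * a' s)" by (intro mult_left_mono nonneg)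
      then have "ennreal (\<psi> (a s)) \<le> ennreal (\<psi> (a s) * ?w (a s) * a' s)" by (intro ennreal_leI) (simp add: mult.assoc)
      also have "\<dots> = ennreal (\<psi> (a s) * ?w (a s)) * ennreal (a' s)"
        using nonneg[of "a s"] \<kappa>0 lower[of s] \<kappa> by (intro ennreal_mult mult_nonneg_nonneg) (auto simp: indicator_def)
      finally show ?thesis using True by simp
    next
      case False
      then have "s < u \<or> v < s" by auto
      then have "a s < - r \<or> r < a s" using strict_monoD[OF mono] uv by metis
      then have "\<psi> (a s) = 0" using r by (intro supp) auto
      then show ?thesis by simp
    qed
  qed
  also have "\<dots> = (\<integral>\<^sup>+x. ennreal (\<psi> x * ?w x) * indicator {a u..a v} x \<partial>lborel)"
  proof (rule nn_integral_substitution_aux[symmetric])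
    show "a' s \<ge> 0" for s using lower[of s] \<kappa> by linarith
    show "(\<lambda>x. ennreal (\<psi> x * ?w x)) \<in> borel_measurable borel" by measurable
  qed (use da cont \<open>u < v\<close> in \<open>auto intro: continuous_on_subset\<close>)
  also have "\<dots> \<le> (\<integral>\<^sup>+x. ennreal (\<psi> x) + ennreal (2 * \<kappa>) * (indicator {-m..m} x * ennreal (\<psi> x)) \<partial>lborel)"
  proof (rule nn_integral_mono)
    fix x
    have "ennreal (\<psi> x * ?w x) = ennreal (\<psi> x) + ennreal (2 * \<kappa>) * (indicator {-m..m} x * ennreal (\<psi> x))"
      using nonneg[of x] \<kappa>0
      by (cases "x \<in> {-m..m}") (simp_all add: distrib_left mult_ac flip: ennreal_plus ennreal_mult)
    then show "ennreal (\<psi> x * ?w x) * indicator {a u..a v} x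
        \<le> ennreal (\<psi> x) + ennreal (2 * \<kappa>) * (indicator {-m..m} x * ennreal (\<psi> x))"
      by (simp add: indicator_def)
  qed
  also have "\<dots> = (\<integral>\<^sup>+x. ennreal (\<psi> x) \<partial>lborel)
      + ennreal (2 * \<kappa>) * (\<integral>\<^sup>+x. indicator {-m..m} x * ennreal (\<psi> x) \<partial>lborel)"
    by (subst nn_integral_add) (auto simp: nn_integral_cmult)
  finally show ?thesis .
qed

section \<open>From test functions to eigenfunctions\<close>

definition magnetic_energy ::
    "('a::euclidean_space \<Rightarrow> 'a) \<Rightarrow> 'a set \<Rightarrow> ('a \<Rightarrow> complex) \<Rightarrow> real" where
  "magnetic_energy A \<Omega> u = (\<Sum>e\<in>Basis. (L2_norm (lebesgue_on \<Omega>)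
     (\<lambda>x. \<i> * weak_derivative \<Omega> e u x + complex_of_real (A x \<bullet> e) * u x))\<^sup>2)"

lemma magnetic_robin_form_eq:
  "magnetic_robin_form A \<beta> \<Omega> c u
    = magnetic_energy A \<Omega> u - \<beta> * (\<integral>s. (cmod (boundary_trace \<Omega> c u s))\<^sup>2 \<partial>lebesgue)"
  by (simp add: magnetic_robin_form_def magnetic_energy_def)

lemma sobolev_H1_cmult: "open \<Omega> \<Longrightarrow> u \<in> sobolev_H1 \<Omega> \<Longrightarrow> (\<lambda>x. k * u x) \<in> sobolev_H1 \<Omega>"
  using sobolev_H1_lincomb[of \<Omega> u u k 0] by simp

lemma weak_derivative_cmult:
  "open \<Omega> \<Longrightarrow> u \<in> sobolev_H1 \<Omega> \<Longrightarrow> e \<in> Basis \<Longrightarrow>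
    AE x in lebesgue_on \<Omega>. weak_derivative \<Omega> e (\<lambda>x. k * u x) x = k * weak_derivative \<Omega> e u x"
  using weak_derivative_lincomb[of \<Omega> u u e k 0] by simp

lemma H1_norm_cmult:
  assumes \<Omega>: "open \<Omega>" and u: "u \<in> sobolev_H1 \<Omega>"
  shows "H1_norm \<Omega> (\<lambda>x. k * u x) = cmod k * H1_norm \<Omega> u"
proof -
  let ?M = "lebesgue_on \<Omega>"
  have "L2_norm ?M (weak_derivative \<Omega> e (\<lambda>x. k * u x))
      = cmod k * L2_norm ?M (weak_derivative \<Omega> e u)" if e: "e \<in> Basis" for e
  proof -
    have "L2_norm ?M (weak_derivative \<Omega> e (\<lambda>x. k * u x))
        = L2_norm ?M (\<lambda>x. k * weak_derivative \<Omega> e u x)"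
      by (intro L2_norm_cong_AE weak_derivative_works(1)[OF sobolev_H1_cmult[OF \<Omega> u] e]
          L2_space_cmult weak_derivative_works(1)[OF u e] weak_derivative_cmult[OF \<Omega> u e])
    then show ?thesis by (simp add: L2_norm_cmult)
  qed
  then have "(L2_norm ?M (\<lambda>x. k * u x))\<^sup>2 + (\<Sum>e\<in>Basis. (L2_norm ?M (weak_derivative \<Omega> e (\<lambda>x. k * u x)))\<^sup>2)
      = (cmod k)\<^sup>2 * ((L2_norm ?M u)\<^sup>2 + (\<Sum>e\<in>Basis. (L2_norm ?M (weak_derivative \<Omega> e u))\<^sup>2))"
    by (simp add: L2_norm_cmult power_mult_distrib distrib_left sum_distrib_left)
  then show ?thesis unfolding H1_norm_def by (simp add: real_sqrt_mult)
qed

lemma has_trace_cmult: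
  assumes \<Omega>: "open \<Omega>" and u: "u \<in> sobolev_H1 \<Omega>" and tr: "has_trace \<Omega> c u g"
  shows "has_trace \<Omega> c (\<lambda>x. k * u x) (\<lambda>s. k * g s)"
proof -
  obtain \<phi> where g: "g \<in> L2_space lebesgue"
    and \<phi>: "\<And>n. \<phi> n \<in> test_functions UNIV" "\<And>n. \<phi> n \<circ> c \<in> L2_space lebesgue"
    and lim: "(\<lambda>n. H1_norm \<Omega> (\<lambda>x. \<phi> n x - u x)) \<longlonglongrightarrow> 0"
      "(\<lambda>n. L2_norm lebesgue (\<lambda>s. \<phi> n (c s) - g s)) \<longlonglongrightarrow> 0"
    using tr unfolding has_trace_def by blast
  have mem: "(\<lambda>x. \<phi> n x - u x) \<in> sobolev_H1 \<Omega>" for n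
    using sobolev_H1_lincomb[OF \<Omega> test_function_sobolev_H1[OF \<Omega> \<phi>(1)] u, of 1 n "-1"] by simp
  have "(\<lambda>n. cmod k * H1_norm \<Omega> (\<lambda>x. \<phi> n x - u x)) \<longlonglongrightarrow> cmod k * 0"
    "(\<lambda>n. cmod k * L2_norm lebesgue (\<lambda>s. \<phi> n (c s) - g s)) \<longlonglongrightarrow> cmod k * 0"
    by (intro tendsto_mult tendsto_const lim)+
  then have "(\<lambda>n. H1_norm \<Omega> (\<lambda>x. k * \<phi> n x - k * u x)) \<longlonglongrightarrow> 0"
    "(\<lambda>n. L2_norm lebesgue (\<lambda>s. k * \<phi> n (c s) - k * g s)) \<longlonglongrightarrow> 0"
    by (simp_all add: H1_norm_cmult[OF \<Omega> mem, symmetric] L2_norm_cmult[symmetric] right_diff_distrib)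
  moreover have "(\<lambda>x. k * \<phi> n x) \<in> test_functions UNIV" "(\<lambda>x. k * \<phi> n x) \<circ> c \<in> L2_space lebesgue" for n
    using test_functions_cmult[OF \<phi>(1)] L2_space_cmult[OF \<phi>(2)] by (auto simp: o_def)
  ultimately show ?thesis
    unfolding has_trace_def using L2_space_cmult[OF g]
    by (intro conjI exI[of _ "\<lambda>n x. k * \<phi> n x"]) auto
qed

lemma magnetic_gradient_L2:
  assumes v: "v \<in> L2_space (lebesgue_on \<Omega>)" "w \<in> L2_space (lebesgue_on \<Omega>)"
    and A: "(\<lambda>x. A x \<bullet> e) \<in> borel_measurable (lebesgue_on \<Omega>)" "\<And>x. \<bar>A x \<bullet> e\<bar> \<le> C"
  shows "(\<lambda>x. \<i> * w x + complex_of_real (A x \<bullet> e) * v x) \<in> L2_space (lebesgue_on \<Omega>)"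
  using A by (intro L2_space_add L2_space_cmult v L2_space_bounded_mult[where C=C]) auto

lemma magnetic_energy_cmult:
  assumes \<Omega>: "open \<Omega>" and u: "u \<in> sobolev_H1 \<Omega>"
    and A: "\<And>e. e \<in> Basis \<Longrightarrow> (\<lambda>x. A x \<bullet> e) \<in> borel_measurable (lebesgue_on \<Omega>)" "\<And>x e. e \<in> Basis \<Longrightarrow> \<bar>A x \<bullet> e\<bar> \<le> C"
  shows "magnetic_energy A \<Omega> (\<lambda>x. k * u x) = (cmod k)\<^sup>2 * magnetic_energy A \<Omega> u"
proof -
  let ?M = "lebesgue_on \<Omega>"
  have "L2_norm ?M (\<lambda>x. \<i> * weak_derivative \<Omega> e (\<lambda>x. k * u x) x + complex_of_real (A x \<bullet> e) * (k * u x))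
      = cmod k * L2_norm ?M (\<lambda>x. \<i> * weak_derivative \<Omega> e u x + complex_of_real (A x \<bullet> e) * u x)"
    if e: "e \<in> Basis" for e
  proof -
    note ku = sobolev_H1_cmult[OF \<Omega> u, of k]
    have "L2_norm ?M (\<lambda>x. \<i> * weak_derivative \<Omega> e (\<lambda>x. k * u x) x + complex_of_real (A x \<bullet> e) * (k * u x))
      = L2_norm ?M (\<lambda>x. k * (\<i> * weak_derivative \<Omega> e u x + complex_of_real (A x \<bullet> e) * u x))"
    proof (rule L2_norm_cong_AE)
      show "AE x in ?M. \<i> * weak_derivative \<Omega> e (\<lambda>x. k * u x) x + complex_of_real (A x \<bullet> e) * (k * u x)
        = k * (\<i> * weak_derivative \<Omega> e u x + complex_of_real (A x \<bullet> e) * u x)"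
        using weak_derivative_cmult[OF \<Omega> u e, of k] by eventually_elim (simp add: algebra_simps)
    qed (intro L2_space_cmult magnetic_gradient_L2[OF _ _ A(1)[OF e] A(2)[OF e]] sobolev_H1_L2 ku u
          weak_derivative_works(1)[OF ku e] weak_derivative_works(1)[OF u e])+
    then show ?thesis by (simp only: L2_norm_cmult)
  qed
  then show ?thesis
    by (simp add: magnetic_energy_def power_mult_distrib sum_distrib_left)
qed

lemma L2_norm_power2_bounded_mult_le:
  assumes f: "f \<in> L2_space M" and w: "w \<in> borel_measurable M" "\<And>x. cmod (w x) \<le> C"
  shows "(L2_norm M (\<lambda>x. w x * f x))\<^sup>2 \<le> C\<^sup>2 * (L2_norm M f)\<^sup>2"
proof -
  have "(\<integral>x. (cmod (w x * f x))\<^sup>2 \<partial>M) \<le> (\<integral>x. C\<^sup>2 * (cmod (f x))\<^sup>2 \<partial>M)"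
  proof (rule integral_mono)
    show "integrable M (\<lambda>x. (cmod (w x * f x))\<^sup>2)"
      using L2_space_bounded_mult[OF f w] by (simp add: L2_space_def)
    show "(cmod (w x * f x))\<^sup>2 \<le> C\<^sup>2 * (cmod (f x))\<^sup>2" for x
      using w(2)[of x] by (auto simp: norm_mult power_mult_distrib intro!: mult_right_mono power_mono)
  qed (use f in \<open>simp add: L2_space_def\<close>)
  then show ?thesis by (simp add: L2_norm_power2)
qed

text \<open>By definition of the trace there are test functions converging to \<open>u\<close> in \<open>H\<^sup>1\<close> whose boundary
  values converge to \<open>g\<close>. Since the potential is bounded, each term of the inequality converges.\<close>

lemma magnetic_robin_inequality_closure:
  fixes A :: "'a::euclidean_space \<Rightarrow> 'a"
  assumes \<Omega>: "open \<Omega>"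
    and A: "\<And>e. e \<in> Basis \<Longrightarrow> (\<lambda>x. A x \<bullet> e) \<in> borel_measurable (lebesgue_on \<Omega>)" "\<And>x e. e \<in> Basis \<Longrightarrow> \<bar>A x \<bullet> e\<bar> \<le> C"
    and test: "\<And>\<phi>. \<phi> \<in> test_functions UNIV \<Longrightarrow> \<phi> \<circ> c \<in> L2_space lebesgue \<Longrightarrow>
      \<beta> * (L2_norm lebesgue (\<phi> \<circ> c))\<^sup>2 \<le>
        (\<Sum>e\<in>Basis. (L2_norm (lebesgue_on \<Omega>) (\<lambda>x. \<i> * frechet_derivative \<phi> (at x) e + complex_of_real (A x \<bullet> e) * \<phi> x))\<^sup>2)
        + \<mu> * (L2_norm (lebesgue_on \<Omega>) \<phi>)\<^sup>2"
    and u: "u \<in> sobolev_H1 \<Omega>" and tr: "has_trace \<Omega> c u g"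
  shows "\<beta> * (L2_norm lebesgue g)\<^sup>2 \<le> magnetic_energy A \<Omega> u + \<mu> * (L2_norm (lebesgue_on \<Omega>) u)\<^sup>2"
proof -
  let ?M = "lebesgue_on \<Omega>"
  obtain \<phi> where g: "g \<in> L2_space lebesgue"
    and \<phi>: "\<And>n. \<phi> n \<in> test_functions UNIV" "\<And>n. \<phi> n \<circ> c \<in> L2_space lebesgue"
    and lim: "(\<lambda>n. H1_norm \<Omega> (\<lambda>x. \<phi> n x - u x)) \<longlonglongrightarrow> 0"
      "(\<lambda>n. L2_norm lebesgue (\<lambda>s. \<phi> n (c s) - g s)) \<longlonglongrightarrow> 0"
    using tr unfolding has_trace_def by blast
  have d: "(\<lambda>x. \<phi> n x - u x) \<in> sobolev_H1 \<Omega>" for n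
    using sobolev_H1_lincomb[OF \<Omega> test_function_sobolev_H1[OF \<Omega> \<phi>(1)] u, of 1 n "-1"] by simp
  have sq: "(\<lambda>n. (H1_norm \<Omega> (\<lambda>x. \<phi> n x - u x))\<^sup>2) \<longlonglongrightarrow> 0"
    using tendsto_power[OF lim(1), of 2] by simp
  have H1: "(H1_norm \<Omega> v)\<^sup>2 = (L2_norm ?M v)\<^sup>2 + (\<Sum>e\<in>Basis. (L2_norm ?M (weak_derivative \<Omega> e v))\<^sup>2)" for v
    unfolding H1_norm_def by (simp add: sum_nonneg)
  have le0: "(L2_norm ?M v)\<^sup>2 \<le> (H1_norm \<Omega> v)\<^sup>2" for v
    unfolding H1 by (simp add: sum_nonneg)
  have le1: "(L2_norm ?M (weak_derivative \<Omega> e v))\<^sup>2 \<le> (H1_norm \<Omega> v)\<^sup>2" if "e \<in> Basis" for e v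
    unfolding H1 using member_le_sum[OF that, of "\<lambda>e. (L2_norm ?M (weak_derivative \<Omega> e v))\<^sup>2"]
    by (simp add: add_increasing)
  have conv0: "(\<lambda>n. L2_norm ?M (\<lambda>x. \<phi> n x - u x)) \<longlonglongrightarrow> 0"
  proof -
    have "(\<lambda>n. (L2_norm ?M (\<lambda>x. \<phi> n x - u x))\<^sup>2) \<longlonglongrightarrow> 0"
      by (rule tendsto_sandwich[OF _ _ tendsto_const sq]) (auto intro!: always_eventually le0)
    from tendsto_real_sqrt[OF this] show ?thesis by (simp add: L2_norm_nonneg)
  qed
  have lim0: "(\<lambda>n. (L2_norm ?M (\<phi> n))\<^sup>2) \<longlonglongrightarrow> (L2_norm ?M u)\<^sup>2"
    by (rule L2_norm_power2_tendsto[OF test_functions_L2[OF \<phi>(1) \<Omega>] sobolev_H1_L2[OF u] conv0])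
  have limb: "(\<lambda>n. (L2_norm lebesgue (\<phi> n \<circ> c))\<^sup>2) \<longlonglongrightarrow> (L2_norm lebesgue g)\<^sup>2"
    by (rule L2_norm_power2_tendsto[OF \<phi>(2) g]) (use lim(2) in \<open>simp add: o_def\<close>)
  have limD: "(\<lambda>n. (L2_norm ?M (\<lambda>x. \<i> * frechet_derivative (\<phi> n) (at x) e + complex_of_real (A x \<bullet> e) * \<phi> n x))\<^sup>2)
      \<longlonglongrightarrow> (L2_norm ?M (\<lambda>x. \<i> * weak_derivative \<Omega> e u x + complex_of_real (A x \<bullet> e) * u x))\<^sup>2"
    if e: "e \<in> Basis" for e
  proof (rule L2_norm_power2_tendsto)
    let ?D = "\<lambda>n x. \<i> * frechet_derivative (\<phi> n) (at x) e + complex_of_real (A x \<bullet> e) * \<phi> n x"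
    let ?Du = "\<lambda>x. \<i> * weak_derivative \<Omega> e u x + complex_of_real (A x \<bullet> e) * u x"
    let ?dw = "\<lambda>n. weak_derivative \<Omega> e (\<lambda>x. \<phi> n x - u x)"
    show D: "?D n \<in> L2_space ?M" for n
      by (intro magnetic_gradient_L2[OF _ _ A(1)[OF e] A(2)[OF e]]
          test_functions_L2[OF \<phi>(1) \<Omega>] test_functions_L2[OF test_functions_frechet_derivative[OF \<phi>(1)] \<Omega>])
    show Du: "?Du \<in> L2_space ?M"
      by (intro magnetic_gradient_L2[OF _ _ A(1)[OF e] A(2)[OF e]] sobolev_H1_L2 u weak_derivative_works(1)[OF u e])
    have bd: "(L2_norm ?M (\<lambda>x. ?D n x - ?Du x))\<^sup>2 \<le> (2 + 2 * C\<^sup>2) * (H1_norm \<Omega> (\<lambda>x. \<phi> n x - u x))\<^sup>2" for n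
    proof -
      note dn = sobolev_H1_L2[OF d[of n]] and dwn = weak_derivative_works(1)[OF d[of n] e]
      have Am: "(\<lambda>x. complex_of_real (A x \<bullet> e)) \<in> borel_measurable ?M" using A(1)[OF e] by measurable
      have Ab: "cmod (complex_of_real (A x \<bullet> e)) \<le> C" for x using A(2)[OF e] by simp
      have "L2_norm ?M (\<lambda>x. ?D n x - ?Du x)
          = L2_norm ?M (\<lambda>x. \<i> * ?dw n x + complex_of_real (A x \<bullet> e) * (\<phi> n x - u x))"
      proof (rule L2_norm_cong_AE)
        show "(\<lambda>x. \<i> * ?dw n x + complex_of_real (A x \<bullet> e) * (\<phi> n x - u x)) \<in> L2_space ?M"
          by (rule magnetic_gradient_L2[OF dn dwn A(1)[OF e] A(2)[OF e]])
        show "AE x in ?M. ?D n x - ?Du x = \<i> * ?dw n x + complex_of_real (A x \<bullet> e) * (\<phi> n x - u x)"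
          using weak_derivative_lincomb[OF \<Omega> test_function_sobolev_H1[OF \<Omega> \<phi>(1)] u e, of 1 n "-1"]
            weak_derivative_test_function[OF \<Omega> \<phi>(1) e, of n]
        proof eventually_elim
          case (elim x)
          then have eq: "frechet_derivative (\<phi> n) (at x) e = weak_derivative \<Omega> e u x + ?dw n x" by simp
          show ?case unfolding eq by (simp add: algebra_simps)
        qed
      qed (rule L2_space_diff[OF D Du])
      then have "(L2_norm ?M (\<lambda>x. ?D n x - ?Du x))\<^sup>2
          \<le> 2 * (L2_norm ?M (\<lambda>x. \<i> * ?dw n x))\<^sup>2 + 2 * (L2_norm ?M (\<lambda>x. complex_of_real (A x \<bullet> e) * (\<phi> n x - u x)))\<^sup>2"
        using L2_norm_power2_add_le[OF L2_space_cmult[OF dwn, of \<i>] L2_space_bounded_mult[OF dn Am Ab]] by simp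
      also have "\<dots> \<le> 2 * (H1_norm \<Omega> (\<lambda>x. \<phi> n x - u x))\<^sup>2 + 2 * (C\<^sup>2 * (H1_norm \<Omega> (\<lambda>x. \<phi> n x - u x))\<^sup>2)"
      proof (intro add_mono mult_left_mono)
        show "(L2_norm ?M (\<lambda>x. \<i> * ?dw n x))\<^sup>2 \<le> (H1_norm \<Omega> (\<lambda>x. \<phi> n x - u x))\<^sup>2"
          using le1[OF e] by (simp add: L2_norm_cmult)
        have "(L2_norm ?M (\<lambda>x. complex_of_real (A x \<bullet> e) * (\<phi> n x - u x)))\<^sup>2
            \<le> C\<^sup>2 * (L2_norm ?M (\<lambda>x. \<phi> n x - u x))\<^sup>2"
          by (rule L2_norm_power2_bounded_mult_le[OF dn Am Ab])
        also have "\<dots> \<le> C\<^sup>2 * (H1_norm \<Omega> (\<lambda>x. \<phi> n x - u x))\<^sup>2"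
          by (intro mult_left_mono le0) auto
        finally show "(L2_norm ?M (\<lambda>x. complex_of_real (A x \<bullet> e) * (\<phi> n x - u x)))\<^sup>2
            \<le> C\<^sup>2 * (H1_norm \<Omega> (\<lambda>x. \<phi> n x - u x))\<^sup>2" .
      qed auto
      finally show ?thesis by (simp add: algebra_simps)
    qed
    have "(\<lambda>n. (2 + 2 * C\<^sup>2) * (H1_norm \<Omega> (\<lambda>x. \<phi> n x - u x))\<^sup>2) \<longlonglongrightarrow> (2 + 2 * C\<^sup>2) * 0"
      by (intro tendsto_mult tendsto_const sq)
    then have "(\<lambda>n. (2 + 2 * C\<^sup>2) * (H1_norm \<Omega> (\<lambda>x. \<phi> n x - u x))\<^sup>2) \<longlonglongrightarrow> 0" by simp
    then have "(\<lambda>n. (L2_norm ?M (\<lambda>x. ?D n x - ?Du x))\<^sup>2) \<longlonglongrightarrow> 0"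
      by (rule tendsto_sandwich[OF _ _ tendsto_const, rotated 2]) (auto intro!: always_eventually bd)
    from tendsto_real_sqrt[OF this] show "(\<lambda>n. L2_norm ?M (\<lambda>x. ?D n x - ?Du x)) \<longlonglongrightarrow> 0"
      by (simp add: L2_norm_nonneg)
  qed
  show ?thesis
    unfolding magnetic_energy_def
  proof (rule LIMSEQ_le)
    show "(\<lambda>n. \<beta> * (L2_norm lebesgue (\<phi> n \<circ> c))\<^sup>2) \<longlonglongrightarrow> \<beta> * (L2_norm lebesgue g)\<^sup>2"
      by (intro tendsto_mult tendsto_const limb)
    show "(\<lambda>n. (\<Sum>e\<in>Basis. (L2_norm ?M (\<lambda>x. \<i> * frechet_derivative (\<phi> n) (at x) e + complex_of_real (A x \<bullet> e) * \<phi> n x))\<^sup>2)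
        + \<mu> * (L2_norm ?M (\<phi> n))\<^sup>2)
      \<longlonglongrightarrow> (\<Sum>e\<in>Basis. (L2_norm ?M (\<lambda>x. \<i> * weak_derivative \<Omega> e u x + complex_of_real (A x \<bullet> e) * u x))\<^sup>2)
        + \<mu> * (L2_norm ?M u)\<^sup>2"
      by (intro tendsto_add tendsto_sum tendsto_mult tendsto_const lim0 limD)
    show "\<exists>N. \<forall>n\<ge>N. \<beta> * (L2_norm lebesgue (\<phi> n \<circ> c))\<^sup>2 \<le>
        (\<Sum>e\<in>Basis. (L2_norm ?M (\<lambda>x. \<i> * frechet_derivative (\<phi> n) (at x) e + complex_of_real (A x \<bullet> e) * \<phi> n x))\<^sup>2)
        + \<mu> * (L2_norm ?M (\<phi> n))\<^sup>2"
      using test[OF \<phi>] by blast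
  qed
qed

text \<open>For real \<open>t\<close> the real part of the polarization only involves the form at real multiples of \<open>u\<close>. This holds
  for an arbitrary real-valued \<open>q\<close>, before anything is known about its boundary term being quadratic.\<close>

lemma Re_polarization_multiple:
  fixes t :: real
  shows "Re (polarization q u (\<lambda>x. complex_of_real t * u x))
    = (q (\<lambda>x. complex_of_real (1 + t) * u x) - q (\<lambda>x. complex_of_real (1 - t) * u x)) / 4"
proof -
  have "(\<lambda>x. u x + \<i> ^ 0 * (complex_of_real t * u x)) = (\<lambda>x. complex_of_real (1 + t) * u x)"
    "(\<lambda>x. u x + \<i> ^ 2 * (complex_of_real t * u x)) = (\<lambda>x. complex_of_real (1 - t) * u x)"
    by (auto simp: algebra_simps)
  moreover have "{..<4::nat} = {0, 1, 2, 3}" by auto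
  moreover have "\<i> ^ 3 = - \<i>" by (simp add: power3_eq_cube)
  ultimately show ?thesis by (simp add: polarization_def)
qed

text \<open>If \<open>2 u\<close> has a trace, testing the eigenvalue equation with \<open>u\<close> itself compares \<open>q[2 u]\<close> with \<open>q[0] \<le> 0\<close>. If not,
  the boundary terms of all nonzero multiples of \<open>u\<close> are the integral of one and the same default
  function, and testing with \<open>2 u\<close> makes them cancel.\<close>

lemma magnetic_robin_no_eigenvalue_below:
  fixes A :: "'a::euclidean_space \<Rightarrow> 'a" and E \<mu> \<beta> :: real
  assumes \<Omega>: "open \<Omega>" and \<beta>: "\<beta> \<ge> 0" and \<mu>: "\<mu> \<ge> 0"
    and A: "\<And>e. e \<in> Basis \<Longrightarrow> (\<lambda>x. A x \<bullet> e) \<in> borel_measurable (lebesgue_on \<Omega>)" "\<And>x e. e \<in> Basis \<Longrightarrow> \<bar>A x \<bullet> e\<bar> \<le> C"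
    and ineq: "\<And>u g. u \<in> sobolev_H1 \<Omega> \<Longrightarrow> has_trace \<Omega> c u g \<Longrightarrow>
      \<beta> * (L2_norm lebesgue g)\<^sup>2 \<le> magnetic_energy A \<Omega> u + \<mu> * (L2_norm (lebesgue_on \<Omega>) u)\<^sup>2"
    and E: "E < - \<mu>"
  shows "\<not> eigenvalue (lebesgue_on \<Omega>) (magnetic_robin_laplacian A \<beta> \<Omega> c) (complex_of_real E)"
proof
  let ?M = "lebesgue_on \<Omega>" and ?q = "magnetic_robin_form A \<beta> \<Omega> c"
  assume "eigenvalue ?M (magnetic_robin_laplacian A \<beta> \<Omega> c) (complex_of_real E)"
  then obtain u where u: "u \<in> sobolev_H1 \<Omega>" and nz: "\<not> (AE x in ?M. u x = 0)"
    and eig: "\<And>v. v \<in> sobolev_H1 \<Omega> \<Longrightarrow> polarization ?q u v = L2_inner ?M (\<lambda>x. complex_of_real E * u x) v"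
    by (auto simp: eigenvalue_def eigenspace_def magnetic_robin_laplacian_def form_operator_def)
  define N where "N = (L2_norm ?M u)\<^sup>2"
  define Q where "Q = magnetic_energy A \<Omega> u"
  have intN: "integrable ?M (\<lambda>x. (cmod (u x))\<^sup>2)" using L2_space_integrable[OF sobolev_H1_L2[OF u]] .
  have N: "N > 0"
  proof (rule ccontr)
    assume "\<not> N > 0"
    then have "N = 0" by (simp add: N_def)
    then have "AE x in ?M. (cmod (u x))\<^sup>2 = 0"
      using integral_nonneg_eq_0_iff_AE[OF intN] by (simp add: N_def L2_norm_power2)
    then show False using nz by simp
  qed
  have Q0: "Q \<ge> 0" by (simp add: Q_def magnetic_energy_def sum_nonneg)
  have energy: "magnetic_energy A \<Omega> (\<lambda>x. complex_of_real r * u x) = r\<^sup>2 * Q" for r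
    using magnetic_energy_cmult[OF \<Omega> u A, of "complex_of_real r"] by (simp add: Q_def)
  have mem: "(\<lambda>x. complex_of_real r * u x) \<in> sobolev_H1 \<Omega>" for r
    by (rule sobolev_H1_cmult[OF \<Omega> u])
  have key: "E * t * N = (?q (\<lambda>x. complex_of_real (1 + t) * u x) - ?q (\<lambda>x. complex_of_real (1 - t) * u x)) / 4" for t
  proof -
    have "L2_inner ?M (\<lambda>x. complex_of_real E * u x) (\<lambda>x. complex_of_real t * u x)
        = (\<integral>x. complex_of_real (E * t * (cmod (u x))\<^sup>2) \<partial>?M)"
      unfolding L2_inner_def
    proof (intro Bochner_Integration.integral_cong refl)
      fix x
      have "complex_of_real E * u x * cnj (complex_of_real t * u x) = complex_of_real (E * t) * (u x * cnj (u x))"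
        by simp
      also have "\<dots> = complex_of_real (E * t * (cmod (u x))\<^sup>2)"
        by (simp only: complex_norm_square[symmetric] of_real_mult)
      finally show "complex_of_real E * u x * cnj (complex_of_real t * u x) = complex_of_real (E * t * (cmod (u x))\<^sup>2)" .
    qed
    also have "\<dots> = complex_of_real (E * t * N)"
      by (subst integral_complex_of_real) (simp add: N_def L2_norm_power2)
    finally have "polarization ?q u (\<lambda>x. complex_of_real t * u x) = complex_of_real (E * t * N)"
      using eig[OF mem] by simp
    then show ?thesis using Re_polarization_multiple[of ?q u t] by simp
  qed
  show False
  proof (cases "\<exists>g. has_trace \<Omega> c (\<lambda>x. complex_of_real 2 * u x) g")
    case True
    let ?u2 = "\<lambda>x. complex_of_real 2 * u x"
    have "has_trace \<Omega> c ?u2 (boundary_trace \<Omega> c ?u2)"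
      unfolding boundary_trace_def using True by (rule someI_ex)
    from ineq[OF mem this] have "?q ?u2 \<ge> - \<mu> * (L2_norm ?M ?u2)\<^sup>2"
      by (simp add: magnetic_robin_form_eq L2_norm_power2)
    also have "(L2_norm ?M ?u2)\<^sup>2 = 4 * N" by (simp add: L2_norm_cmult power_mult_distrib N_def)
    finally have 2: "?q ?u2 \<ge> - (4 * \<mu> * N)" by simp
    have 0: "?q (\<lambda>x. complex_of_real 0 * u x) \<le> 0"
      unfolding magnetic_robin_form_eq energy using \<beta> by simp
    have "E * N = (?q ?u2 - ?q (\<lambda>x. complex_of_real 0 * u x)) / 4" using key[of 1] by simp
    then have "E * N \<ge> - \<mu> * N" using 0 2 by simp
    moreover have "E * N < - \<mu> * N" using E N by (rule mult_strict_right_mono)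
    ultimately show False by simp
  next
    case False
    have none: "\<not> has_trace \<Omega> c (\<lambda>x. complex_of_real r * u x) g" if "r \<noteq> 0" for r g
    proof
      assume "has_trace \<Omega> c (\<lambda>x. complex_of_real r * u x) g"
      from has_trace_cmult[OF \<Omega> mem this, of "complex_of_real (2 / r)"]
      have "has_trace \<Omega> c (\<lambda>x. complex_of_real 2 * u x) (\<lambda>s. complex_of_real (2 / r) * g s)"
        using that by simp
      then show False using False by blast
    qed
    have "has_trace \<Omega> c (\<lambda>x. complex_of_real 3 * u x) = has_trace \<Omega> c (\<lambda>x. complex_of_real (-1) * u x)"
    proof
      fix g show "has_trace \<Omega> c (\<lambda>x. complex_of_real 3 * u x) g = has_trace \<Omega> c (\<lambda>x. complex_of_real (-1) * u x) g"
        using none[of 3 g] none[of "-1" g] by simp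
    qed
    then have "boundary_trace \<Omega> c (\<lambda>x. complex_of_real 3 * u x) = boundary_trace \<Omega> c (\<lambda>x. complex_of_real (-1) * u x)"
      unfolding boundary_trace_def by (simp only:)
    then have "?q (\<lambda>x. complex_of_real 3 * u x) - ?q (\<lambda>x. complex_of_real (-1) * u x) = 8 * Q"
      unfolding magnetic_robin_form_eq energy by simp
    then have "E * 2 * N = 2 * Q" using key[of 2] by simp
    moreover have "E * N < 0" using E \<mu> N by (intro mult_neg_pos) auto
    ultimately show False using Q0 by simp
  qed
qed

section \<open>Absence of discrete spectrum\<close>

lemma null_strip:
  assumes "N \<in> null_sets (lborel :: real measure)"
  shows "N \<times> (UNIV :: real set) \<in> null_sets lborel"
proof -
  have N: "N \<in> sets lborel" "emeasure lborel N = 0" using assms by auto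
  have "N \<times> UNIV \<in> sets (lborel \<Otimes>\<^sub>M lborel)" using N by auto
  moreover have "emeasure (lborel \<Otimes>\<^sub>M lborel) (N \<times> (UNIV :: real set)) = 0"
    using N lborel.emeasure_pair_measure_Times[of N lborel UNIV] by simp
  ultimately have "N \<times> UNIV \<in> null_sets (lborel \<Otimes>\<^sub>M (lborel :: real measure))" by (rule null_setsI[rotated])
  then show ?thesis by (simp only: lborel_prod)
qed

lemma AE_lborel_fst:
  assumes "AE x in (lborel :: real measure). P x"
  shows "AE p in (lborel :: (real \<times> real) measure). P (fst p)"
proof -
  obtain N where N: "N \<in> null_sets lborel" "{x \<in> space lborel. \<not> P x} \<subseteq> N"
    using assms unfolding eventually_ae_filter by blast
  show ?thesis
    by (rule AE_I'[OF null_strip[OF N(1)]]) (use N(2) in auto)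
qed

text \<open>Products of a null set with a line are null, so functions that are Lebesgue measurable in one
  variable remain Lebesgue measurable as functions on the plane.\<close>

lemma fst_measurable_lebesgue: "(fst :: real \<times> real \<Rightarrow> real) \<in> measurable lebesgue lebesgue"
proof (rule completion.measurable_completion2)
  show fst: "(fst :: real \<times> real \<Rightarrow> real) \<in> measurable lebesgue lborel"
  proof (rule measurable_completion)
    have "(fst :: real \<times> real \<Rightarrow> real) \<in> borel_measurable borel"
      by (intro borel_measurable_continuous_onI continuous_on_fst continuous_on_id)
    then show "(fst :: real \<times> real \<Rightarrow> real) \<in> measurable lborel lborel" by simp
  qed
  show "null_sets (lborel :: real measure)
      \<subseteq> null_sets (distr (lebesgue :: (real \<times> real) measure) lborel fst)"
  proof
    fix N :: "real set" assume N: "N \<in> null_sets lborel"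
    have "fst -` N = N \<times> (UNIV :: real set)" by auto
    then have "fst -` N \<in> null_sets (lebesgue :: (real \<times> real) measure)"
      using null_sets_completionI[OF null_strip[OF N]] by simp
    then show "N \<in> null_sets (distr (lebesgue :: (real \<times> real) measure) lborel fst)"
      unfolding null_sets_distr_iff[OF fst] space_completion space_lborel space_borel Int_UNIV_right
      using null_setsD2[OF N] by (rule conjI)
  qed
qed

lemma ennreal_L2_norm_power2:
  assumes "open \<Omega>" "f \<in> L2_space (lebesgue_on \<Omega>)"
  shows "ennreal ((L2_norm (lebesgue_on \<Omega>) f)\<^sup>2) = (\<integral>\<^sup>+x. indicator \<Omega> x * ennreal ((cmod (f x))\<^sup>2) \<partial>lborel)"
proof -
  let ?M = "lebesgue_on \<Omega>"
  have "ennreal ((L2_norm ?M f)\<^sup>2) = (\<integral>\<^sup>+x. ennreal ((cmod (f x))\<^sup>2) \<partial>?M)"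
    using assms(2) by (simp add: L2_norm_power2 L2_space_def nn_integral_eq_integral)
  also have "\<dots> = (\<integral>\<^sup>+x. ennreal ((cmod (f x))\<^sup>2) * indicator \<Omega> x \<partial>lebesgue)"
    using assms(1) by (intro nn_integral_restrict_space) (auto simp: borel_open)
  finally show ?thesis by (simp add: nn_integral_completion mult.commute)
qed

lemma ennreal_L2_norm_power2_lebesgue:
  assumes "f \<in> L2_space lebesgue"
  shows "ennreal ((L2_norm lebesgue f)\<^sup>2) = (\<integral>\<^sup>+x. ennreal ((cmod (f x))\<^sup>2) \<partial>lborel)"
  using assms by (simp add: L2_norm_power2 L2_space_def nn_integral_eq_integral[symmetric] nn_integral_completion)

lemma magnetic_potential_component:
  "magnetic_potential B a20 p \<bullet> (1, 0) = 0"
  "magnetic_potential B a20 p \<bullet> (0, 1) = B * a20 (fst p)"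
  by (simp_all add: magnetic_potential_def case_prod_unfold)

lemma Basis_real_prod: "(Basis :: (real \<times> real) set) = {(1, 0), (0, 1)}"
  by (auto simp: Basis_prod_def)

lemma magnetic_potential_measurable:
  assumes "a20 \<in> borel_measurable lebesgue" "e \<in> Basis"
  shows "(\<lambda>p. magnetic_potential B a20 p \<bullet> e) \<in> borel_measurable (lebesgue_on \<Omega>)"
proof -
  have "(\<lambda>p :: real \<times> real. a20 (fst p)) \<in> borel_measurable lebesgue"
    using measurable_compose[OF fst_measurable_lebesgue assms(1)] .
  then have "(\<lambda>p :: real \<times> real. B * a20 (fst p)) \<in> borel_measurable (lebesgue_on \<Omega>)"
    by (intro borel_measurable_times borel_measurable_const measurable_restrict_space1)
  then show ?thesis using assms(2) by (auto simp: Basis_real_prod magnetic_potential_component)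
qed

lemma magnetic_potential_bounded:
  assumes "\<And>x. \<bar>a20 x\<bar> \<le> C" "e \<in> Basis"
  shows "\<bar>magnetic_potential B a20 p \<bullet> e\<bar> \<le> \<bar>B\<bar> * C"
proof -
  have "0 \<le> C" using assms(1)[of 0] by linarith
  then show ?thesis using assms
    by (auto simp: Basis_real_prod magnetic_potential_component abs_mult intro!: mult_left_mono)
qed

text \<open>The energy inequality for the given potential. The Lebesgue measurable \<open>a20\<close> is replaced by a Borel
  function that agrees with it almost everywhere and equals \<open>x\<close> at every point of the strip, so that Tonelli's
  theorem and the pointwise transport argument both apply.\<close>

lemma robin_test_inequality:
  fixes \<phi> :: "real \<times> real \<Rightarrow> complex" and a20 h a b :: "real \<Rightarrow> real" and B \<beta> t H m \<alpha> \<kappa> :: real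
  defines "\<Omega> \<equiv> epigraph h"
  assumes \<phi>: "\<phi> \<in> test_functions UNIV" and trace: "\<phi> \<circ> (\<lambda>s. (a s, b s)) \<in> L2_space lebesgue"
    and B: "B > 0" and \<beta>: "\<beta> > 0" and t: "t > 0" and m: "m \<ge> 0" and mt: "m + t < \<alpha>"
    and a20: "a20 \<in> borel_measurable lebesgue" "\<And>x. \<bar>a20 x\<bar> \<le> C"
    and ax: "\<And>x. -\<alpha> < x \<Longrightarrow> x < \<alpha> \<Longrightarrow> a20 x = x"
    and h: "continuous_on UNIV h" and hH: "\<And>x. \<bar>h x\<bar> \<le> H"
    and \<kappa>: "0 \<le> \<kappa>" "\<kappa> \<le> 1 / 2" "2 * \<beta> * \<kappa> * holonomy_const B \<beta> t H m \<le> 1"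
    and da: "\<And>s. (a has_real_derivative a' s) (at s)" and cont: "continuous_on UNIV a'"
    and mono: "strict_mono a" and surj: "surj a" and bh: "\<And>s. b s = h (a s)"
    and lower: "\<And>s. 1 - \<kappa> \<le> a' s" and out: "\<And>s. \<bar>a s\<bar> > m \<Longrightarrow> a' s = 1"
  shows "\<beta> * (L2_norm lebesgue (\<phi> \<circ> (\<lambda>s. (a s, b s))))\<^sup>2 \<le>
    (\<Sum>e\<in>Basis. (L2_norm (lebesgue_on \<Omega>)
      (\<lambda>p. \<i> * frechet_derivative \<phi> (at p) e + complex_of_real (magnetic_potential B a20 p \<bullet> e) * \<phi> p))\<^sup>2)
    + \<beta>\<^sup>2 * (L2_norm (lebesgue_on \<Omega>) \<phi>)\<^sup>2"
proof -
  let ?M = "lebesgue_on \<Omega>"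
  have \<Omega>: "open \<Omega>" unfolding \<Omega>_def by (rule open_epigraph[OF h])
  have [measurable]: "\<Omega> \<in> sets borel" using \<Omega> by (rule borel_open)
  have "a20 \<in> borel_measurable (completion lborel)" using a20(1) .
  then obtain a1 where a1[measurable]: "a1 \<in> borel_measurable lborel" and ae1: "AE x in lborel. a20 x = a1 x"
    using completion_ex_borel_measurable_real by blast
  define a2 where "a2 x = (if \<bar>x\<bar> < \<alpha> then x else a1 x)" for x
  have a2[measurable]: "a2 \<in> borel_measurable borel" unfolding a2_def by measurable
  have a2x: "a2 x = x" if "\<bar>x\<bar> < \<alpha>" for x using that by (simp add: a2_def)
  have ae2: "AE x in lborel. a20 x = a2 x"
    using ae1 by eventually_elim (use ax in \<open>auto simp: a2_def abs_less_iff\<close>)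
  have [measurable]: "\<phi> \<in> borel_measurable borel" "(\<lambda>p. dx \<phi> p) \<in> borel_measurable borel"
    "(\<lambda>p. dy \<phi> p) \<in> borel_measurable borel"
    using \<phi> by (auto intro!: test_functions_borel[of _ UNIV] test_functions_frechet_derivative)
  have [measurable]: "(fst :: real \<times> real \<Rightarrow> real) \<in> borel_measurable borel"
    by (intro borel_measurable_continuous_onI continuous_on_fst continuous_on_id)
  let ?D = "\<lambda>p. \<i> * dy \<phi> p + complex_of_real (B * a20 (fst p)) * \<phi> p"
  let ?D2 = "\<lambda>p. \<i> * dy \<phi> p + complex_of_real (B * a2 (fst p)) * \<phi> p"
  have L\<phi>: "\<phi> \<in> L2_space ?M" using \<phi> \<Omega> by (rule test_functions_L2)
  have Ldx: "(\<lambda>p. dx \<phi> p) \<in> L2_space ?M" and Ldy: "(\<lambda>p. dy \<phi> p) \<in> L2_space ?M"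
    using \<phi> \<Omega> by (auto intro: test_functions_L2 test_functions_frechet_derivative)
  have LD: "?D \<in> L2_space ?M"
    unfolding magnetic_potential_component(2)[symmetric]
    by (rule magnetic_gradient_L2[OF L\<phi> Ldy magnetic_potential_measurable[OF a20(1)]
          magnetic_potential_bounded[OF a20(2)]]) (auto simp: Basis_real_prod)
  define T where "T = (\<integral>\<^sup>+s. ennreal ((cmod (\<phi> (a s, b s)))\<^sup>2) \<partial>lborel)"
  have T: "ennreal ((L2_norm lebesgue (\<phi> \<circ> (\<lambda>s. (a s, b s))))\<^sup>2) = T"
    using ennreal_L2_norm_power2_lebesgue[OF trace] by (simp add: T_def)
  obtain R where R: "\<And>p. norm p > R \<Longrightarrow> \<phi> p = 0" using test_functions_bounded_support[OF \<phi>] by blast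
  have "T \<le> (\<integral>\<^sup>+x. ennreal ((cmod (\<phi> (x, h x)))\<^sup>2) \<partial>lborel)
      + ennreal (2 * \<kappa>) * (\<integral>\<^sup>+x. indicator {-m..m} x * ennreal ((cmod (\<phi> (x, h x)))\<^sup>2) \<partial>lborel)"
    unfolding T_def bh
  proof (rule arc_length_integral_le[where \<psi>="\<lambda>x. (cmod (\<phi> (x, h x)))\<^sup>2" and a'=a' and R=R])
    have "continuous_on UNIV (\<lambda>x. \<phi> (x, h x))"
      by (intro continuous_on_compose2[OF test_functions_continuous[OF \<phi>, of UNIV]]
        continuous_on_Pair continuous_on_id h) auto
    then show "(\<lambda>x. (cmod (\<phi> (x, h x)))\<^sup>2) \<in> borel_measurable borel"
      by (intro borel_measurable_continuous_onI continuous_intros)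
    fix x :: real assume "R < \<bar>x\<bar>"
    then have "norm (x, h x) > R" using norm_fst_le[of x "h x"] by simp
    then show "(cmod (\<phi> (x, h x)))\<^sup>2 = 0" using R by simp
  qed (use da cont mono surj \<kappa> lower out in auto)
  from robin_energy_test_function[OF \<phi> B \<beta> t m mt a2 a2x h hH \<kappa>(1,3) this]
  have "ennreal \<beta> * T \<le> (\<integral>\<^sup>+p. indicator \<Omega> p * ennreal ((cmod (dx \<phi> p))\<^sup>2) \<partial>lborel)
    + (\<integral>\<^sup>+p. indicator \<Omega> p * ennreal ((cmod (?D2 p))\<^sup>2 + \<beta>\<^sup>2 * (cmod (\<phi> p))\<^sup>2) \<partial>lborel)"
    unfolding \<Omega>_def .
  also have "(\<integral>\<^sup>+p. indicator \<Omega> p * ennreal ((cmod (?D2 p))\<^sup>2 + \<beta>\<^sup>2 * (cmod (\<phi> p))\<^sup>2) \<partial>lborel)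
      = (\<integral>\<^sup>+p. indicator \<Omega> p * ennreal ((cmod (?D2 p))\<^sup>2) + ennreal (\<beta>\<^sup>2) * (indicator \<Omega> p * ennreal ((cmod (\<phi> p))\<^sup>2)) \<partial>lborel)"
    by (intro nn_integral_cong) (simp add: ennreal_plus ennreal_mult distrib_left mult_ac)
  also have "\<dots> = (\<integral>\<^sup>+p. indicator \<Omega> p * ennreal ((cmod (?D2 p))\<^sup>2) \<partial>lborel)
      + ennreal (\<beta>\<^sup>2) * (\<integral>\<^sup>+p. indicator \<Omega> p * ennreal ((cmod (\<phi> p))\<^sup>2) \<partial>lborel)"
    by (subst nn_integral_add, measurable, subst nn_integral_cmult, measurable)
  also have "(\<integral>\<^sup>+p. indicator \<Omega> p * ennreal ((cmod (?D2 p))\<^sup>2) \<partial>lborel)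
      = (\<integral>\<^sup>+p. indicator \<Omega> p * ennreal ((cmod (?D p))\<^sup>2) \<partial>lborel)"
  proof (rule nn_integral_cong_AE)
    show "AE p in lborel. indicator \<Omega> p * ennreal ((cmod (?D2 p))\<^sup>2) = indicator \<Omega> p * ennreal ((cmod (?D p))\<^sup>2)"
      using AE_lborel_fst[OF ae2] by eventually_elim simp
  qed
  also have "(\<integral>\<^sup>+p. indicator \<Omega> p * ennreal ((cmod (dx \<phi> p))\<^sup>2) \<partial>lborel)
      + ((\<integral>\<^sup>+p. indicator \<Omega> p * ennreal ((cmod (?D p))\<^sup>2) \<partial>lborel)
        + ennreal (\<beta>\<^sup>2) * (\<integral>\<^sup>+p. indicator \<Omega> p * ennreal ((cmod (\<phi> p))\<^sup>2) \<partial>lborel))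
      = ennreal ((L2_norm ?M (\<lambda>p. dx \<phi> p))\<^sup>2 + (L2_norm ?M ?D)\<^sup>2
          + \<beta>\<^sup>2 * (L2_norm ?M \<phi>)\<^sup>2)"
    unfolding ennreal_L2_norm_power2[OF \<Omega> L\<phi>, symmetric] ennreal_L2_norm_power2[OF \<Omega> Ldx, symmetric]
      ennreal_L2_norm_power2[OF \<Omega> LD, symmetric]
    by (simp add: ennreal_plus ennreal_mult add.assoc)
  finally have "ennreal (\<beta> * (L2_norm lebesgue (\<phi> \<circ> (\<lambda>s. (a s, b s))))\<^sup>2)
      \<le> ennreal ((L2_norm ?M (\<lambda>p. dx \<phi> p))\<^sup>2 + (L2_norm ?M ?D)\<^sup>2
          + \<beta>\<^sup>2 * (L2_norm ?M \<phi>)\<^sup>2)"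
    unfolding T[symmetric] using \<beta> by (simp add: ennreal_mult)
  then have "\<beta> * (L2_norm lebesgue (\<phi> \<circ> (\<lambda>s. (a s, b s))))\<^sup>2
      \<le> (L2_norm ?M (\<lambda>p. dx \<phi> p))\<^sup>2 + (L2_norm ?M ?D)\<^sup>2
          + \<beta>\<^sup>2 * (L2_norm ?M \<phi>)\<^sup>2"
    by (subst (asm) ennreal_le_iff) auto
  moreover have "(L2_norm ?M (\<lambda>p. \<i> * dx \<phi> p))\<^sup>2 = (L2_norm ?M (\<lambda>p. dx \<phi> p))\<^sup>2"
    by (simp add: L2_norm_cmult)
  ultimately show ?thesis
    by (simp add: Basis_real_prod magnetic_potential_component)
qed

theorem theorem1:
  fixes \<alpha> \<delta> c1 c2 \<sigma> :: real and a20 :: "real \<Rightarrow> real"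
  assumes "\<alpha> > 0" and "0 < \<delta>" and "\<delta> < \<alpha>"
    and "a20 \<in> borel_measurable lebesgue" and "bounded (range a20)"
    and "\<And>x. -\<alpha> < x \<Longrightarrow> x < \<alpha> \<Longrightarrow> a20 x = x"
    and "(a20 \<longlongrightarrow> 0) at_infinity"
    and "0 < c1" and "c1 < c2" and "\<sigma> \<ge> 2"
  shows "\<exists>\<beta>0>0. \<exists>\<epsilon>0 :: real \<Rightarrow> real. (\<forall>B>0. \<epsilon>0 B > 0) \<and>
    (\<forall>\<beta>>\<beta>0. \<forall>B. c1 * \<beta> powr \<sigma> \<le> B \<and> B \<le> c2 * \<beta> powr \<sigma> \<longrightarrow>
      (\<forall>a b \<Omega>.
         admissible_curve \<alpha> \<delta> a b \<and>
         curvilinear_upper_half_plane a b \<Omega> \<and>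
         max (Linf_norm (signed_curvature a b)) (Linf_norm (deriv (signed_curvature a b)))
           < ereal (\<epsilon>0 B) \<longrightarrow>
         discrete_spectrum (lebesgue_on \<Omega>)
           (magnetic_robin_laplacian (magnetic_potential B a20) \<beta> \<Omega> (\<lambda>s. (a s, b s)))
         \<inter> complex_of_real ` {..< -\<beta>\<^sup>2} = {}))"
proof -
  define m where "m = \<alpha> - \<delta>"
  define t where "t = \<delta> / 2"
  \<comment> \<open>the largest \<open>\<beta>\<close> compatible with \<open>c1 * \<beta> powr \<sigma> \<le> B\<close>\<close>
  define \<beta>max where "\<beta>max B = (B / c1) powr (1 / \<sigma>)" for B
  define K where "K B = holonomy_const B (\<beta>max B) t (3 * m) m" for B
  \<comment> \<open>\<open>2 * \<beta>max B * \<kappa> B * K B \<le> 1\<close> lets the Hardy type inequality absorb the excess of arc length;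
    \<open>\<kappa> B \<le> 1 / 3\<close> keeps \<open>a' \<ge> 2 / 3\<close> along the curve\<close>
  define \<kappa> where "\<kappa> B = min (1 / 3) (1 / (2 * \<beta>max B * K B))" for B
  \<comment> \<open>the strip is crossed within arc length \<open>3 * m\<close>, so \<open>a'\<close> drops by at most \<open>\<kappa> B\<close>\<close>
  define \<epsilon>0 where "\<epsilon>0 B = \<kappa> B / (3 * m)" for B
  have m: "m > 0" and t: "t > 0" and mt: "m + t < \<alpha>"
    using assms(1-3) by (auto simp: m_def t_def)
  have \<beta>max0: "\<beta>max B > 0" and K0: "K B > 0" if "B > 0" for B
    using that \<open>0 < c1\<close> m t holonomy_const_pos[of B t "3 * m" m "\<beta>max B"] by (auto simp: \<beta>max_def K_def)
  have \<kappa>0: "\<kappa> B > 0" if "B > 0" for B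
    using \<beta>max0[OF that] K0[OF that] by (simp add: \<kappa>_def)
  obtain C where C: "\<And>x. \<bar>a20 x\<bar> \<le> C"
    using assms(5) by (auto simp: bounded_iff)
  have "discrete_spectrum (lebesgue_on \<Omega>)
           (magnetic_robin_laplacian (magnetic_potential B a20) \<beta> \<Omega> (\<lambda>s. (a s, b s)))
         \<inter> complex_of_real ` {..< -\<beta>\<^sup>2} = {}"
    if \<beta>: "1 < \<beta>" and Blow: "c1 * \<beta> powr \<sigma> \<le> B" and adm: "admissible_curve \<alpha> \<delta> a b"
      and half: "curvilinear_upper_half_plane a b \<Omega>"
      and curv: "Linf_norm (signed_curvature a b) < ereal (\<epsilon>0 B)" for \<beta> B a b \<Omega>
  proof -
    have B: "B > 0" using Blow \<beta> \<open>0 < c1\<close> by (smt (verit) mult_pos_pos powr_gt_zero)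
    have \<beta>le: "\<beta> \<le> \<beta>max B"
    proof -
      have "(\<beta> powr \<sigma>) powr (1 / \<sigma>) \<le> (B / c1) powr (1 / \<sigma>)"
        using Blow \<open>0 < c1\<close> \<open>\<sigma> \<ge> 2\<close> by (intro powr_mono2) (auto simp: field_simps)
      then show ?thesis using \<beta> \<open>\<sigma> \<ge> 2\<close> by (simp add: powr_powr \<beta>max_def)
    qed
    have sm: "smooth a" "smooth b" and top: "filterlim a at_top at_top" and bot: "filterlim a at_bot at_bot"
      using adm by (auto simp: admissible_curve_def)
    have curv': "\<bar>signed_curvature a b s\<bar> \<le> \<epsilon>0 B" for s
      by (rule Linf_norm_bound[OF continuous_signed_curvature[OF sm] curv])
    have \<epsilon>: "\<epsilon>0 B * (3 * (\<alpha> - \<delta>)) \<le> \<kappa> B" "\<kappa> B \<le> 1 / 3"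
      using m by (auto simp: \<epsilon>0_def \<kappa>_def m_def)
    have m': "\<alpha> - \<delta> > 0" using m by (simp add: m_def)
    note geo = admissible_curve_almost_straight[OF adm m' curv' \<epsilon>, folded m_def]
    have da: "(a has_real_derivative deriv a s) (at s)" for s using smooth_real_deriv(1)[OF sm(1)] .
    have pos: "deriv a s > 0" for s using geo(1)[of s] \<epsilon>(2) by linarith
    obtain h where h: "continuous_on UNIV h" and bh: "\<And>s. b s = h (a s)" and mono: "strict_mono a" and surj: "surj a"
      using graph_parametrization[OF da pos top bot smooth_continuous_on[OF sm(2)]] by blast
    have \<Omega>: "\<Omega> = epigraph h" by (rule curvilinear_upper_half_plane_graph[OF h bh surj half])
    have hH: "\<bar>h x\<bar> \<le> 3 * m" for x
      using surjD[OF surj, of x] geo(4) bh by metis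
    have \<kappa>\<beta>: "2 * \<beta> * \<kappa> B * holonomy_const B \<beta> t (3 * m) m \<le> 1"
    proof -
      have "2 * \<beta> * \<kappa> B * holonomy_const B \<beta> t (3 * m) m \<le> 2 * \<beta>max B * \<kappa> B * K B"
        unfolding K_def using B t m \<beta> \<beta>le \<kappa>0[OF B] \<beta>max0[OF B] holonomy_const_pos[of B t "3 * m" m \<beta>]
        by (intro mult_mono holonomy_const_mono) auto
      also have "\<dots> \<le> 2 * \<beta>max B * (1 / (2 * \<beta>max B * K B)) * K B"
        using \<beta>max0[OF B] K0[OF B] by (intro mult_right_mono mult_left_mono) (auto simp: \<kappa>_def)
      also have "\<dots> = 1" using \<beta>max0[OF B] K0[OF B] by simp
      finally show ?thesis .
    qed
    let ?A = "magnetic_potential B a20" and ?c = "\<lambda>s. (a s, b s)"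
    have open\<Omega>: "open \<Omega>" unfolding \<Omega> by (rule open_epigraph[OF h])
    note A = magnetic_potential_measurable[OF assms(4)] magnetic_potential_bounded[OF C]
    have test: "\<beta> * (L2_norm lebesgue (\<phi> \<circ> ?c))\<^sup>2 \<le>
        (\<Sum>e\<in>Basis. (L2_norm (lebesgue_on \<Omega>) (\<lambda>p. \<i> * frechet_derivative \<phi> (at p) e + complex_of_real (?A p \<bullet> e) * \<phi> p))\<^sup>2)
        + \<beta>\<^sup>2 * (L2_norm (lebesgue_on \<Omega>) \<phi>)\<^sup>2"
      if "\<phi> \<in> test_functions UNIV" "\<phi> \<circ> ?c \<in> L2_space lebesgue" for \<phi>
      unfolding \<Omega>
    proof (rule robin_test_inequality[OF that B _ t _ mt assms(4) C assms(6) h hH _ _ \<kappa>\<beta> da _ mono surj bh])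
      show "continuous_on UNIV (deriv a)" using smooth_real_deriv(2)[OF sm(1)] by (rule smooth_continuous_on)
    qed (use \<beta> m \<kappa>0[OF B] \<epsilon>(2) geo in auto)
    have "\<not> eigenvalue (lebesgue_on \<Omega>) (magnetic_robin_laplacian ?A \<beta> \<Omega> ?c) (complex_of_real E)" if "E < - \<beta>\<^sup>2" for E
    proof (rule magnetic_robin_no_eigenvalue_below[OF open\<Omega> _ _ A _ that])
      fix u g assume "u \<in> sobolev_H1 \<Omega>" "has_trace \<Omega> ?c u g"
      with magnetic_robin_inequality_closure[OF open\<Omega> A test]
      show "\<beta> * (L2_norm lebesgue g)\<^sup>2 \<le> magnetic_energy ?A \<Omega> u + \<beta>\<^sup>2 * (L2_norm (lebesgue_on \<Omega>) u)\<^sup>2"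
        by blast
    qed (use \<beta> in auto)
    then show ?thesis by (auto simp: discrete_spectrum_def)
  qed
  then have main: "\<forall>\<beta>>1. \<forall>B. c1 * \<beta> powr \<sigma> \<le> B \<and> B \<le> c2 * \<beta> powr \<sigma> \<longrightarrow>
      (\<forall>a b \<Omega>.
         admissible_curve \<alpha> \<delta> a b \<and>
         curvilinear_upper_half_plane a b \<Omega> \<and>
         max (Linf_norm (signed_curvature a b)) (Linf_norm (deriv (signed_curvature a b)))
           < ereal (\<epsilon>0 B) \<longrightarrow>
         discrete_spectrum (lebesgue_on \<Omega>)
           (magnetic_robin_laplacian (magnetic_potential B a20) \<beta> \<Omega> (\<lambda>s. (a s, b s)))
         \<inter> complex_of_real ` {..< -\<beta>\<^sup>2} = {})"
    by (auto simp: max_less_iff_conj)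
  have "\<forall>B>0. \<epsilon>0 B > 0" using \<kappa>0 m by (simp add: \<epsilon>0_def)
  then show ?thesis
    using main by (intro exI[of _ 1] exI[of _ \<epsilon>0] conjI) auto
qed

end
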